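(* Assume $ZF + AD^{L(\mathbb R)}$. Then $HP(\mathrm{HOD})$ does not hold.
   Context: $AD^{L(\mathbb R)}$ is the statement that the Axiom of Determinacy holds in $L(\mathbb R)$; $\mathrm{HOD}$ is the class of hereditarily ordinal definable sets. For a real $x$, a limit ordinal $\alpha>\omega$ is $x$-admissible if there is no $\Sigma_1(L_\alpha[x])$ mapping from an ordinal $\delta<\alpha$ cofinally into $\alpha$. For an inner model $M$, the Generalized Harrington's Principle $HP(M)$ is the statement: there is a real $x$ such that for any ordinal $\alpha$, if $\alpha$ is $x$-admissible then $\alpha$ is an $M$-cardinal, i.e., $M\models$ "$\alpha$ is a cardinal". *)

theory Defs
  imports Main
begin

text \<open>
  Provability from ZF is rendered as truth in all models of ZF.  A structure for the language of
  set theory is a carrier \<open>U\<close> with a binary relation.  Every notion below unfolds to a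
  first-order formula over that structure: quantifiers range over \<open>U\<close> only, and sets of type
  \<^typ>\<open>'a set\<close> are classes given by such a formula, never quantified over.  Relativising a
  notion to an inner model \<open>M\<close> therefore amounts to replacing \<open>U\<close> by \<open>M\<close>.  In particular,
  \<open>\<omega>\<close>, formulas and satisfaction are those of the model, which need not be an
  \<open>\<omega>\<close>-model or well-founded; an HOL inductive definition of them would be wrong here.
\<close>

text \<open>
  Formulas of the metalanguage, used only for the two axiom schemas.
\<close>

datatype fm = Mem nat nat | Equal nat nat | Neg fm | Conj fm fm | Exists nat fm

locale set_structure =
  fixes U :: "'a set"
    and mem :: "'a \<Rightarrow> 'a \<Rightarrow> bool"
begin

definition el :: "'a \<Rightarrow> 'a set" where
  "el x = {z \<in> U. mem z x}"

primrec sat :: "fm \<Rightarrow> (nat \<Rightarrow> 'a) \<Rightarrow> bool" where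
  "sat (Mem i j) e \<longleftrightarrow> mem (e i) (e j)"
| "sat (Equal i j) e \<longleftrightarrow> e i = e j"
| "sat (Neg p) e \<longleftrightarrow> \<not> sat p e"
| "sat (Conj p q) e \<longleftrightarrow> sat p e \<and> sat q e"
| "sat (Exists i p) e \<longleftrightarrow> (\<exists>a\<in>U. sat p (e(i := a)))"


section \<open>The axioms of ZF\<close>

definition extensionality :: bool where
  "extensionality \<longleftrightarrow> (\<forall>x\<in>U. \<forall>y\<in>U. el x = el y \<longrightarrow> x = y)"

definition foundation :: bool where
  "foundation \<longleftrightarrow> (\<forall>x\<in>U. el x \<noteq> {} \<longrightarrow> (\<exists>y\<in>el x. el y \<inter> el x = {}))"

definition pairing :: bool where
  "pairing \<longleftrightarrow> (\<forall>a\<in>U. \<forall>b\<in>U. \<exists>p\<in>U. el p = {a, b})"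

definition union_axiom :: bool where
  "union_axiom \<longleftrightarrow> (\<forall>x\<in>U. \<exists>u\<in>U. el u = (\<Union>y\<in>el x. el y))"

definition power_set_axiom :: bool where
  "power_set_axiom \<longleftrightarrow> (\<forall>x\<in>U. \<exists>p\<in>U. el p = {y \<in> U. el y \<subseteq> el x})"

definition infinity :: bool where
  "infinity \<longleftrightarrow> (\<exists>x\<in>U. (\<exists>z\<in>el x. el z = {}) \<and>
     (\<forall>y\<in>el x. \<exists>z\<in>el x. el z = insert y (el y)))"

definition separation :: bool where
  "separation \<longleftrightarrow> (\<forall>\<phi> e. range e \<subseteq> U \<longrightarrow>
     (\<forall>x\<in>U. \<exists>y\<in>U. el y = {z \<in> el x. sat \<phi> (e(0 := z))}))"

definition replacement :: bool where
  "replacement \<longleftrightarrow> (\<forall>\<phi> e. range e \<subseteq> U \<longrightarrow>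
     (\<forall>a\<in>U. \<forall>b\<in>U. \<forall>c\<in>U. sat \<phi> (e(0 := a, 1 := b)) \<and> sat \<phi> (e(0 := a, 1 := c)) \<longrightarrow> b = c) \<longrightarrow>
     (\<forall>x\<in>U. \<exists>y\<in>U. el y = {b \<in> U. \<exists>a\<in>el x. sat \<phi> (e(0 := a, 1 := b))}))"

definition ZF :: bool where
  "ZF \<longleftrightarrow> extensionality \<and> foundation \<and> pairing \<and> union_axiom \<and> power_set_axiom \<and>
     infinity \<and> separation \<and> replacement"


section \<open>Functions and ordinals\<close>

definition is_pair :: "'a \<Rightarrow> 'a \<Rightarrow> 'a \<Rightarrow> bool" where
  "is_pair a b p \<longleftrightarrow> (\<exists>s\<in>U. \<exists>d\<in>U. el s = {a} \<and> el d = {a, b} \<and> el p = {s, d})"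

text \<open>The pair of \<open>a\<close> and \<open>b\<close> belongs to \<open>f\<close>.\<close>

definition app :: "'a \<Rightarrow> 'a \<Rightarrow> 'a \<Rightarrow> bool" where
  "app f a b \<longleftrightarrow> (\<exists>p\<in>el f. is_pair a b p)"

definition maps :: "'a \<Rightarrow> 'a set \<Rightarrow> 'a set \<Rightarrow> bool" where
  "maps f A B \<longleftrightarrow> (\<forall>p\<in>el f. \<exists>a\<in>A. \<exists>b\<in>B. is_pair a b p) \<and> (\<forall>a\<in>A. \<exists>!b. b \<in> B \<and> app f a b)"

definition bijection :: "'a \<Rightarrow> 'a set \<Rightarrow> 'a set \<Rightarrow> bool" where
  "bijection f A B \<longleftrightarrow> maps f A B \<and> (\<forall>b\<in>B. \<exists>!a. a \<in> A \<and> app f a b)"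

definition transitive :: "'a \<Rightarrow> bool" where
  "transitive x \<longleftrightarrow> (\<forall>y\<in>el x. el y \<subseteq> el x)"

text \<open>Well-foundedness of the membership relation on \<open>x\<close> is supplied by the axiom of foundation.\<close>

definition ordinal :: "'a \<Rightarrow> bool" where
  "ordinal x \<longleftrightarrow> transitive x \<and> (\<forall>y\<in>el x. \<forall>z\<in>el x. mem y z \<or> y = z \<or> mem z y)"

definition is_succ :: "'a \<Rightarrow> 'a \<Rightarrow> bool" where
  "is_succ x y \<longleftrightarrow> el y = insert x (el x)"

definition limit_ordinal :: "'a \<Rightarrow> bool" where
  "limit_ordinal x \<longleftrightarrow> ordinal x \<and> el x \<noteq> {} \<and> (\<forall>y\<in>el x. \<exists>z\<in>el x. mem y z)"

definition omega :: "'a set" where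
  "omega = {n \<in> U. ordinal n \<and> (\<forall>m\<in>insert n (el n). \<not> limit_ordinal m)}"

definition cardinal :: "'a \<Rightarrow> bool" where
  "cardinal x \<longleftrightarrow> ordinal x \<and> \<not> (\<exists>y\<in>el x. \<exists>f\<in>U. bijection f (el y) (el x))"

definition real_set :: "'a \<Rightarrow> bool" where
  "real_set x \<longleftrightarrow> el x \<subseteq> omega"

text \<open>\<open>t\<close> is the transitive closure of the singleton of \<open>x\<close>.\<close>

definition is_tc :: "'a \<Rightarrow> 'a \<Rightarrow> bool" where
  "is_tc x t \<longleftrightarrow> transitive t \<and> x \<in> el t \<and>
     (\<forall>s\<in>U. transitive s \<and> x \<in> el s \<longrightarrow> el t \<subseteq> el s)"


section \<open>Formulas and satisfaction inside the model\<close>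

text \<open>
  Codes of formulas in the language with membership, equality and one unary predicate symbol, and
  with variables indexed by \<open>\<omega>\<close>.  A code is a pair whose first component is one of the numerals
  \<open>0, \<dots>, 5\<close> of the model.
\<close>

primrec is_numeral :: "nat \<Rightarrow> 'a \<Rightarrow> bool" where
  "is_numeral 0 x \<longleftrightarrow> el x = {}"
| "is_numeral (Suc k) x \<longleftrightarrow> (\<exists>y\<in>U. is_numeral k y \<and> is_succ y x)"

definition tagged :: "nat \<Rightarrow> 'a \<Rightarrow> 'a \<Rightarrow> bool" where
  "tagged k a c \<longleftrightarrow> (\<exists>t\<in>U. is_numeral k t \<and> is_pair t a c)"

definition tagged2 :: "nat \<Rightarrow> 'a \<Rightarrow> 'a \<Rightarrow> 'a \<Rightarrow> bool" where
  "tagged2 k a b c \<longleftrightarrow> (\<exists>p\<in>U. is_pair a b p \<and> tagged k p c)"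

definition mem_code :: "'a \<Rightarrow> 'a \<Rightarrow> 'a \<Rightarrow> bool" where
  "mem_code = tagged2 0"

definition eq_code :: "'a \<Rightarrow> 'a \<Rightarrow> 'a \<Rightarrow> bool" where
  "eq_code = tagged2 1"

definition pred_code :: "'a \<Rightarrow> 'a \<Rightarrow> bool" where
  "pred_code = tagged 2"

definition neg_code :: "'a \<Rightarrow> 'a \<Rightarrow> bool" where
  "neg_code = tagged 3"

definition conj_code :: "'a \<Rightarrow> 'a \<Rightarrow> 'a \<Rightarrow> bool" where
  "conj_code = tagged2 4"

definition ex_code :: "'a \<Rightarrow> 'a \<Rightarrow> 'a \<Rightarrow> bool" where
  "ex_code = tagged2 5"

definition atomic_code :: "'a \<Rightarrow> bool" where
  "atomic_code c \<longleftrightarrow> (\<exists>i\<in>omega. \<exists>j\<in>omega. mem_code i j c \<or> eq_code i j c \<or> pred_code i c)"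

definition boolean_closed :: "'a set \<Rightarrow> bool" where
  "boolean_closed S \<longleftrightarrow> (\<forall>c\<in>U. (\<exists>f\<in>S. neg_code f c) \<or> (\<exists>f\<in>S. \<exists>g\<in>S. conj_code f g c) \<longrightarrow> c \<in> S)"

definition ex_closed :: "'a set \<Rightarrow> bool" where
  "ex_closed S \<longleftrightarrow> (\<forall>c\<in>U. (\<exists>i\<in>omega. \<exists>f\<in>S. ex_code i f c) \<longrightarrow> c \<in> S)"

text \<open>Bounded quantification \<open>\<exists>v\<^sub>i \<in> v\<^sub>j. f\<close> with \<open>i \<noteq> j\<close>, written as \<open>\<exists>v\<^sub>i. v\<^sub>i \<in> v\<^sub>j \<and> f\<close>.\<close>

definition bounded_ex_closed :: "'a set \<Rightarrow> bool" where
  "bounded_ex_closed S \<longleftrightarrow> (\<forall>c\<in>U.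
     (\<exists>i\<in>omega. \<exists>j\<in>omega. \<exists>f\<in>S. \<exists>m\<in>U. \<exists>g\<in>U.
        i \<noteq> j \<and> mem_code i j m \<and> conj_code m f g \<and> ex_code i g c) \<longrightarrow> c \<in> S)"

definition Formula :: "'a set" where
  "Formula = {c \<in> U. \<forall>S\<in>U.
     (\<forall>d\<in>U. atomic_code d \<longrightarrow> d \<in> el S) \<and> boolean_closed (el S) \<and> ex_closed (el S) \<longrightarrow> c \<in> el S}"

definition Delta0 :: "'a set" where
  "Delta0 = {c \<in> U. \<forall>S\<in>U.
     (\<forall>d\<in>U. atomic_code d \<longrightarrow> d \<in> el S) \<and> boolean_closed (el S) \<and> bounded_ex_closed (el S)
       \<longrightarrow> c \<in> el S}"

definition Sigma1 :: "'a set" where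
  "Sigma1 = {c \<in> U. \<forall>S\<in>U. Delta0 \<subseteq> el S \<and> ex_closed (el S) \<longrightarrow> c \<in> el S}"

text \<open>
  Assignments are partial functions from \<open>\<omega>\<close> to \<open>A\<close>, so that there is one even if \<open>A\<close> is empty.
  Atomic formulas containing an unassigned variable count as false; since this amounts to replacing
  such an atom by a contradictory one, no definable or \<open>\<Sigma>\<^sub>1\<close>-definable sets are gained or lost.
\<close>

definition assignments :: "'a set \<Rightarrow> 'a set" where
  "assignments A = {e \<in> U. (\<forall>p\<in>el e. \<exists>i\<in>omega. \<exists>a\<in>A. is_pair i a p) \<and>
     (\<forall>i\<in>U. \<forall>a\<in>U. \<forall>b\<in>U. app e i a \<and> app e i b \<longrightarrow> a = b)}"

text \<open>\<open>e'\<close> is \<open>e\<close> with the value at \<open>i\<close> changed to \<open>a\<close>.\<close>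

definition update :: "'a \<Rightarrow> 'a \<Rightarrow> 'a \<Rightarrow> 'a \<Rightarrow> bool" where
  "update e i a e' \<longleftrightarrow>
     el e' = {p \<in> U. is_pair i a p} \<union> {p \<in> el e. \<not> (\<exists>b\<in>U. is_pair i b p)}"

text \<open>
  \<open>T\<close> is a satisfaction relation, as a set of pairs of formulas and assignments, for the structure
  \<open>A\<close> with the membership relation and the unary predicate \<open>P\<close>.
\<close>

definition satisfaction_relation :: "'a set \<Rightarrow> 'a set \<Rightarrow> 'a \<Rightarrow> bool" where
  "satisfaction_relation A P T \<longleftrightarrow> (\<forall>c\<in>Formula. \<forall>e\<in>assignments A.
     (\<forall>i\<in>omega. \<forall>j\<in>omega. mem_code i j c \<longrightarrow>
        (app T c e \<longleftrightarrow> (\<exists>a\<in>U. \<exists>b\<in>U. app e i a \<and> app e j b \<and> mem a b))) \<and>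
     (\<forall>i\<in>omega. \<forall>j\<in>omega. eq_code i j c \<longrightarrow>
        (app T c e \<longleftrightarrow> (\<exists>a\<in>U. app e i a \<and> app e j a))) \<and>
     (\<forall>i\<in>omega. pred_code i c \<longrightarrow>
        (app T c e \<longleftrightarrow> (\<exists>a\<in>U. app e i a \<and> a \<in> P))) \<and>
     (\<forall>f\<in>Formula. neg_code f c \<longrightarrow>
        (app T c e \<longleftrightarrow> \<not> app T f e)) \<and>
     (\<forall>f\<in>Formula. \<forall>g\<in>Formula. conj_code f g c \<longrightarrow>
        (app T c e \<longleftrightarrow> app T f e \<and> app T g e)) \<and>
     (\<forall>i\<in>omega. \<forall>f\<in>Formula. ex_code i f c \<longrightarrow>
        (app T c e \<longleftrightarrow> (\<exists>a\<in>A. \<exists>e'\<in>U. update e i a e' \<and> app T f e'))))"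

definition satisfies :: "'a set \<Rightarrow> 'a set \<Rightarrow> 'a \<Rightarrow> 'a \<Rightarrow> bool" where
  "satisfies A P c e \<longleftrightarrow> (\<exists>T\<in>U. satisfaction_relation A P T \<and> app T c e)"

text \<open>Definability over \<open>(A, \<in>, P \<inter> A)\<close> with parameters from \<open>A\<close>.\<close>

definition definable_subset :: "'a set \<Rightarrow> 'a set \<Rightarrow> 'a \<Rightarrow> bool" where
  "definable_subset A P X \<longleftrightarrow> el X \<subseteq> A \<and>
     (\<exists>c\<in>Formula. \<exists>e\<in>assignments A. \<exists>i\<in>omega. \<forall>a\<in>A.
        a \<in> el X \<longleftrightarrow> (\<exists>e'\<in>U. update e i a e' \<and> satisfies A P c e'))"

definition Sigma1_function :: "'a set \<Rightarrow> 'a set \<Rightarrow> 'a \<Rightarrow> bool" where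
  "Sigma1_function A P f \<longleftrightarrow>
     (\<exists>c\<in>Sigma1. \<exists>e\<in>assignments A. \<exists>i\<in>omega. \<exists>j\<in>omega. i \<noteq> j \<and> (\<forall>a\<in>A. \<forall>b\<in>A.
        app f a b \<longleftrightarrow>
          (\<exists>e'\<in>U. \<exists>e''\<in>U. update e i a e' \<and> update e' j b e'' \<and> satisfies A P c e'')))"


section \<open>Cumulative hierarchies\<close>

definition is_Pow :: "'a \<Rightarrow> 'a \<Rightarrow> bool" where
  "is_Pow A D \<longleftrightarrow> el D = {X \<in> U. el X \<subseteq> el A}"

definition is_Def :: "'a set \<Rightarrow> 'a \<Rightarrow> 'a \<Rightarrow> bool" where
  "is_Def P A D \<longleftrightarrow> el D = {X \<in> U. definable_subset (el A) P X}"

text \<open>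
  \<open>h\<close> lists the levels up to \<open>\<alpha>\<close> of the hierarchy that starts with \<open>B\<close>, applies \<open>step\<close> at
  successors and takes unions at limits.
\<close>

definition hierarchy :: "('a \<Rightarrow> 'a \<Rightarrow> bool) \<Rightarrow> 'a \<Rightarrow> 'a \<Rightarrow> 'a \<Rightarrow> bool" where
  "hierarchy step B \<alpha> h \<longleftrightarrow> (\<forall>\<beta>\<in>insert \<alpha> (el \<alpha>).
     (\<exists>!A. A \<in> U \<and> app h \<beta> A) \<and>
     (\<forall>A\<in>U. app h \<beta> A \<longrightarrow>
        (el \<beta> = {} \<longrightarrow> A = B) \<and>
        (\<forall>\<gamma>\<in>U. \<forall>C\<in>U. is_succ \<gamma> \<beta> \<and> app h \<gamma> C \<longrightarrow> step C A) \<and>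
        (limit_ordinal \<beta> \<longrightarrow> el A = {z \<in> U. \<exists>\<gamma>\<in>el \<beta>. \<exists>C\<in>U. app h \<gamma> C \<and> z \<in> el C})))"

definition level :: "('a \<Rightarrow> 'a \<Rightarrow> bool) \<Rightarrow> 'a \<Rightarrow> 'a \<Rightarrow> 'a \<Rightarrow> bool" where
  "level step B \<alpha> A \<longleftrightarrow> ordinal \<alpha> \<and> (\<exists>h\<in>U. hierarchy step B \<alpha> h \<and> app h \<alpha> A)"

text \<open>\<open>A = V\<^sub>\<alpha>\<close>\<close>

definition V_level :: "'a \<Rightarrow> 'a \<Rightarrow> bool" where
  "V_level \<alpha> A \<longleftrightarrow> (\<exists>B\<in>U. el B = {} \<and> level is_Pow B \<alpha> A)"

text \<open>\<open>A = L\<^sub>\<alpha>[x]\<close>, where \<open>L\<^bsub>\<alpha>+1\<^esub>[x]\<close> consists of the subsets of \<open>L\<^sub>\<alpha>[x]\<close> definable over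
  \<open>(L\<^sub>\<alpha>[x], \<in>, x \<inter> L\<^sub>\<alpha>[x])\<close>.\<close>

definition L_level :: "'a \<Rightarrow> 'a \<Rightarrow> 'a \<Rightarrow> bool" where
  "L_level x \<alpha> A \<longleftrightarrow> (\<exists>B\<in>U. el B = {} \<and> level (is_Def (el x)) B \<alpha> A)"

text \<open>The class \<open>L(\<real>)\<close>, where \<open>L\<^sub>0(\<real>)\<close> is the transitive closure of \<open>{\<real>}\<close>.\<close>

definition L_R :: "'a set" where
  "L_R = {y \<in> U. \<exists>r\<in>U. el r = {x \<in> U. real_set x} \<and>
     (\<exists>B\<in>U. is_tc r B \<and> (\<exists>\<alpha>\<in>U. \<exists>A\<in>U. level (is_Def {}) B \<alpha> A \<and> y \<in> el A))}"

text \<open>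
  \<open>a\<close> is ordinal definable iff for some \<open>\<alpha>\<close> it is definable over \<open>V\<^sub>\<alpha>\<close> from ordinals below
  \<open>\<alpha>\<close>; by reflection this expresses definability from ordinals over the universe.
\<close>

definition OD :: "'a set" where
  "OD = {a \<in> U. \<exists>\<alpha>\<in>U. \<exists>A\<in>U. V_level \<alpha> A \<and> a \<in> el A \<and>
     (\<exists>c\<in>Formula. \<exists>e\<in>assignments {\<beta> \<in> el A. ordinal \<beta>}. \<exists>i\<in>omega. \<forall>b\<in>el A.
        b = a \<longleftrightarrow> (\<exists>e'\<in>U. update e i b e' \<and> satisfies (el A) {} c e'))}"

definition HOD :: "'a set" where
  "HOD = {x \<in> U. \<exists>t\<in>U. is_tc x t \<and> el t \<subseteq> OD}"


section \<open>The Axiom of Determinacy\<close>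

definition even_number :: "'a \<Rightarrow> bool" where
  "even_number n \<longleftrightarrow> n \<in> omega \<and> (\<exists>s\<in>U. n \<in> el s \<and>
     (\<forall>k\<in>omega. k \<in> el s \<longleftrightarrow> el k = {} \<or> (\<exists>j\<in>omega. is_succ j k \<and> j \<notin> el s)))"

definition finite_sequences :: "'a set" where
  "finite_sequences = {s \<in> U. \<exists>n\<in>omega. maps s (el n) omega}"

definition infinite_sequences :: "'a set" where
  "infinite_sequences = {x \<in> U. maps x omega omega}"

definition restriction :: "'a \<Rightarrow> 'a \<Rightarrow> 'a \<Rightarrow> bool" where
  "restriction x n s \<longleftrightarrow> el s = {p \<in> el x. \<exists>k\<in>el n. \<exists>v\<in>U. is_pair k v p}"

definition strategy :: "'a \<Rightarrow> bool" where
  "strategy \<sigma> \<longleftrightarrow> maps \<sigma> finite_sequences omega"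

text \<open>Player I makes the moves with even index, player II those with odd index.\<close>

definition follows_I :: "'a \<Rightarrow> 'a \<Rightarrow> bool" where
  "follows_I \<sigma> x \<longleftrightarrow> (\<forall>n\<in>omega. even_number n \<longrightarrow>
     (\<forall>s\<in>U. \<forall>k\<in>U. restriction x n s \<and> app x n k \<longrightarrow> app \<sigma> s k))"

definition follows_II :: "'a \<Rightarrow> 'a \<Rightarrow> bool" where
  "follows_II \<sigma> x \<longleftrightarrow> (\<forall>n\<in>omega. \<not> even_number n \<longrightarrow>
     (\<forall>s\<in>U. \<forall>k\<in>U. restriction x n s \<and> app x n k \<longrightarrow> app \<sigma> s k))"

definition determined :: "'a \<Rightarrow> bool" where
  "determined A \<longleftrightarrow>
     (\<exists>\<sigma>\<in>U. strategy \<sigma> \<and> (\<forall>x\<in>infinite_sequences. follows_I \<sigma> x \<longrightarrow> x \<in> el A)) \<or>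
     (\<exists>\<sigma>\<in>U. strategy \<sigma> \<and> (\<forall>x\<in>infinite_sequences. follows_II \<sigma> x \<longrightarrow> x \<notin> el A))"

definition AD :: bool where
  "AD \<longleftrightarrow> (\<forall>A\<in>U. el A \<subseteq> infinite_sequences \<longrightarrow> determined A)"

definition AD_L_R :: bool where
  "AD_L_R \<longleftrightarrow> set_structure.AD L_R mem"


section \<open>Admissible ordinals and the generalized Harrington principle\<close>

definition cofinal_map :: "'a \<Rightarrow> 'a \<Rightarrow> 'a \<Rightarrow> bool" where
  "cofinal_map f \<delta> \<alpha> \<longleftrightarrow> maps f (el \<delta>) (el \<alpha>) \<and>
     (\<forall>\<beta>\<in>el \<alpha>. \<exists>\<gamma>\<in>el \<delta>. \<exists>\<eta>\<in>el \<alpha>. app f \<gamma> \<eta> \<and> (mem \<beta> \<eta> \<or> \<beta> = \<eta>))"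

definition admissible :: "'a \<Rightarrow> 'a \<Rightarrow> bool" where
  "admissible x \<alpha> \<longleftrightarrow> limit_ordinal \<alpha> \<and> (\<exists>w\<in>el \<alpha>. el w = omega) \<and>
     (\<exists>A\<in>U. L_level x \<alpha> A \<and>
        \<not> (\<exists>\<delta>\<in>el \<alpha>. \<exists>f\<in>U. cofinal_map f \<delta> \<alpha> \<and> Sigma1_function (el A) (el x) f))"

definition HP :: "'a set \<Rightarrow> bool" where
  "HP M \<longleftrightarrow> (\<exists>x\<in>U. real_set x \<and>
     (\<forall>\<alpha>\<in>U. ordinal \<alpha> \<and> admissible x \<alpha> \<longrightarrow> \<alpha> \<in> M \<and> set_structure.cardinal M mem \<alpha>))"

end

end

theory Submission
  imports Defs
begin

text \<open>
  Let \<open>x\<close> be a real.  An \<open>x\<close>-admissible ordinal \<open>\<mu>\<close> is constructed together with an ordinal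
  definable bijection of a smaller ordinal with \<open>\<mu>\<close>; so \<open>\<mu>\<close> is not a cardinal in HOD, and \<open>x\<close> does not
  witness the principle.

  \<^bold>\<open>Inadmissible ordinals have names.\<close>  If a limit ordinal \<open>a > \<omega>\<close> is not \<open>x\<close>-admissible, then a
  \<open>\<Sigma>\<^sub>1\<close> formula \<open>c\<close> with finitely many parameters \<open>e\<close> from \<open>L\<^sub>a[x]\<close> defines a map from some \<open>d < a\<close>
  cofinally into \<open>a\<close>.  The tuple formed by \<open>d\<close>, \<open>c\<close> and \<open>e\<close> determines \<open>a\<close> (\<open>wit_unique\<close>): \<open>\<Sigma>\<^sub>1\<close>
  formulas persist from a level to a larger one (\<open>Sigma1_upward\<close>), so a smaller ordinal with the same
  tuple would bound the range of the map.  Let \<open>\<gamma>\<close> be closed under a pairing function, and close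
  \<open>\<gamma> \<union> {\<gamma>}\<close> under adjoining an element to a set, under passing from such a tuple to its ordinal, and
  under passing from a definition over a level \<open>L\<^sub>b[x]\<close> to the set that it defines.  The closure is the
  range on \<open>\<gamma>\<close> of a definable enumeration (\<open>enum\<close>).  It contains every \<open>a\<close>, and includes \<open>L\<^sub>a[x]\<close>,
  as long as there is no \<open>x\<close>-admissible ordinal in the interval from \<open>\<gamma>\<close> to \<open>a\<close>
  (\<open>hull_captures\<close>).  As it is a set, it cannot contain all ordinals; hence there is a least
  \<open>x\<close>-admissible \<open>\<mu> > \<gamma>\<close>, and the closure includes \<open>\<mu>\<close> (\<open>admissible_in_hull\<close>).

  \<^bold>\<open>Removing the real.\<close>  This enumeration depends on \<open>x\<close>, so it need not be ordinal definable.  For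
  \<open>\<xi> < \<gamma>\<close> let \<open>C\<^sub>\<xi>\<close> be the set of the ordinals that occur with index \<open>\<xi>\<close> in the enumeration for some
  real.  An ordinal \<open>b < \<mu>\<close> is determined by the least \<open>\<xi>\<close> with \<open>b \<in> C\<^sub>\<xi>\<close> and by its position in
  \<open>C\<^sub>\<xi>\<close>.  The order types of the sets of ordinals that are images of the reals are bounded by a fixed
  ordinal (\<open>ot_bound\<close>), because such a type can be recovered from a relation on the reals.  With \<open>\<gamma>\<close>
  chosen above that bound, index and position are both below \<open>\<gamma>\<close>, and pairing them is an
  injection of \<open>\<mu>\<close> into \<open>\<gamma>\<close> that is definable from \<open>\<gamma>\<close> and \<open>\<mu>\<close>.  Collapsing its range yields the
  required bijection (\<open>no_HOD_cardinal_in_hull\<close>).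

  \<^bold>\<open>Working inside the model.\<close>  The model need not be well-founded, so separation, replacement and
  induction are available only for first-order conditions.  The predicates \<open>Dfb\<close>, \<open>Dft\<close> and \<open>Dfc\<close>
  say that a predicate, an operation or a class of HOL is given by a formula of set theory, with
  parameters from a specified class; the rules collected under \<open>dfb\<close> derive this from the
  structure of a HOL term.  With ordinals as the only parameters, and with the reflection principle,
  they also yield ordinal definability (\<open>OD_intro\<close>).
\<close>

section \<open>Definable predicates, terms and classes\<close>

primrec ren :: "(nat \<Rightarrow> nat) \<Rightarrow> fm \<Rightarrow> fm" where
  "ren r (Mem i j) = Mem (r i) (r j)"
| "ren r (Equal i j) = Equal (r i) (r j)"
| "ren r (Neg p) = Neg (ren r p)"
| "ren r (Conj p q) = Conj (ren r p) (ren r q)"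
| "ren r (Exists i p) = Exists (r i) (ren r p)"

primrec vbound :: "fm \<Rightarrow> nat" where
  "vbound (Mem i j) = Suc (max i j)"
| "vbound (Equal i j) = Suc (max i j)"
| "vbound (Neg p) = vbound p"
| "vbound (Conj p q) = max (vbound p) (vbound q)"
| "vbound (Exists i p) = max (Suc i) (vbound p)"

named_theorems dfb

context set_structure
begin

lemma sat_ren: "inj r \<Longrightarrow> sat (ren r p) e = sat p (e \<circ> r)"
proof (induction p arbitrary: e)
  case (Exists i p)
  have "sat (ren r p) (e(r i := a)) = sat p ((e \<circ> r)(i := a))" for a
    unfolding Exists.IH[OF Exists.prems]
    by (rule arg_cong[of _ _ "sat p"]) (use Exists.prems in \<open>auto simp: fun_eq_iff inj_eq\<close>)
  then show ?case by (simp only: ren.simps sat.simps)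
qed auto

lemma sat_cong: "(\<And>n. n < vbound p \<Longrightarrow> e n = e' n) \<Longrightarrow> sat p e = sat p e'"
proof (induction p arbitrary: e e')
  case (Exists i p)
  have "sat p (e(i := a)) = sat p (e'(i := a))" for a
    by (rule Exists.IH) (use Exists.prems in auto)
  then show ?case by simp
next
  case (Conj p q)
  have "sat p e = sat p e'" "sat q e = sat q e'"
    by (rule Conj.IH; use Conj.prems in auto)+
  then show ?case by simp
next
  case (Neg p)
  have "sat p e = sat p e'"
    by (rule Neg.IH) (use Neg.prems in auto)
  then show ?case by simp
qed simp_all

text \<open>The first \<open>k\<close> variables are reserved for parameters.\<close>

definition env :: "nat \<Rightarrow> (nat \<Rightarrow> 'a) \<Rightarrow> (nat \<Rightarrow> 'a) \<Rightarrow> nat \<Rightarrow> 'a" where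
  "env k c e n = (if n < k then c n else e (n - k))"

text \<open>\<open>Dfb C P\<close>, \<open>Dft C t\<close> and \<open>Dfc C A\<close>: the predicate \<open>P\<close>, the operation \<open>t\<close> and the class \<open>A\<close>, all
  depending on an environment, are first-order definable over the model with parameters from \<open>C\<close>.
  In the last two, variable \<open>0\<close> stands for the value or the member, and the environment proper is
  shifted by one; binders below use the same convention.\<close>

definition Dfb :: "'a set \<Rightarrow> ((nat \<Rightarrow> 'a) \<Rightarrow> bool) \<Rightarrow> bool" where
  "Dfb C P \<longleftrightarrow> (\<exists>\<phi> k c. (\<forall>n<k. c n \<in> C) \<and> (\<forall>e. range e \<subseteq> U \<longrightarrow> P e = sat \<phi> (env k c e)))"

definition Dft :: "'a set \<Rightarrow> ((nat \<Rightarrow> 'a) \<Rightarrow> 'a) \<Rightarrow> bool" where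
  "Dft C t \<longleftrightarrow> (\<forall>e. range e \<subseteq> U \<longrightarrow> t e \<in> U) \<and> Dfb C (\<lambda>e. e 0 = t (\<lambda>n. e (Suc n)))"

definition Dfc :: "'a set \<Rightarrow> ((nat \<Rightarrow> 'a) \<Rightarrow> 'a set) \<Rightarrow> bool" where
  "Dfc C A \<longleftrightarrow> (\<forall>e. range e \<subseteq> U \<longrightarrow> A e \<subseteq> U) \<and> Dfb C (\<lambda>e. e 0 \<in> A (\<lambda>n. e (Suc n)))"

lemma rangeU: "range e \<subseteq> U \<Longrightarrow> e n \<in> U" by blast

lemma range_shift: "range e \<subseteq> U \<Longrightarrow> range (\<lambda>n. e (f n)) \<subseteq> U" by blast

lemma range_case: "a \<in> U \<Longrightarrow> range e \<subseteq> U \<Longrightarrow> range (case_nat a e) \<subseteq> U"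
  by (auto split: nat.splits dest: rangeU)

lemma dfbI:
  "(\<And>n. n < k \<Longrightarrow> c n \<in> C) \<Longrightarrow> (\<And>e. range e \<subseteq> U \<Longrightarrow> P e = sat \<phi> (env k c e)) \<Longrightarrow> Dfb C P"
  unfolding Dfb_def by blast

lemma dfbE:
  assumes "Dfb C P"
  obtains \<phi> k c where "\<And>n. n < k \<Longrightarrow> c n \<in> C" "\<And>e. range e \<subseteq> U \<Longrightarrow> P e = sat \<phi> (env k c e)"
  using assms unfolding Dfb_def by blast

lemma dfb_cong: "(\<And>e. range e \<subseteq> U \<Longrightarrow> P e = Q e) \<Longrightarrow> Dfb C P = Dfb C Q"
  unfolding Dfb_def by (simp cong: conj_cong imp_cong)

lemma dfb_sat: "Dfb C (\<lambda>e. sat \<phi> e)"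
proof (rule dfbI[of 0])
  show "sat \<phi> e = sat \<phi> (env 0 undefined e)" for e
    by (rule arg_cong[of _ _ "sat \<phi>"]) (simp add: fun_eq_iff env_def)
qed simp

lemma dfb_not[dfb]: "Dfb C P \<Longrightarrow> Dfb C (\<lambda>e. \<not> P e)"
  by (erule dfbE, rule_tac \<phi> = "Neg \<phi>" in dfbI) auto

lemma dfb_conj[dfb]:
  assumes "Dfb C P" "Dfb C Q" shows "Dfb C (\<lambda>e. P e \<and> Q e)"
proof -
  obtain \<phi> k c where 1: "\<And>n. n < k \<Longrightarrow> c n \<in> C" "\<And>e. range e \<subseteq> U \<Longrightarrow> P e = sat \<phi> (env k c e)"
    by (rule dfbE[OF assms(1)], rule that)
  obtain \<psi> l d where 2: "\<And>n. n < l \<Longrightarrow> d n \<in> C" "\<And>e. range e \<subseteq> U \<Longrightarrow> Q e = sat \<psi> (env l d e)"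
    by (rule dfbE[OF assms(2)], rule that)
  define r where "r n = (if n < k then n else n + l)" for n
  define s where "s n = n + k" for n :: nat
  define b where "b n = (if n < k then c n else d (n - k))" for n
  have "inj r" "inj s" by (auto simp: inj_def r_def s_def split: if_splits)
  moreover have "env (k + l) b e \<circ> r = env k c e" for e
    by (rule ext) (simp add: env_def r_def b_def)
  moreover have "env (k + l) b e \<circ> s = env l d e" for e
    by (rule ext) (simp add: env_def s_def b_def add.commute)
  ultimately have "P e \<and> Q e \<longleftrightarrow> sat (Conj (ren r \<phi>) (ren s \<psi>)) (env (k + l) b e)"
    if "range e \<subseteq> U" for e
    using 1(2)[OF that] 2(2)[OF that] by (simp add: sat_ren)
  moreover have "b n \<in> C" if "n < k + l" for n using 1(1) 2(1) that by (simp add: b_def)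
  ultimately show ?thesis by (rule dfbI[rotated])
qed

lemma dfb_rename:
  assumes "Dfb C P" "inj r" shows "Dfb C (\<lambda>e. P (\<lambda>n. e (r n)))"
proof -
  obtain \<phi> k c where 1: "\<And>n. n < k \<Longrightarrow> c n \<in> C" "\<And>e. range e \<subseteq> U \<Longrightarrow> P e = sat \<phi> (env k c e)"
    by (rule dfbE[OF assms(1)], rule that)
  define s where "s n = (if n < k then n else r (n - k) + k)" for n
  have s: "inj s"
  proof (rule injI)
    fix x y assume "s x = s y"
    then have "x < k \<and> y < k \<and> x = y \<or> \<not> x < k \<and> \<not> y < k \<and> r (x - k) = r (y - k)"
      by (simp add: s_def split: if_splits)
    then have "x < k \<and> y < k \<and> x = y \<or> \<not> x < k \<and> \<not> y < k \<and> x - k = y - k"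
      by (simp only: inj_eq[OF assms(2)])
    then show "x = y" by linarith
  qed
  have *: "env k c e \<circ> s = env k c (\<lambda>n. e (r n))" for e
    by (rule ext) (simp add: s_def env_def)
  show ?thesis
  proof (rule dfbI[OF 1(1)])
    fix e :: "nat \<Rightarrow> 'a" assume "range e \<subseteq> U"
    then have "range (\<lambda>n. e (r n)) \<subseteq> U" by auto
    from 1(2)[OF this] show "P (\<lambda>n. e (r n)) = sat (ren s \<phi>) (env k c e)"
      by (simp only: sat_ren[OF s] *)
  qed
qed

lemma dfb_exU:
  assumes "Dfb C (\<lambda>e. Q (\<lambda>n. e (Suc n)) (e 0))" shows "Dfb C (\<lambda>e. \<exists>a\<in>U. Q e a)"
proof -
  obtain \<phi> k c where 1: "\<And>n. n < k \<Longrightarrow> c n \<in> C"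
    "\<And>e. range e \<subseteq> U \<Longrightarrow> Q (\<lambda>n. e (Suc n)) (e 0) = sat \<phi> (env k c e)"
    by (rule dfbE[OF assms], rule that)
  define N where "N = vbound \<phi> + k + 1"
  \<comment> \<open>a cyclic permutation that moves the quantified variable to an index that does not occur\<close>
  define r where "r n = (if n < k \<or> n > N then n else if n = k then N else n - 1)" for n
  have r: "inj r" by (rule injI) (simp add: r_def N_def split: if_splits; linarith)
  show ?thesis
  proof (rule dfbI[OF 1(1)])
    fix e :: "nat \<Rightarrow> 'a" assume e: "range e \<subseteq> U"
    have "Q e a = sat (ren r \<phi>) ((env k c e)(N := a))" if "a \<in> U" for a
    proof -
      have "range (case_nat a e) \<subseteq> U" using e that by (simp add: range_case)
      from 1(2)[OF this] have "Q e a = sat \<phi> (env k c (case_nat a e))" by simp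
      also have "\<dots> = sat \<phi> ((env k c e)(N := a) \<circ> r)"
      proof (rule sat_cong)
        fix n assume n: "n < vbound \<phi>"
        show "env k c (case_nat a e) n = ((env k c e)(N := a) \<circ> r) n"
        proof (cases "n \<le> k")
          case False
          then obtain m where m: "n = k + Suc m"
            using less_imp_Suc_add[of k n] by (auto simp: not_le)
          then show ?thesis using n by (simp add: r_def N_def env_def)
        qed (use n in \<open>auto simp: r_def N_def env_def\<close>)
      qed
      finally show ?thesis by (simp add: sat_ren[OF r])
    qed
    then show "(\<exists>a\<in>U. Q e a) = sat (Exists N (ren r \<phi>)) (env k c e)" by simp
  qed
qed

lemma dft_var[dfb]: "Dft C (\<lambda>e. e i)"
proof -
  have "Dfb C (\<lambda>e. sat (Equal 0 (Suc i)) e)" by (rule dfb_sat)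
  then show ?thesis by (auto simp: Dft_def)
qed

lemma dft_const: "c \<in> U \<Longrightarrow> c \<in> C \<Longrightarrow> Dft C (\<lambda>e. c)"
  unfolding Dft_def
  by (intro conjI allI impI, assumption, rule dfbI[of 1 "\<lambda>_. c" _ _ "Equal 1 0"]) (auto simp: env_def)

lemma dft_shift: "Dft C t \<Longrightarrow> Dft C (\<lambda>e. t (\<lambda>n. e (Suc n)))"
proof -
  assume t: "Dft C t"
  have "inj (case_nat 0 (\<lambda>m. Suc (Suc m)))" by (auto simp: inj_def split: nat.splits)
  from dfb_rename[OF conjunct2[OF t[unfolded Dft_def]] this]
  have "Dfb C (\<lambda>e. e 0 = t (\<lambda>n. e (Suc (Suc n))))" by simp
  then show ?thesis using t by (simp add: Dft_def range_shift)
qed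

text \<open>Substituting a definable term amounts to quantifying over its value.\<close>

lemma dfb_subst:
  assumes t: "Dft C t" and Q: "Dfb C (\<lambda>e. Q (\<lambda>n. e (Suc n)) (e 0))"
  shows "Dfb C (\<lambda>e. Q e (t e))"
proof -
  have "Dfb C (\<lambda>e. e 0 = t (\<lambda>n. e (Suc n)) \<and> Q (\<lambda>n. e (Suc n)) (e 0))"
    using t Q by (intro dfb_conj) (auto simp: Dft_def)
  from dfb_exU[of C "\<lambda>e a. a = t e \<and> Q e a", OF this] show ?thesis
    by (rule iffD1[OF dfb_cong, rotated]) (use t in \<open>auto simp: Dft_def\<close>)
qed

text \<open>The lifting rules reduce the definability of a predicate applied to arbitrary terms to the case in
  which all arguments are variables, where unfolding its definition and applying \<open>dfb\<close> suffices.\<close>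

lemma dfb_lift1:
  "(\<And>i. Dfb C (\<lambda>e. P (e i))) \<Longrightarrow> Dft C a \<Longrightarrow> Dfb C (\<lambda>e. P (a e))"
  by (rule dfb_subst)

lemma dfb_lift2:
  assumes "\<And>i j. Dfb C (\<lambda>e. P (e i) (e j))" "Dft C a" "Dft C b"
  shows "Dfb C (\<lambda>e. P (a e) (b e))"
  by (rule dfb_subst[OF assms(2)], rule dfb_subst[OF dft_shift[OF assms(3)]], rule assms)

lemma dfb_lift3:
  assumes "\<And>i j k. Dfb C (\<lambda>e. P (e i) (e j) (e k))" "Dft C a" "Dft C b" "Dft C c"
  shows "Dfb C (\<lambda>e. P (a e) (b e) (c e))"
proof -
  have 1: "Dfb C (\<lambda>e. P (e i) (b e) (c e))" if "Dft C b" "Dft C c" for b c i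
    by (rule dfb_subst[OF that(1)], rule dfb_subst[OF dft_shift[OF that(2)]], rule assms)
  show ?thesis
    by (rule dfb_subst[OF assms(2)], rule 1; intro dft_shift assms)
qed

lemma dfb_eq[dfb]:
  assumes "Dft C s" "Dft C t" shows "Dfb C (\<lambda>e. s e = t e)"
proof (rule dfb_lift2[OF _ assms])
  fix i j show "Dfb C (\<lambda>e. e i = e j)" using dfb_sat[of C "Equal i j"] by simp
qed

lemma dfb_mem[dfb]:
  assumes "Dft C s" "Dft C t" shows "Dfb C (\<lambda>e. mem (s e) (t e))"
proof (rule dfb_lift2[OF _ assms])
  fix i j show "Dfb C (\<lambda>e. mem (e i) (e j))" using dfb_sat[of C "Mem i j"] by simp
qed

lemma dfb_in[dfb]: "Dft C t \<Longrightarrow> Dfc C A \<Longrightarrow> Dfb C (\<lambda>e. t e \<in> A e)"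
  unfolding Dfc_def by (rule dfb_subst) auto

lemma dfb_disj[dfb]:
  assumes "Dfb C P" "Dfb C Q" shows "Dfb C (\<lambda>e. P e \<or> Q e)"
proof -
  have "Dfb C (\<lambda>e. \<not> (\<not> P e \<and> \<not> Q e))" by (intro dfb_not dfb_conj assms)
  then show ?thesis by simp
qed

lemma dfb_imp[dfb]:
  assumes "Dfb C P" "Dfb C Q" shows "Dfb C (\<lambda>e. P e \<longrightarrow> Q e)"
  unfolding imp_conv_disj by (intro dfb_not dfb_disj assms)

lemma dfb_iff[dfb]:
  assumes "Dfb C P" "Dfb C Q" shows "Dfb C (\<lambda>e. P e = Q e)"
  unfolding iff_conv_conj_imp by (intro dfb_imp dfb_conj assms)

lemma dfb_True[dfb]: "Dfb C (\<lambda>e. True)"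
  using dfb_sat[of C "Neg (Conj (Mem 0 0) (Neg (Mem 0 0)))"] by simp

lemma dfb_False[dfb]: "Dfb C (\<lambda>e. False)"
  using dfb_not[OF dfb_True] by simp

lemma dfb_bex[dfb]:
  "Dfc C A \<Longrightarrow> Dfb C (\<lambda>e. Q (\<lambda>n. e (Suc n)) (e 0)) \<Longrightarrow> Dfb C (\<lambda>e. \<exists>a\<in>A e. Q e a)"
proof -
  assume A: "Dfc C A" and Q: "Dfb C (\<lambda>e. Q (\<lambda>n. e (Suc n)) (e 0))"
  have "Dfb C (\<lambda>e. e 0 \<in> A (\<lambda>n. e (Suc n)) \<and> Q (\<lambda>n. e (Suc n)) (e 0))"
    using A Q by (intro dfb_conj) (auto simp: Dfc_def)
  from dfb_exU[of C "\<lambda>e a. a \<in> A e \<and> Q e a", OF this] show ?thesis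
    by (rule iffD1[OF dfb_cong, rotated]) (use A in \<open>auto simp: Dfc_def\<close>)
qed

lemma dfb_ball[dfb]:
  "Dfc C A \<Longrightarrow> Dfb C (\<lambda>e. Q (\<lambda>n. e (Suc n)) (e 0)) \<Longrightarrow> Dfb C (\<lambda>e. \<forall>a\<in>A e. Q e a)"
proof -
  assume "Dfc C A" "Dfb C (\<lambda>e. Q (\<lambda>n. e (Suc n)) (e 0))"
  from dfb_not[OF dfb_bex[of C A "\<lambda>e a. \<not> Q e a", OF this(1) dfb_not[OF this(2)]]]
  show ?thesis by simp
qed

lemma dfc_shift: "Dfc C A \<Longrightarrow> Dfc C (\<lambda>e. A (\<lambda>n. e (Suc n)))"
proof -
  assume t: "Dfc C A"
  have "inj (case_nat 0 (\<lambda>m. Suc (Suc m)))" by (auto simp: inj_def split: nat.splits)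
  from dfb_rename[OF conjunct2[OF t[unfolded Dfc_def]] this]
  have "Dfb C (\<lambda>e. e 0 \<in> A (\<lambda>n. e (Suc (Suc n))))" by simp
  then show ?thesis using t by (simp add: Dfc_def range_shift)
qed

text \<open>\<open>dfb_swap\<close> and \<open>dfb_skip\<close> rearrange the two innermost variables.\<close>

lemma dfb_swap:
  "Dfb C (\<lambda>e. Q (\<lambda>n. e (Suc (Suc n))) (e 0) (e (Suc 0))) \<Longrightarrow>
   Dfb C (\<lambda>e. Q (\<lambda>n. e (Suc (Suc n))) (e (Suc 0)) (e 0))"
proof -
  assume Q: "Dfb C (\<lambda>e. Q (\<lambda>n. e (Suc (Suc n))) (e 0) (e (Suc 0)))"
  have "inj (case_nat (1::nat) (case_nat 0 (\<lambda>m. Suc (Suc m))))" by (auto simp: inj_def split: nat.splits)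
  from dfb_rename[OF Q this] show ?thesis by simp
qed

lemma dfb_skip:
  "Dfb C (\<lambda>e. Q (\<lambda>n. e (Suc n)) (e 0)) \<Longrightarrow> Dfb C (\<lambda>e. Q (\<lambda>n. e (Suc (Suc n))) (e 0))"
proof -
  assume Q: "Dfb C (\<lambda>e. Q (\<lambda>n. e (Suc n)) (e 0))"
  have "inj (case_nat 0 (\<lambda>m. Suc (Suc m)))" by (auto simp: inj_def split: nat.splits)
  from dfb_rename[OF Q this] show ?thesis by simp
qed

lemma dfb_ex1[dfb]:
  assumes A: "Dfc C A" and Q: "Dfb C (\<lambda>e. Q (\<lambda>n. e (Suc n)) (e 0))"
  shows "Dfb C (\<lambda>e. \<exists>!b. b \<in> A e \<and> Q e b)"
proof -
  have 1: "Dfb C (\<lambda>e. Q (\<lambda>n. e (Suc (Suc n))) (e 0))" by (rule dfb_skip[OF Q])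
  have "Dfb C (\<lambda>e. \<exists>b\<in>A e. Q e b \<and> (\<forall>c\<in>A e. Q e c \<longrightarrow> c = b))"
    by (rule dfb dfc_shift A Q 1)+
  then show ?thesis
    by (rule iffD1[OF dfb_cong, rotated]) blast
qed

lemma dfc_U[dfb]: "Dfc C (\<lambda>e. U)"
proof -
  have "Dfb C (\<lambda>e. True)" by (rule dfb)
  then have "Dfb C (\<lambda>e. e 0 \<in> U)" by (rule iffD1[OF dfb_cong, rotated]) auto
  then show ?thesis by (auto simp: Dfc_def)
qed

lemma el_subset: "el x \<subseteq> U" by (auto simp: el_def)

lemma el_U[simp]: "z \<in> el x \<Longrightarrow> z \<in> U" by (simp add: el_def)

lemma dfc_el[dfb]: "Dft C t \<Longrightarrow> Dfc C (\<lambda>e. el (t e))"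
  unfolding Dfc_def el_def
  by (intro conjI) (auto intro!: dfb dft_shift)

lemma dfc_Collect[dfb]:
  "Dfc C A \<Longrightarrow> Dfb C (\<lambda>e. Q (\<lambda>n. e (Suc n)) (e 0)) \<Longrightarrow> Dfc C (\<lambda>e. {a \<in> A e. Q e a})"
  unfolding Dfc_def by (auto intro!: dfb_conj)

lemma dfc_Un[dfb]: "Dfc C A \<Longrightarrow> Dfc C B \<Longrightarrow> Dfc C (\<lambda>e. A e \<union> B e)"
  unfolding Dfc_def by (auto intro!: dfb_disj)

lemma dfc_Int[dfb]: "Dfc C A \<Longrightarrow> Dfc C B \<Longrightarrow> Dfc C (\<lambda>e. A e \<inter> B e)"
  unfolding Dfc_def by (auto intro!: dfb_conj)

lemma dfc_empty[dfb]: "Dfc C (\<lambda>e. {})"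
  unfolding Dfc_def by (auto intro!: dfb_False)

lemma dfc_insert[dfb]: "Dft C t \<Longrightarrow> Dfc C A \<Longrightarrow> Dfc C (\<lambda>e. insert (t e) (A e))"
  unfolding Dfc_def Dft_def by (auto intro!: dfb_disj)

lemma dfc_UN[dfb]:
  assumes A: "Dfc C A" and B: "Dfc C (\<lambda>e. B (\<lambda>n. e (Suc n)) (e 0))"
  shows "Dfc C (\<lambda>e. \<Union>y\<in>A e. B e y)"
proof -
  have "Dfb C (\<lambda>e. e 0 \<in> B (\<lambda>n. e (Suc (Suc n))) (e (Suc 0)))"
    using B unfolding Dfc_def by auto
  from dfb_swap[where Q = "\<lambda>e a b. a \<in> B e b", OF this]
  have 1: "Dfb C (\<lambda>e. e (Suc 0) \<in> B (\<lambda>n. e (Suc (Suc n))) (e 0))" .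
  have "Dfb C (\<lambda>e. \<exists>y\<in>A (\<lambda>n. e (Suc n)). e 0 \<in> B (\<lambda>n. e (Suc n)) y)"
    by (rule dfb dfc_shift A 1)+
  moreover have "B e y \<subseteq> U" if "range e \<subseteq> U" "y \<in> A e" for e y
  proof -
    have "y \<in> U" using A that by (auto simp: Dfc_def)
    with that have "range (case_nat y e) \<subseteq> U" by (simp add: range_case)
    with B have "B (\<lambda>n. case_nat y e (Suc n)) (case_nat y e 0) \<subseteq> U" unfolding Dfc_def by blast
    then show ?thesis by simp
  qed
  ultimately show ?thesis unfolding Dfc_def by auto
qed

lemma dfb_subset[dfb]:
  assumes "Dfc C A" "Dfc C B" shows "Dfb C (\<lambda>e. A e \<subseteq> B e)"
proof -
  have "Dfb C (\<lambda>e. \<forall>x\<in>A e. x \<in> B e)"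
    by (rule dfb dfc_shift assms)+
  then show ?thesis by (simp add: subset_eq)
qed

lemma dfb_seteq[dfb]:
  assumes "Dfc C A" "Dfc C B" shows "Dfb C (\<lambda>e. A e = B e)"
proof -
  have "Dfb C (\<lambda>e. A e \<subseteq> B e \<and> B e \<subseteq> A e)"
    by (rule dfb assms)+
  then show ?thesis by (simp add: set_eq_subset)
qed

lemma dft_U: "Dft C t \<Longrightarrow> range e \<subseteq> U \<Longrightarrow> t e \<in> U" by (simp add: Dft_def)

lemma dft_lift1:
  assumes "\<And>i. Dft C (\<lambda>e. F (e i))" "Dft C a" shows "Dft C (\<lambda>e. F (a e))"
proof -
  have "Dfb C (\<lambda>e. e 0 = F (a (\<lambda>n. e (Suc n))))"
    by (rule dfb_subst[OF dft_shift[OF assms(2)]], rule dfb, rule dfb, rule assms)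
  moreover have "F x \<in> U" if "x \<in> U" for x
    using dft_U[OF assms(1), of "\<lambda>_. x"] that by auto
  ultimately show ?thesis using assms(2) by (auto simp: Dft_def)
qed

lemma dft_lift2:
  assumes "\<And>i j. Dft C (\<lambda>e. F (e i) (e j))" "Dft C a" "Dft C b"
  shows "Dft C (\<lambda>e. F (a e) (b e))"
proof -
  have "Dfb C (\<lambda>e. e 0 = F (a (\<lambda>n. e (Suc n))) (b (\<lambda>n. e (Suc n))))"
    by (rule dfb_lift3[where P = "\<lambda>x y z. x = F y z"], rule dfb, rule dfb, rule assms, rule dfb)
       (rule dft_shift, rule assms)+
  moreover have "F x y \<in> U" if "x \<in> U" "y \<in> U" for x y
    using dft_U[OF assms(1) range_case[of x "\<lambda>_. y"], of 0 1] that by auto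
  ultimately show ?thesis using assms(2,3) by (auto simp: Dft_def)
qed

lemma dfb_lift4:
  assumes "\<And>i j k l. Dfb C (\<lambda>e. P (e i) (e j) (e k) (e l))" "Dft C a" "Dft C b" "Dft C c" "Dft C d"
  shows "Dfb C (\<lambda>e. P (a e) (b e) (c e) (d e))"
proof -
  have 1: "Dfb C (\<lambda>e. P (e i) (b e) (c e) (d e))" if "Dft C b" "Dft C c" "Dft C d" for b c d i
  proof -
    have 2: "Dfb C (\<lambda>e. P (e i) (e j) (c e) (d e))" if "Dft C c" "Dft C d" for c d i j
      by (rule dfb_subst[OF that(1)], rule dfb_subst[OF dft_shift[OF that(2)]], rule assms)
    show ?thesis
      by (rule dfb_subst[OF that(1)], rule 2; intro dft_shift that)
  qed
  show ?thesis
    by (rule dfb_subst[OF assms(2)], rule 1; intro dft_shift assms)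
qed

lemma dft_lift3:
  assumes "\<And>i j k. Dft C (\<lambda>e. F (e i) (e j) (e k))" "Dft C a" "Dft C b" "Dft C c"
  shows "Dft C (\<lambda>e. F (a e) (b e) (c e))"
proof -
  have "Dfb C (\<lambda>e. e 0 = F (a (\<lambda>n. e (Suc n))) (b (\<lambda>n. e (Suc n))) (c (\<lambda>n. e (Suc n))))"
    by (rule dfb_lift4[where P = "\<lambda>x y z w. x = F y z w"], rule dfb, rule dfb, rule assms, rule dfb)
       (rule dft_shift, rule assms)+
  moreover have "F x y z \<in> U" if "x \<in> U" "y \<in> U" "z \<in> U" for x y z
    using dft_U[OF assms(1) range_case[OF _ range_case[of y "\<lambda>_. z"]], of x 0 1 2] that
    by (auto simp: numeral_2_eq_2)
  ultimately show ?thesis using assms(2-) by (auto simp: Dft_def)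
qed

lemma dfc_lift1:
  assumes "\<And>i. Dfc C (\<lambda>e. F (e i))" "Dft C a" shows "Dfc C (\<lambda>e. F (a e))"
proof -
  have "Dfb C (\<lambda>e. e 0 \<in> F (a (\<lambda>n. e (Suc n))))"
    by (rule dfb_subst[OF dft_shift[OF assms(2)]], rule dfb, rule dfb, rule assms)
  moreover have "F x \<subseteq> U" if "x \<in> U" for x
  proof -
    have "range (\<lambda>_::nat. x) \<subseteq> U" using that by auto
    then show ?thesis using assms(1)[of 0] unfolding Dfc_def by blast
  qed
  ultimately show ?thesis using assms(2) by (auto simp: Dfc_def Dft_def)
qed

lemma dfc_image[dfb]:
  assumes "Dfc C A" "Dft C (\<lambda>e. F (\<lambda>n. e (Suc n)) (e 0))"
  shows "Dfc C (\<lambda>e. F e ` A e)"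
proof -
  have "Dfc C (\<lambda>e. \<Union>a\<in>A e. {F e a})" by (rule dfb assms)+
  then show ?thesis by (simp add: UNION_singleton_eq_range)
qed

end

section \<open>Elementary set theory\<close>

locale zf = set_structure U mem for U :: "'a set" and mem :: "'a \<Rightarrow> 'a \<Rightarrow> bool" +
  assumes ZF: "ZF"
begin

lemma el_ext: "x \<in> U \<Longrightarrow> y \<in> U \<Longrightarrow> el x = el y \<Longrightarrow> x = y"
  using ZF by (auto simp: ZF_def extensionality_def)

definition isset :: "'a set \<Rightarrow> bool" where
  "isset X \<longleftrightarrow> (\<exists>y\<in>U. el y = X)"

text \<open>The set with the given members.  For a proper class the value is the empty set, which keeps the
  operation total and definable.\<close>

definition setof :: "'a set \<Rightarrow> 'a" where
  "setof X = (if isset X then THE y. y \<in> U \<and> el y = X else THE y. y \<in> U \<and> el y = {})"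

lemma setof_el: "x \<in> U \<Longrightarrow> setof (el x) = x"
  unfolding setof_def isset_def by (auto intro: el_ext the_equality)

lemma el_setof: "isset X \<Longrightarrow> el (setof X) = X"
  using setof_el by (auto simp: isset_def)

lemma isset_el[simp, intro]: "x \<in> U \<Longrightarrow> isset (el x)" by (auto simp: isset_def)

lemma isset_subU: "isset X \<Longrightarrow> X \<subseteq> U" using el_subset by (auto simp: isset_def)

text \<open>The axiom of separation evaluates its formula with the tested element as variable \<open>0\<close>, whereas
  parameters come first in \<open>env\<close>; the renaming \<open>r\<close> translates between the two.\<close>

lemma sep_env:
  assumes "Dfb C (\<lambda>e. Q (e 0))" "C \<subseteq> U" "x \<in> U" shows "isset {z \<in> el x. Q z}"
proof -
  obtain \<phi> k c where 1: "\<And>n. n < k \<Longrightarrow> c n \<in> C"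
    "\<And>e. range e \<subseteq> U \<Longrightarrow> Q (e 0) = sat \<phi> (env k c e)"
    by (rule dfbE[OF assms(1)], rule that)
  define r where "r n = (if n < k then Suc n else if n = k then 0 else n)" for n
  have r: "inj r" by (auto simp: inj_def r_def split: if_splits)
  define E where "E n = (if 0 < n \<and> n \<le> k then c (n - 1) else x)" for n
  have rE: "range E \<subseteq> U"
  proof clarify
    fix n show "E n \<in> U"
      using 1(1)[of "n - 1"] assms(2,3) by (cases "0 < n \<and> n \<le> k") (auto simp: E_def)
  qed
  have sep: "\<exists>y\<in>U. el y = {z \<in> el x. sat (ren r \<phi>) (E(0 := z))}"
    using ZF rE assms(3) by (auto simp: ZF_def separation_def)
  have "Q z = sat (ren r \<phi>) (E(0 := z))" if "z \<in> el x" for z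
  proof -
    have "Q z = sat \<phi> (env k c (\<lambda>m. if m = 0 then z else x))"
      using 1(2)[of "\<lambda>m. if m = 0 then z else x"] that assms(3) by auto
    also have "\<dots> = sat \<phi> (E(0 := z) \<circ> r)"
      by (rule sat_cong) (auto simp: r_def E_def env_def)
    finally show ?thesis by (simp add: sat_ren[OF r])
  qed
  then have "{z \<in> el x. Q z} = {z \<in> el x. sat (ren r \<phi>) (E(0 := z))}" by auto
  then show ?thesis using sep unfolding isset_def by metis
qed

lemma isset_sep: "isset X \<Longrightarrow> Dfb U (\<lambda>e. Q (e 0)) \<Longrightarrow> isset {z \<in> X. Q z}"
  using sep_env[of U Q] by (auto simp: isset_def)

lemma isset_subset: "isset X \<Longrightarrow> Y \<subseteq> X \<Longrightarrow> Dfc U (\<lambda>e. Y) \<Longrightarrow> isset Y"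
  using isset_sep[of X "\<lambda>z. z \<in> Y"] by (simp add: Dfc_def Int_absorb1 flip: Int_def)

lemma isset_empty[simp, intro]: "isset {}"
proof -
  obtain x where "x \<in> U" using ZF by (auto simp: ZF_def infinity_def)
  then show ?thesis using isset_subset[of "el x" "{}"] by (auto intro!: dfb)
qed

lemma setof_U[simp, intro]: "setof X \<in> U"
proof (cases "isset X")
  case True then show ?thesis using setof_el unfolding isset_def by metis
next
  case False
  have "setof {} \<in> U" using setof_el isset_empty unfolding isset_def by metis
  moreover have "setof X = setof {}" using False by (simp add: setof_def)
  ultimately show ?thesis by simp
qed

lemma setof_cases: "isset X \<and> el (setof X) = X \<or> \<not> isset X \<and> el (setof X) = {}"
proof (cases "isset X")
  case False
  then have "setof X = setof {}" by (simp add: setof_def)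
  with False show ?thesis by (simp add: el_setof)
qed (simp add: el_setof)

lemma el_inj: "x \<in> U \<Longrightarrow> y \<in> U \<Longrightarrow> el x = el y \<longleftrightarrow> x = y" using el_ext by blast

lemma dft_setof[dfb]:
  assumes A: "Dfc C A" shows "Dft C (\<lambda>e. setof (A e))"
proof -
  have "Dfb C (\<lambda>e. el (e 0) = A (\<lambda>n. e (Suc n)) \<or>
          \<not> (\<exists>y\<in>U. el y = A (\<lambda>n. e (Suc n))) \<and> el (e 0) = {})"
    by (rule dfb dfc_shift A)+
  then have "Dfb C (\<lambda>e. e 0 = setof (A (\<lambda>n. e (Suc n))))"
  proof (rule iffD1[OF dfb_cong, rotated])
    fix e :: "nat \<Rightarrow> 'a" assume "range e \<subseteq> U"
    then have e0: "e 0 \<in> U" by (rule rangeU)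
    let ?A = "A (\<lambda>n. e (Suc n))"
    have "(e 0 = setof ?A) = (el (e 0) = el (setof ?A))" using el_inj[OF e0 setof_U] by simp
    also have "\<dots> = (el (e 0) = ?A \<or> \<not> isset ?A \<and> el (e 0) = {})"
    proof (cases "isset ?A")
      case False
      moreover have "el (e 0) \<noteq> ?A" using False e0 unfolding isset_def by metis
      moreover have "el (setof ?A) = {}" using setof_cases[of ?A] False by simp
      ultimately show ?thesis by simp
    qed (simp add: el_setof)
    finally show "(el (e 0) = ?A \<or> \<not> (\<exists>y\<in>U. el y = ?A) \<and> el (e 0) = {}) = (e 0 = setof ?A)"
      by (simp add: isset_def)
  qed
  then show ?thesis by (simp add: Dft_def)
qed

text \<open>A definable description operator: the union collapses to the unique solution, and is empty if
  there is none or more than one.\<close>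

definition uniq :: "('a \<Rightarrow> bool) \<Rightarrow> 'a" where
  "uniq Q = setof (\<Union>a\<in>{a \<in> U. Q a \<and> (\<forall>b\<in>U. Q b \<longrightarrow> b = a)}. el a)"

lemma uniq_U[simp, intro]: "uniq Q \<in> U" by (simp add: uniq_def)

lemma uniq_eq: "a \<in> U \<Longrightarrow> Q a \<Longrightarrow> (\<And>b. b \<in> U \<Longrightarrow> Q b \<Longrightarrow> b = a) \<Longrightarrow> uniq Q = a"
proof -
  assume a: "a \<in> U" "Q a" "\<And>b. b \<in> U \<Longrightarrow> Q b \<Longrightarrow> b = a"
  then have "{a \<in> U. Q a \<and> (\<forall>b\<in>U. Q b \<longrightarrow> b = a)} = {a}" by blast
  then show ?thesis unfolding uniq_def using a(1) setof_el by simp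
qed

lemma dft_uniq[dfb]:
  assumes "Dfb C (\<lambda>e. Q (\<lambda>n. e (Suc n)) (e 0))" shows "Dft C (\<lambda>e. uniq (Q e))"
proof -
  have 1: "Dfb C (\<lambda>e. Q (\<lambda>n. e (Suc (Suc n))) (e 0))" by (rule dfb_skip[OF assms])
  show ?thesis unfolding uniq_def by (rule dfb assms 1)+
qed

lemma dft_const_U: "c \<in> U \<Longrightarrow> Dft U (\<lambda>e. c)" by (rule dft_const)

subsection \<open>Set existence\<close>

lemma isset_pair[intro]: "a \<in> U \<Longrightarrow> b \<in> U \<Longrightarrow> isset {a, b}"
  using ZF by (auto simp: ZF_def pairing_def isset_def)

lemma isset_single[intro]: "a \<in> U \<Longrightarrow> isset {a}"
  using isset_pair[of a a] by simp

lemma isset_Union: "isset X \<Longrightarrow> isset (\<Union>y\<in>X. el y)"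
  using ZF by (auto simp: ZF_def union_axiom_def isset_def)

lemma isset_Pow: "isset X \<Longrightarrow> isset {y \<in> U. el y \<subseteq> X}"
  using ZF by (auto simp: ZF_def power_set_axiom_def isset_def)

lemma isset_Un[intro]: "isset X \<Longrightarrow> isset Y \<Longrightarrow> isset (X \<union> Y)"
proof -
  assume *: "isset X" "isset Y"
  have "isset (\<Union>y\<in>{setof X, setof Y}. el y)" by (rule isset_Union) auto
  then show ?thesis using * by (simp add: el_setof)
qed

lemma isset_insert[intro]: "a \<in> U \<Longrightarrow> isset Y \<Longrightarrow> isset (insert a Y)"
  using isset_Un[of "{a}" Y] by auto

text \<open>The axiom of replacement, for an operation instead of a functional formula.\<close>

lemma isset_image:
  assumes X: "isset X" and F: "Dft U (\<lambda>e. F (e 0))" shows "isset (F ` X)"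
proof -
  have "Dfb U (\<lambda>e. e (Suc 0) = F (e 0))"
    by (rule dfb F)+
  obtain \<phi> k c where 1: "\<And>n. n < k \<Longrightarrow> c n \<in> U"
    "\<And>e. range e \<subseteq> U \<Longrightarrow> (e (Suc 0) = F (e 0)) = sat \<phi> (env k c e)"
    by (rule dfbE[OF \<open>Dfb U (\<lambda>e. e (Suc 0) = F (e 0))\<close>], rule that)
  obtain x where x: "x \<in> U" "el x = X" using X by (auto simp: isset_def)
  \<comment> \<open>argument and value are variables \<open>0\<close> and \<open>1\<close> of the axiom, but follow the parameters in \<open>env\<close>\<close>
  define r where "r n = (if n < k then Suc (Suc n) else if n = k then 0 else if n = Suc k then 1 else n)" for n
  have r: "inj r" by (auto simp: inj_def r_def split: if_splits)
  define E where "E n = (if 1 < n \<and> n \<le> Suc k then c (n - 2) else x)" for n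
  have rE: "range E \<subseteq> U"
  proof clarify
    fix n show "E n \<in> U"
    proof (cases "1 < n \<and> n \<le> Suc k")
      case True
      then have "n - 2 < k" by linarith
      with True 1(1) show ?thesis by (simp add: E_def)
    qed (use x in \<open>auto simp: E_def\<close>)
  qed
  have *: "(b = F a) = sat (ren r \<phi>) (E(0 := a, 1 := b))" if "a \<in> U" "b \<in> U" for a b
  proof -
    have "(b = F a) = sat \<phi> (env k c (\<lambda>m. if m = 0 then a else if m = 1 then b else x))"
      using 1(2)[of "\<lambda>m. if m = 0 then a else if m = 1 then b else x"] that x by auto
    also have "\<dots> = sat \<phi> (E(0 := a, 1 := b) \<circ> r)"
      by (rule sat_cong) (auto simp: r_def E_def env_def)
    finally show ?thesis by (simp add: sat_ren[OF r])
  qed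
  have "\<forall>a\<in>U. \<forall>b\<in>U. \<forall>c\<in>U. sat (ren r \<phi>) (E(0 := a, 1 := b)) \<and> sat (ren r \<phi>) (E(0 := a, 1 := c)) \<longrightarrow> b = c"
    using * by metis
  then have "\<exists>y\<in>U. el y = {b \<in> U. \<exists>a\<in>el x. sat (ren r \<phi>) (E(0 := a, 1 := b))}"
    using ZF rE x(1) unfolding ZF_def replacement_def by blast
  moreover have "F a \<in> U" if "a \<in> U" for a
    using dft_U[OF F, of "\<lambda>_. a"] that by auto
  then have "{b \<in> U. \<exists>a\<in>el x. sat (ren r \<phi>) (E(0 := a, 1 := b))} = F ` X"
    unfolding x(2)[symmetric] image_def using * el_U by blast
  ultimately show ?thesis unfolding isset_def by metis
qed

lemma isset_UN:
  assumes X: "isset X" and F: "Dft U (\<lambda>e. F (e 0))" shows "isset (\<Union>a\<in>X. el (F a))"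
  using isset_Union[OF isset_image[OF X F]] by simp

subsection \<open>Pairs and functions\<close>

definition emp where "emp = setof {}"
definition pair where "pair a b = setof {setof {a}, setof {a, b}}"
definition sc where "sc a = setof (insert a (el a))"

lemma el_emp[simp]: "el emp = {}" by (simp add: emp_def el_setof)
lemma emp_U[simp, intro]: "emp \<in> U" by (simp add: emp_def)
lemma pair_U[simp, intro]: "pair a b \<in> U" by (simp add: pair_def)
lemma sc_U[simp, intro]: "sc a \<in> U" by (simp add: sc_def)
lemma el_sc[simp]: "a \<in> U \<Longrightarrow> el (sc a) = insert a (el a)" by (simp add: sc_def el_setof isset_insert)

lemma el_emp_iff: "x \<in> U \<Longrightarrow> el x = {} \<longleftrightarrow> x = emp" using el_ext[of x emp] by auto

lemma dft_emp[dfb]: "Dft C (\<lambda>e. emp)" unfolding emp_def by (rule dfb)+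

lemma dft_pair[dfb]: "Dft C a \<Longrightarrow> Dft C b \<Longrightarrow> Dft C (\<lambda>e. pair (a e) (b e))"
  by (rule dft_lift2[of C pair]) (unfold pair_def, (rule dfb)+)

lemma dft_sc[dfb]: "Dft C a \<Longrightarrow> Dft C (\<lambda>e. sc (a e))"
  by (rule dft_lift1[of C sc]) (unfold sc_def, (rule dfb)+)

lemma is_pair_iff: "a \<in> U \<Longrightarrow> b \<in> U \<Longrightarrow> p \<in> U \<Longrightarrow> is_pair a b p \<longleftrightarrow> p = pair a b"
proof
  assume *: "a \<in> U" "b \<in> U" "p \<in> U" "is_pair a b p"
  then obtain s d where sd: "s \<in> U" "d \<in> U" "el s = {a}" "el d = {a, b}" "el p = {s, d}"
    by (auto simp: is_pair_def)
  then have "setof {a} = s" "setof {a, b} = d" using setof_el by metis+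
  with sd * show "p = pair a b" unfolding pair_def using setof_el by metis
next
  assume *: "a \<in> U" "b \<in> U" "p \<in> U" "p = pair a b"
  then show "is_pair a b p" unfolding is_pair_def
    by (intro bexI[of _ "setof {a}"] bexI[of _ "setof {a, b}"])
       (auto simp: pair_def el_setof isset_single isset_pair)
qed

lemma is_pair_pair[simp]: "a \<in> U \<Longrightarrow> b \<in> U \<Longrightarrow> is_pair a b (pair a b)"
  by (simp add: is_pair_iff)

lemma el_pair: "a \<in> U \<Longrightarrow> b \<in> U \<Longrightarrow> el (pair a b) = {setof {a}, setof {a, b}}"
  by (simp add: pair_def el_setof isset_single isset_pair)

lemma pair_inject[simp]:
  "a \<in> U \<Longrightarrow> b \<in> U \<Longrightarrow> c \<in> U \<Longrightarrow> d \<in> U \<Longrightarrow> pair a b = pair c d \<longleftrightarrow> a = c \<and> b = d"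
proof
  assume *: "a \<in> U" "b \<in> U" "c \<in> U" "d \<in> U" "pair a b = pair c d"
  have "el (pair a b) = {setof {a}, setof {a, b}}" "el (pair c d) = {setof {c}, setof {c, d}}"
    by (rule el_pair[OF *(1,2)], rule el_pair[OF *(3,4)])
  then have "el ` {setof {a}, setof {a, b}} = el ` {setof {c}, setof {c, d}}"
    using *(5) by metis
  then have "{{a}, {a, b}} = {{c}, {c, d}}"
    using * by (simp add: el_setof isset_single isset_pair)
  then show "a = c \<and> b = d" by (auto simp: doubleton_eq_iff)
qed auto

lemma app_iff: "f \<in> U \<Longrightarrow> a \<in> U \<Longrightarrow> b \<in> U \<Longrightarrow> app f a b \<longleftrightarrow> pair a b \<in> el f"
  unfolding app_def using is_pair_iff by (metis el_U pair_U)

definition fn where "fn f a = uniq (\<lambda>b. pair a b \<in> el f)"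
definition lam where "lam X F = setof ((\<lambda>a. pair a (F a)) ` X)"

lemma lam_U[simp, intro]: "lam X F \<in> U" by (simp add: lam_def)

lemma dft_fn[dfb]: "Dft C a \<Longrightarrow> Dft C b \<Longrightarrow> Dft C (\<lambda>e. fn (a e) (b e))"
  by (rule dft_lift2[of C fn]) (unfold fn_def, (rule dfb)+)

lemma dft_lam[dfb]:
  assumes "Dfc C X" "Dft C (\<lambda>e. F (\<lambda>n. e (Suc n)) (e 0))" shows "Dft C (\<lambda>e. lam (X e) (F e))"
  unfolding lam_def by (rule dfb assms)+

lemma dft_app1:
  "Dft U (\<lambda>e. F (e 0)) \<Longrightarrow> a \<in> U \<Longrightarrow> F a \<in> U"
  using dft_U[of U "\<lambda>e. F (e 0)" "\<lambda>_. a"] by auto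

lemma el_lam: "isset X \<Longrightarrow> Dft U (\<lambda>e. F (e 0)) \<Longrightarrow> el (lam X F) = (\<lambda>a. pair a (F a)) ` X"
  unfolding lam_def by (rule el_setof, rule isset_image, assumption) (rule dfb | assumption)+

lemma fn_lam: "isset X \<Longrightarrow> Dft U (\<lambda>e. F (e 0)) \<Longrightarrow> a \<in> X \<Longrightarrow> fn (lam X F) a = F a"
  unfolding fn_def using isset_subU[of X] dft_app1[of F]
  by (intro uniq_eq) (auto simp: el_lam subset_iff)

lemma app_lam: "isset X \<Longrightarrow> Dft U (\<lambda>e. F (e 0)) \<Longrightarrow> a \<in> U \<Longrightarrow> b \<in> U \<Longrightarrow>
    app (lam X F) a b \<longleftrightarrow> a \<in> X \<and> b = F a"
  using isset_subU[of X] dft_app1[of F] by (auto simp: app_iff el_lam subset_iff)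

lemma dfb_is_pair[dfb]:
  "Dft C a \<Longrightarrow> Dft C b \<Longrightarrow> Dft C p \<Longrightarrow> Dfb C (\<lambda>e. is_pair (a e) (b e) (p e))"
  by (rule dfb_lift3[of C is_pair]) (unfold is_pair_def, (rule dfb)+)

lemma dfb_app[dfb]:
  "Dft C a \<Longrightarrow> Dft C b \<Longrightarrow> Dft C p \<Longrightarrow> Dfb C (\<lambda>e. app (a e) (b e) (p e))"
  by (rule dfb_lift3[of C app]) (unfold app_def, (rule dfb)+)

section \<open>Ordinals\<close>

lemma dfb_transitive[dfb]: "Dft C a \<Longrightarrow> Dfb C (\<lambda>e. transitive (a e))"
  by (rule dfb_lift1[of C transitive]) (unfold transitive_def, (rule dfb)+)

lemma dfb_ordinal[dfb]: "Dft C a \<Longrightarrow> Dfb C (\<lambda>e. ordinal (a e))"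
  by (rule dfb_lift1[of C ordinal]) (unfold ordinal_def, (rule dfb)+)

lemma dfb_limit[dfb]: "Dft C a \<Longrightarrow> Dfb C (\<lambda>e. limit_ordinal (a e))"
  by (rule dfb_lift1[of C limit_ordinal]) (unfold limit_ordinal_def, (rule dfb)+)

lemma dfb_is_succ[dfb]: "Dft C a \<Longrightarrow> Dft C b \<Longrightarrow> Dfb C (\<lambda>e. is_succ (a e) (b e))"
  by (rule dfb_lift2[of C is_succ]) (unfold is_succ_def, (rule dfb)+)

lemma dfc_omega[dfb]: "Dfc C (\<lambda>e. omega)"
  unfolding omega_def by (rule dfb)+

lemma dft_comp: "Dft C (\<lambda>e. F (e 0)) \<Longrightarrow> Dft C t \<Longrightarrow> Dft C (\<lambda>e. F (t e))"
proof -
  assume F: "Dft C (\<lambda>e. F (e 0))" and t: "Dft C t"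
  have "Dfb C (\<lambda>e. e 0 = F (e (Suc 0)))" using F by (simp add: Dft_def)
  from dfb_swap[where Q = "\<lambda>e a b. a = F b", OF this]
  have 1: "Dfb C (\<lambda>e. e (Suc 0) = F (e 0))" .
  have "F x \<in> U" if "x \<in> U" for x
    using dft_U[OF F, of "\<lambda>_. x"] that by auto
  moreover have "Dfb C (\<lambda>e. e 0 = F (t (\<lambda>n. e (Suc n))))"
    by (rule dfb_subst[OF dft_shift[OF t]]) (rule 1)
  ultimately show ?thesis using t by (simp add: Dft_def)
qed

lemma dft_if[dfb]:
  assumes "Dfb C P" "Dft C s" "Dft C t" shows "Dft C (\<lambda>e. if P e then s e else t e)"
proof -
  have P: "Dfb C (\<lambda>e. P (\<lambda>n. e (Suc n)))"
    by (rule dfb_rename[OF assms(1)]) simp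
  have "Dfb C (\<lambda>e. P (\<lambda>n. e (Suc n)) \<and> e 0 = s (\<lambda>n. e (Suc n)) \<or>
                \<not> P (\<lambda>n. e (Suc n)) \<and> e 0 = t (\<lambda>n. e (Suc n)))"
    by (rule dfb dft_shift assms P)+
  then have "Dfb C (\<lambda>e. e 0 = (if P (\<lambda>n. e (Suc n)) then s (\<lambda>n. e (Suc n)) else t (\<lambda>n. e (Suc n))))"
    by (rule iffD1[OF dfb_cong, rotated]) simp
  then show ?thesis using assms(2,3) by (simp add: Dft_def)
qed

definition Ord :: "'a set" where "Ord = {a \<in> U. ordinal a}"

lemma dfc_Ord[dfb]: "Dfc C (\<lambda>e. Ord)"
  unfolding Ord_def by (rule dfb)+

lemma Ord_U[simp]: "a \<in> Ord \<Longrightarrow> a \<in> U"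
  unfolding Ord_def by blast

lemma mem_iff: "y \<in> U \<Longrightarrow> mem y z \<longleftrightarrow> y \<in> el z"
  unfolding el_def by blast

lemma found: "isset X \<Longrightarrow> X \<noteq> {} \<Longrightarrow> \<exists>y\<in>X. el y \<inter> X = {}"
  using ZF unfolding ZF_def foundation_def isset_def by metis

lemma no_self: "a \<notin> el a"
proof
  assume a: "a \<in> el a"
  then have "a \<in> U" by simp
  then have "isset {a}" by (rule isset_single)
  from found[OF this] show False using a by blast
qed

lemma no_cycle2: "a \<in> el b \<Longrightarrow> b \<in> el a \<Longrightarrow> False"
  using found[OF isset_pair[of a b]] el_U by blast

lemma no_cycle3: "a \<in> el b \<Longrightarrow> b \<in> el c \<Longrightarrow> c \<in> el a \<Longrightarrow> False"
  using found[OF isset_insert[of a "{b, c}", OF _ isset_pair]] el_U by blast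

lemma transitiveD: "transitive a \<Longrightarrow> c \<in> el b \<Longrightarrow> b \<in> el a \<Longrightarrow> c \<in> el a"
  by (auto simp: transitive_def)

lemma Ord_transitive: "a \<in> Ord \<Longrightarrow> transitive a"
  unfolding Ord_def ordinal_def by blast

lemma Ord_trans: "a \<in> Ord \<Longrightarrow> c \<in> el b \<Longrightarrow> b \<in> el a \<Longrightarrow> c \<in> el a"
  using transitiveD Ord_transitive by blast

lemma Ord_lin_in: "a \<in> Ord \<Longrightarrow> x \<in> el a \<Longrightarrow> y \<in> el a \<Longrightarrow> x \<in> el y \<or> x = y \<or> y \<in> el x"
  unfolding Ord_def ordinal_def using mem_iff el_U by blast

lemma OrdI: "a \<in> U \<Longrightarrow> (\<And>x y. x \<in> el y \<Longrightarrow> y \<in> el a \<Longrightarrow> x \<in> el a) \<Longrightarrow>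
   (\<And>x y. x \<in> el a \<Longrightarrow> y \<in> el a \<Longrightarrow> x \<in> el y \<or> x = y \<or> y \<in> el x) \<Longrightarrow> a \<in> Ord"
  unfolding Ord_def ordinal_def transitive_def using mem_iff el_U by blast

lemma Ord_elem:
  assumes a: "a \<in> Ord" and b: "b \<in> el a" shows "b \<in> Ord"
proof (rule OrdI)
  show "b \<in> U" using b by (rule el_U)
  fix x y
  show "x \<in> el b" if xy: "x \<in> el y" "y \<in> el b"
  proof -
    have "y \<in> el a" using Ord_trans[OF a xy(2) b] .
    then have "x \<in> el a" using Ord_trans[OF a xy(1)] by blast
    then show ?thesis using Ord_lin_in[OF a _ b] no_cycle2[of b y] no_cycle3[of b x y] xy by blast
  qed
  show "x \<in> el y \<or> x = y \<or> y \<in> el x" if "x \<in> el b" "y \<in> el b"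
    using Ord_lin_in[OF a Ord_trans[OF a that(1) b] Ord_trans[OF a that(2) b]] .
qed

lemma Ord_sub_mem:
  assumes a: "a \<in> Ord" and b: "b \<in> Ord" and sub: "el a \<subseteq> el b" and ne: "a \<noteq> b"
  shows "a \<in> el b"
proof -
  define X where "X = {z \<in> el b. z \<notin> el a}"
  have "isset X" unfolding X_def using a b
    by (intro isset_sep isset_el) (rule Ord_U dfb dft_const_U | assumption)+
  moreover have "X \<noteq> {}" using el_ext[of a b] a b sub ne by (auto simp: X_def)
  ultimately obtain y where y: "y \<in> X" "el y \<inter> X = {}" using found by blast
  have "el y \<subseteq> el a" using y Ord_trans[OF b] by (auto simp: X_def)
  moreover have "el a \<subseteq> el y"
  proof
    fix z assume z: "z \<in> el a"
    then have "z \<in> el y \<or> z = y \<or> y \<in> el z" using y sub Ord_lin_in[OF b] by (auto simp: X_def)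
    then show "z \<in> el y" using z y Ord_trans[OF a] by (auto simp: X_def)
  qed
  ultimately have "a = y" using el_ext[of a y] a y by (auto simp: X_def)
  then show ?thesis using y by (simp add: X_def)
qed

lemma Ord_linear:
  assumes a: "a \<in> Ord" and b: "b \<in> Ord"
  shows "a \<in> el b \<or> a = b \<or> b \<in> el a"
proof -
  have s: "isset {z \<in> el a. z \<in> el b}" using a b
    by (intro isset_sep isset_el) (rule Ord_U dfb dft_const_U | assumption)+
  define i where "i = setof {z \<in> el a. z \<in> el b}"
  have i: "el i = el a \<inter> el b" using el_setof[OF s] by (auto simp: i_def)
  have "i \<in> Ord"
    by (rule OrdI) (auto simp: i dest: Ord_trans[OF a] Ord_trans[OF b] Ord_lin_in[OF a], simp add: i_def)
  then have "i = a \<or> i \<in> el a" "i = b \<or> i \<in> el b"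
    using Ord_sub_mem[of i a] Ord_sub_mem[of i b] a b i by auto
  then show ?thesis using i no_self by blast
qed

lemma Ord_le_iff: "a \<in> Ord \<Longrightarrow> b \<in> Ord \<Longrightarrow> el a \<subseteq> el b \<longleftrightarrow> a = b \<or> a \<in> el b"
  using Ord_sub_mem Ord_trans by blast

lemma Ord_not_mem: "a \<in> Ord \<Longrightarrow> b \<in> Ord \<Longrightarrow> a \<notin> el b \<longleftrightarrow> el b \<subseteq> el a"
  using Ord_linear Ord_le_iff no_self no_cycle2 by metis

lemma emp_Ord[simp, intro]: "emp \<in> Ord" by (rule OrdI) auto

lemma sc_Ord[simp, intro]: "a \<in> Ord \<Longrightarrow> sc a \<in> Ord"
  by (rule OrdI) (auto dest: Ord_trans Ord_lin_in)

lemma sc_inj: "a \<in> U \<Longrightarrow> b \<in> U \<Longrightarrow> sc a = sc b \<Longrightarrow> a = b"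
  using no_cycle2 el_sc by (metis insertE insertI1)

lemma sc_not_emp[simp]: "a \<in> U \<Longrightarrow> sc a \<noteq> emp"
  using el_sc el_emp by (metis insert_not_empty)

lemma Ord_sc_le: "a \<in> Ord \<Longrightarrow> b \<in> el a \<Longrightarrow> el (sc b) \<subseteq> el a"
  using Ord_trans by auto

lemma Ord_sc_mem: "a \<in> Ord \<Longrightarrow> b \<in> el a \<Longrightarrow> sc b = a \<or> sc b \<in> el a"
  using Ord_sc_le Ord_le_iff Ord_elem sc_Ord by metis

lemma Ord_Union:
  assumes "isset X" "X \<subseteq> Ord" shows "setof (\<Union>x\<in>X. el x) \<in> Ord" "el (setof (\<Union>x\<in>X. el x)) = (\<Union>x\<in>X. el x)"
proof -
  show e: "el (setof (\<Union>x\<in>X. el x)) = (\<Union>x\<in>X. el x)"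
    by (rule el_setof[OF isset_Union[OF assms(1)]])
  show "setof (\<Union>x\<in>X. el x) \<in> Ord"
  proof (rule OrdI[OF setof_U], unfold e)
    fix x y assume x: "x \<in> el y" and "y \<in> (\<Union>x\<in>X. el x)"
    then obtain z where z: "z \<in> X" "y \<in> el z" by blast
    then have "z \<in> Ord" using assms(2) by blast
    from Ord_trans[OF this x z(2)] z(1) show "x \<in> (\<Union>x\<in>X. el x)" by blast
  next
    fix x y assume "x \<in> (\<Union>x\<in>X. el x)" "y \<in> (\<Union>x\<in>X. el x)"
    then obtain z w where z: "z \<in> X" "x \<in> el z" "w \<in> X" "y \<in> el w" by blast
    then have "z \<in> Ord" "w \<in> Ord" using assms(2) by blast+
    with z have "x \<in> Ord" "y \<in> Ord" using Ord_elem[of z x] Ord_elem[of w y] by simp_all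
    then show "x \<in> el y \<or> x = y \<or> y \<in> el x" by (rule Ord_linear)
  qed
qed

lemma Ord_bound: "isset X \<Longrightarrow> X \<subseteq> Ord \<Longrightarrow> \<exists>b\<in>Ord. X \<subseteq> el b"
proof -
  assume X: "isset X" "X \<subseteq> Ord"
  let ?u = "setof (\<Union>x\<in>X. el x)"
  have "x \<in> el (sc ?u)" if "x \<in> X" for x
  proof -
    have "el x \<subseteq> el ?u" using Ord_Union(2)[OF X] that by auto
    then show ?thesis using Ord_le_iff[of x ?u] X that Ord_Union(1)[OF X] by auto
  qed
  then show ?thesis using Ord_Union(1)[OF X] by (intro bexI[of _ "sc ?u"]) auto
qed

text \<open>The Burali-Forti paradox; this is what makes an admissible ordinal exist later on.\<close>

lemma Ord_not_set: "isset X \<Longrightarrow> \<not> Ord \<subseteq> X"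
proof
  assume X: "isset X" "Ord \<subseteq> X"
  have "isset Ord" by (rule isset_subset[OF X]) (rule dfb)
  with Ord_bound[of Ord] no_self show False by blast
qed

lemma Ord_least:
  assumes P: "Dfb U (\<lambda>e. P (e 0))" and a: "a \<in> Ord" "P a"
  obtains b where "b \<in> Ord" "P b" "\<And>c. c \<in> el b \<Longrightarrow> \<not> P c"
proof -
  have "isset {z \<in> el (sc a). P z}" by (rule isset_sep[OF _ P]) simp
  moreover have "a \<in> {z \<in> el (sc a). P z}" using a by simp
  ultimately obtain b where b: "b \<in> el (sc a)" "P b" "el b \<inter> {z \<in> el (sc a). P z} = {}"
    using found by blast
  have "b \<in> Ord" using b(1) a Ord_elem sc_Ord by blast
  moreover have "\<not> P c" if "c \<in> el b" for c
    using b that Ord_trans[OF sc_Ord[OF a(1)] that b(1)] by blast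
  ultimately show ?thesis using that b(2) by blast
qed

lemma Ord_induct:
  assumes P: "Dfb U (\<lambda>e. P (e 0))" and a: "a \<in> Ord"
    and step: "\<And>b. b \<in> Ord \<Longrightarrow> (\<And>c. c \<in> el b \<Longrightarrow> P c) \<Longrightarrow> P b"
  shows "P a"
proof (rule ccontr)
  assume "\<not> P a"
  then obtain b where "b \<in> Ord" "\<not> P b" "\<And>c. c \<in> el b \<Longrightarrow> \<not> \<not> P c"
    using Ord_least[of "\<lambda>x. \<not> P x" a, OF dfb_not[OF P] a] by blast
  then show False using step by blast
qed

lemma is_succ_iff: "a \<in> U \<Longrightarrow> b \<in> U \<Longrightarrow> is_succ a b \<longleftrightarrow> b = sc a"
  unfolding is_succ_def using el_sc[of a] el_inj[of b "sc a"] by simp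

lemma limitI: "a \<in> Ord \<Longrightarrow> x \<in> el a \<Longrightarrow> (\<And>y. y \<in> el a \<Longrightarrow> sc y \<in> el a) \<Longrightarrow> limit_ordinal a"
  unfolding limit_ordinal_def
proof (intro conjI ballI)
  assume a: "a \<in> Ord" "x \<in> el a" "\<And>y. y \<in> el a \<Longrightarrow> sc y \<in> el a"
  show "ordinal a" using a(1) unfolding Ord_def by blast
  show "el a \<noteq> {}" using a by blast
  fix y assume "y \<in> el a"
  then show "\<exists>z\<in>el a. mem y z" using a(3) mem_iff[of y "sc y"] by (intro bexI[of _ "sc y"]) auto
qed

lemma limit_Ord: "a \<in> U \<Longrightarrow> limit_ordinal a \<Longrightarrow> a \<in> Ord"
  unfolding limit_ordinal_def Ord_def by blast

lemma limit_sc: "a \<in> U \<Longrightarrow> limit_ordinal a \<Longrightarrow> b \<in> el a \<Longrightarrow> sc b \<in> el a"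
proof -
  assume a: "a \<in> U" "limit_ordinal a" "b \<in> el a"
  then obtain z where z: "z \<in> el a" "b \<in> el z" unfolding limit_ordinal_def using mem_iff[OF el_U[OF a(3)]] by blast
  have O: "a \<in> Ord" using limit_Ord a by blast
  then have "el (sc b) \<subseteq> el z" using Ord_sc_le z Ord_elem by blast
  then have "sc b = z \<or> sc b \<in> el z" using Ord_le_iff[of "sc b" z] O z a Ord_elem by blast
  then show ?thesis using z O Ord_trans by blast
qed

lemma limit_nonempty: "a \<in> U \<Longrightarrow> limit_ordinal a \<Longrightarrow> emp \<in> el a"
proof -
  assume a: "a \<in> U" "limit_ordinal a"
  then have "a \<in> Ord" "el a \<noteq> {}" using limit_Ord unfolding limit_ordinal_def by blast+
  then show ?thesis using Ord_le_iff[of emp a] by auto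
qed

lemma sc_not_limit: "a \<in> Ord \<Longrightarrow> \<not> limit_ordinal (sc a)"
  using limit_sc[of "sc a" a] no_self[of "sc a"] by auto

lemma Ord_cases:
  assumes "a \<in> Ord" obtains "a = emp" | b where "b \<in> Ord" "a = sc b" "b \<in> el a" | "limit_ordinal a"
proof (cases "a = emp \<or> limit_ordinal a")
  case False
  then have "el a \<noteq> {}" using el_emp_iff assms by auto
  with False obtain b where b: "b \<in> el a" "sc b \<notin> el a" using limitI[OF assms] by blast
  then have "sc b = a" using Ord_sc_mem[OF assms] by blast
  then show ?thesis using that(2)[of b] b(1) Ord_elem[OF assms] by blast
qed (use that in blast)

lemma Ord_limit_cases:
  assumes "a \<in> Ord"
  shows "a = emp \<or> (\<exists>b\<in>el a. a = sc b) \<or> limit_ordinal a"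
  using Ord_cases[OF assms] by metis

section \<open>Transfinite recursion\<close>

lemma lam_cong: "(\<And>x. x \<in> X \<Longrightarrow> F x = H x) \<Longrightarrow> lam X F = lam X H"
  unfolding lam_def by (rule arg_cong[of _ _ setof]) (simp cong: image_cong)

text \<open>Definability of the step functions of recursions: their arguments are a parameter, the ordinal, and
  the restriction of the recursively defined function to that ordinal, as a set of pairs.\<close>

definition Dg :: "'a set \<Rightarrow> ('a \<Rightarrow> 'a \<Rightarrow> 'a \<Rightarrow> 'a) \<Rightarrow> bool" where
  "Dg C G \<longleftrightarrow> (\<forall>i j k. Dft C (\<lambda>e. G (e i) (e j) (e k)))"

lemma DgD: "Dg C G \<Longrightarrow> Dft C a \<Longrightarrow> Dft C b \<Longrightarrow> Dft C c \<Longrightarrow> Dft C (\<lambda>e. G (a e) (b e) (c e))"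
  unfolding Dg_def by (rule dft_lift3) auto

lemma Dg_U: "Dg C G \<Longrightarrow> a \<in> U \<Longrightarrow> b \<in> U \<Longrightarrow> c \<in> U \<Longrightarrow> G a b c \<in> U"
proof -
  assume "Dg C G" and abc: "a \<in> U" "b \<in> U" "c \<in> U"
  then have "Dft C (\<lambda>e. G (e 0) (e 1) (e 2))" by (simp add: Dg_def)
  from dft_U[OF this range_case[OF _ range_case[of b "\<lambda>_. c"]], of a] abc
  show ?thesis by (auto simp: numeral_2_eq_2)
qed

text \<open>\<open>h\<close> is the restriction to \<open>a\<close> of the function defined by the recursion.\<close>

definition approx :: "('a \<Rightarrow> 'a \<Rightarrow> 'a \<Rightarrow> 'a) \<Rightarrow> 'a \<Rightarrow> 'a \<Rightarrow> 'a \<Rightarrow> bool" where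
  "approx G p a h \<longleftrightarrow> h = lam (el a) (fn h) \<and> (\<forall>b\<in>el a. fn h b = G p b (lam (el b) (fn h)))"

definition rec :: "('a \<Rightarrow> 'a \<Rightarrow> 'a \<Rightarrow> 'a) \<Rightarrow> 'a \<Rightarrow> 'a \<Rightarrow> 'a" where
  "rec G p a = (if a \<in> Ord then G p a (uniq (approx G p a)) else emp)"

lemma dfb_approx:
  assumes "Dg C G" "Dft C p" "Dft C a" "Dft C h" shows "Dfb C (\<lambda>e. approx G (p e) (a e) (h e))"
  by (rule dfb_lift3[of C "approx G", OF _ assms(2-)]) (unfold approx_def, (rule dfb DgD[OF assms(1)])+)

lemma dft_rec:
  assumes "Dg C G" "Dft C p" "Dft C a" shows "Dft C (\<lambda>e. rec G (p e) (a e))"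
  by (rule dft_lift2[of C "rec G", OF _ assms(2-)])
     (unfold rec_def, (rule dfb dfb_approx DgD[OF assms(1)] assms(1))+)

lemma fn_lam_fn: "a \<in> U \<Longrightarrow> h \<in> U \<Longrightarrow> b \<in> el a \<Longrightarrow> fn (lam (el a) (fn h)) b = fn h b"
  by (rule fn_lam) (simp, (rule dfb dft_const_U | assumption)+)

lemma approx_restrict:
  assumes "approx G p a h" "a \<in> Ord" "h \<in> U" "c \<in> el a" shows "approx G p c (lam (el c) (fn h))"
proof -
  have 1: "fn (lam (el c) (fn h)) d = fn h d" if "d \<in> el c" for d
    using fn_lam_fn[of c h d] assms that by simp
  have 2: "lam (el d) (fn (lam (el c) (fn h))) = lam (el d) (fn h)" if "el d \<subseteq> el c" for d
    by (rule lam_cong) (use 1 that in blast)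
  show ?thesis unfolding approx_def
  proof (intro conjI ballI)
    show "lam (el c) (fn h) = lam (el c) (fn (lam (el c) (fn h)))" by (rule 2[symmetric]) simp
    fix b assume b: "b \<in> el c"
    have "b \<in> el a" using Ord_trans[OF assms(2) b assms(4)] .
    moreover have "el b \<subseteq> el c"
      using Ord_elem[OF assms(2,4)] b Ord_trans by blast
    ultimately show "fn (lam (el c) (fn h)) b = G p b (lam (el b) (fn (lam (el c) (fn h))))"
      using assms(1) 1[OF b] 2[of b] by (simp add: approx_def)
  qed
qed

lemma approx_unique:
  assumes a: "a \<in> Ord" and h: "approx G p a h" "h \<in> U" and h': "approx G p a h'" "h' \<in> U"
  shows "h = h'"
proof -
  have "b \<in> el a \<longrightarrow> fn h b = fn h' b" if "b \<in> Ord" for b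
  proof (rule Ord_induct[of "\<lambda>b. b \<in> el a \<longrightarrow> fn h b = fn h' b", OF _ that])
    show "Dfb U (\<lambda>e. e 0 \<in> el a \<longrightarrow> fn h (e 0) = fn h' (e 0))"
      by (rule dfb dft_const_U[OF Ord_U[OF a]] dft_const_U[OF h(2)] dft_const_U[OF h'(2)])+
    fix b assume b: "b \<in> Ord" and IH: "\<And>c. c \<in> el b \<Longrightarrow> c \<in> el a \<longrightarrow> fn h c = fn h' c"
    show "b \<in> el a \<longrightarrow> fn h b = fn h' b"
    proof
      assume ba: "b \<in> el a"
      have "lam (el b) (fn h) = lam (el b) (fn h')"
        by (rule lam_cong) (use IH ba Ord_trans[OF a] in blast)
      then show "fn h b = fn h' b" using h(1) h'(1) ba by (simp add: approx_def)
    qed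
  qed
  then have "lam (el a) (fn h) = lam (el a) (fn h')"
    by (intro lam_cong) (use a Ord_elem in blast)
  then show ?thesis using h(1) h'(1) by (simp add: approx_def)
qed

text \<open>The approximations for the smaller ordinals cohere, so their next values form one for \<open>b\<close>.\<close>

lemma approx_exists:
  assumes G: "Dg U G" and p: "p \<in> U" and a: "a \<in> Ord"
  shows "\<exists>h\<in>U. approx G p a h"
proof (rule Ord_induct[of "\<lambda>a. \<exists>h\<in>U. approx G p a h", OF _ a])
  show "Dfb U (\<lambda>e. \<exists>h\<in>U. approx G p (e 0) h)"
    by (rule dfb dfb_approx G dft_const_U[OF p])+
next
  fix b assume b: "b \<in> Ord" and IH: "\<And>c. c \<in> el b \<Longrightarrow> \<exists>h\<in>U. approx G p c h"
  define H where "H c = uniq (approx G p c)" for c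
  have H: "H c \<in> U" "approx G p c (H c)" if c: "c \<in> el b" for c
  proof -
    obtain h where h: "h \<in> U" "approx G p c h" using IH[OF c] by blast
    have "c \<in> Ord" using Ord_elem[OF b c] .
    then have "uniq (approx G p c) = h" using approx_unique h by (intro uniq_eq) auto
    then show "H c \<in> U" "approx G p c (H c)" using h by (simp_all add: H_def)
  qed
  define v where "v c = G p c (H c)" for c
  have v: "Dft U (\<lambda>e. v (e 0))" unfolding v_def H_def
    by (rule dfb dfb_approx G DgD[OF G] dft_const_U[OF p])+
  define h where "h = lam (el b) v"
  have bU: "b \<in> U" using b by simp
  have fnh: "fn h c = v c" if "c \<in> el b" for c
    unfolding h_def by (rule fn_lam[OF _ v that]) (simp add: bU)
  have Hc: "lam (el c) (fn h) = H c" if c: "c \<in> el b" for c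
  proof -
    have cO: "c \<in> Ord" using Ord_elem[OF b c] .
    have "fn h d = fn (H c) d" if d: "d \<in> el c" for d
    proof -
      have db: "d \<in> el b" using Ord_trans[OF b d c] .
      have "lam (el d) (fn (H c)) = H d"
        by (rule approx_unique[OF Ord_elem[OF b db] approx_restrict[OF H(2)[OF c] cO H(1)[OF c] d] _ H(2)[OF db] H(1)[OF db]]) simp
      then show ?thesis using fnh[OF db] H(2)[OF c] d by (simp add: v_def approx_def)
    qed
    then have "lam (el c) (fn h) = lam (el c) (fn (H c))" by (rule lam_cong)
    then show ?thesis using H(2)[OF c] by (simp add: approx_def)
  qed
  have "approx G p b h" unfolding approx_def
  proof (intro conjI ballI)
    show "h = lam (el b) (fn h)" unfolding h_def by (rule lam_cong) (use fnh in \<open>simp add: h_def\<close>)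
    fix c assume "c \<in> el b"
    then show "fn h c = G p c (lam (el c) (fn h))" using fnh Hc by (simp add: v_def)
  qed
  moreover have "h \<in> U" by (simp add: h_def)
  ultimately show "\<exists>h\<in>U. approx G p b h" by blast
qed

lemma rec_eq:
  assumes G: "Dg U G" and p: "p \<in> U" and a: "a \<in> Ord"
  shows "rec G p a = G p a (lam (el a) (rec G p))"
proof -
  obtain h where h: "h \<in> U" "approx G p a h" using approx_exists[OF assms] by blast
  have uh: "uniq (approx G p a) = h" using approx_unique[OF a] h by (intro uniq_eq) auto
  have "fn h b = rec G p b" if b: "b \<in> el a" for b
  proof -
    have bO: "b \<in> Ord" using Ord_elem[OF a b] .
    have "uniq (approx G p b) = lam (el b) (fn h)"
    proof (rule uniq_eq)
      show 1: "approx G p b (lam (el b) (fn h))" by (rule approx_restrict[OF h(2) a h(1) b])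
      show "k = lam (el b) (fn h)" if "k \<in> U" "approx G p b k" for k
        by (rule approx_unique[OF bO that(2,1) 1]) simp
    qed simp
    then show ?thesis using h(2) b bO by (simp add: rec_def approx_def)
  qed
  then have "lam (el a) (fn h) = lam (el a) (rec G p)" by (rule lam_cong)
  then have "h = lam (el a) (rec G p)" using h(2) by (simp add: approx_def)
  with uh show ?thesis using a by (simp add: rec_def)
qed

lemma fn_rec:
  assumes "Dg U G" "p \<in> U" "a \<in> Ord" "b \<in> el a"
  shows "fn (lam (el a) (rec G p)) b = rec G p b"
  by (rule fn_lam[OF _ _ assms(4)]) (use assms(3) in simp, (rule dft_rec assms(1) dfb dft_const_U[OF assms(2)])+)

lemma rec_U: "Dg U G \<Longrightarrow> p \<in> U \<Longrightarrow> rec G p a \<in> U"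
  using rec_eq[of G p a] Dg_U[of U G p a] by (cases "a \<in> Ord") (auto simp: rec_def)

section \<open>The natural numbers of the model\<close>

lemma omega_iff: "n \<in> omega \<longleftrightarrow> n \<in> Ord \<and> \<not> limit_ordinal n \<and> (\<forall>m\<in>el n. \<not> limit_ordinal m)"
  unfolding omega_def Ord_def by blast

lemma omega_Ord: "n \<in> omega \<Longrightarrow> n \<in> Ord" by (simp add: omega_iff)

lemma omega_U[simp]: "n \<in> omega \<Longrightarrow> n \<in> U"
  unfolding omega_def by blast

lemma omega_elem: "n \<in> omega \<Longrightarrow> m \<in> el n \<Longrightarrow> m \<in> omega"
  unfolding omega_iff using Ord_elem Ord_trans by blast

lemma omega_cases: "n \<in> omega \<Longrightarrow> n = emp \<or> (\<exists>m\<in>omega. n = sc m)"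
proof -
  assume n: "n \<in> omega"
  then have "\<not> limit_ordinal n" by (simp add: omega_iff)
  with Ord_limit_cases[OF omega_Ord[OF n]] show ?thesis using omega_elem[OF n] by blast
qed

lemma emp_not_limit: "\<not> limit_ordinal emp"
  unfolding limit_ordinal_def by simp

lemma emp_omega[simp, intro]: "emp \<in> omega"
  by (simp add: omega_iff emp_not_limit)

lemma sc_omega[simp, intro]: "n \<in> omega \<Longrightarrow> sc n \<in> omega"
proof -
  assume n: "n \<in> omega"
  then have "sc n \<in> Ord" "\<not> limit_ordinal (sc n)" "el (sc n) = insert n (el n)"
    using omega_Ord[of n] sc_not_limit[of n] by auto
  then show ?thesis using n unfolding omega_iff by auto
qed

lemma omega_induct:
  assumes P: "Dfb U (\<lambda>e. P (e 0))" and n: "n \<in> omega"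
    and 0: "P emp" and S: "\<And>m. m \<in> omega \<Longrightarrow> P m \<Longrightarrow> P (sc m)"
  shows "P n"
proof -
  have "n \<in> omega \<longrightarrow> P n"
  proof (rule Ord_induct[of "\<lambda>n. n \<in> omega \<longrightarrow> P n", OF _ omega_Ord[OF n]])
    show "Dfb U (\<lambda>e. e 0 \<in> omega \<longrightarrow> P (e 0))" by (rule dfb P)+
    fix b assume IH: "\<And>c. c \<in> el b \<Longrightarrow> c \<in> omega \<longrightarrow> P c"
    show "b \<in> omega \<longrightarrow> P b"
    proof
      assume "b \<in> omega"
      then consider "b = emp" | m where "m \<in> omega" "b = sc m" using omega_cases by blast
      then show "P b" by cases (use 0 S IH in auto)
    qed
  qed
  then show ?thesis using n by blast
qed

text \<open>An inductive set supplied by the axiom of infinity includes \<open>\<omega>\<close>, by induction.\<close>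

lemma isset_omega[simp, intro]: "isset omega"
proof -
  obtain x where x: "x \<in> U" "\<exists>z\<in>el x. el z = {}" "\<forall>y\<in>el x. \<exists>z\<in>el x. el z = insert y (el y)"
    using ZF unfolding ZF_def infinity_def by blast
  have "n \<in> el x" if "n \<in> omega" for n
  proof (rule omega_induct[of "\<lambda>n. n \<in> el x", OF _ that])
    show "Dfb U (\<lambda>e. e 0 \<in> el x)" by (rule dfb dft_const_U[OF x(1)])+
    obtain z where z: "z \<in> el x" "el z = {}" using x(2) by blast
    then have "z = emp" by (simp add: el_emp_iff)
    then show "emp \<in> el x" using z(1) by simp
    fix m assume m: "m \<in> el x"
    then obtain z where z: "z \<in> el x" "el z = insert m (el m)" using x(3) by blast
    then have "z = sc m" using m by (intro el_ext) auto
    then show "sc m \<in> el x" using z by simp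
  qed
  then have "omega \<subseteq> el x" by blast
  then show ?thesis by (rule isset_subset[OF isset_el[OF x(1)]]) (rule dfb)
qed

definition om :: 'a where "om = setof omega"

lemma el_om[simp]: "el om = omega" by (simp add: om_def el_setof)
lemma om_U[simp, intro]: "om \<in> U" by (simp add: om_def)
lemma om_Ord[simp, intro]: "om \<in> Ord"
proof (rule OrdI[OF om_U], unfold el_om)
  show "x \<in> omega" if "x \<in> el y" "y \<in> omega" for x y using omega_elem that by blast
  show "x \<in> el y \<or> x = y \<or> y \<in> el x" if "x \<in> omega" "y \<in> omega" for x y
    using Ord_linear omega_Ord that by blast
qed

lemma om_limit: "limit_ordinal om"
  by (rule limitI[of _ emp]) auto

text \<open>Numerals of the metalanguage, which may be only an initial segment of the \<open>\<omega>\<close> of the model.\<close>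

primrec num :: "nat \<Rightarrow> 'a" where
  "num 0 = emp"
| "num (Suc k) = sc (num k)"

lemma num_omega[simp, intro]: "num k \<in> omega" by (induction k) auto
lemma num_U[simp, intro]: "num k \<in> U" using num_omega omega_U by blast

lemma is_numeral_iff: "x \<in> U \<Longrightarrow> is_numeral k x \<longleftrightarrow> x = num k"
  by (induction k arbitrary: x) (auto simp: el_emp_iff is_succ_iff)

lemma num_eq_iff[simp]: "num i = num j \<longleftrightarrow> i = j"
proof (induction i arbitrary: j)
  case 0 then show ?case by (cases j) (auto dest: sym)
next
  case (Suc i) then show ?case using sc_inj[of "num i"] by (cases j) auto
qed

lemma dft_num[dfb]: "Dft C (\<lambda>e. num k)"
proof (induction k)
  case 0 show ?case unfolding num.simps by (rule dfb)+
next
  case (Suc k) show ?case unfolding num.simps by (rule dfb Suc)+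
qed

section \<open>Transitive closures and membership induction\<close>

text \<open>Stage \<open>n\<close> of the transitive closure of \<open>x\<close> adds the members of members of the earlier stages.\<close>

definition tcG :: "'a \<Rightarrow> 'a \<Rightarrow> 'a \<Rightarrow> 'a" where
  "tcG x n h = setof (el x \<union> (\<Union>y\<in>(\<Union>m\<in>el n. el (fn h m)). el y))"

lemma Dg_tcG: "Dg C tcG"
  unfolding Dg_def tcG_def by (intro allI) (rule dfb)+

lemma el_tc_rec:
  assumes x: "x \<in> U" and n: "n \<in> Ord"
  shows "el (rec tcG x n) = el x \<union> (\<Union>y\<in>(\<Union>m\<in>el n. el (rec tcG x m)). el y)"
proof -
  have 1: "(\<Union>m\<in>el n. el (fn (lam (el n) (rec tcG x)) m)) = (\<Union>m\<in>el n. el (rec tcG x m))"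
    using fn_rec[OF Dg_tcG x n] by simp
  have 2: "isset (\<Union>m\<in>el n. el (rec tcG x m))"
    by (rule isset_UN[OF isset_el[OF Ord_U[OF n]]]) (rule dft_rec Dg_tcG dfb dft_const_U[OF x])+
  show ?thesis unfolding rec_eq[OF Dg_tcG x n] tcG_def[of x n "lam (el n) (rec tcG x)"] 1
    by (rule el_setof[OF isset_Un[OF isset_el[OF x] isset_Union[OF 2]]])
qed

lemma transitive_superset:
  assumes x: "x \<in> U"
  obtains t where "t \<in> U" "transitive t" "el x \<subseteq> el t"
proof -
  define X where "X = (\<Union>n\<in>omega. el (rec tcG x n))"
  have "isset X" unfolding X_def
    by (rule isset_UN[OF isset_omega]) (rule dft_rec Dg_tcG dfb dft_const_U[OF x])+
  then have eX: "el (setof X) = X" by (rule el_setof)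
  have "el x \<subseteq> X"
    using el_tc_rec[OF x emp_Ord] by (auto simp: X_def)
  moreover have "el y \<subseteq> X" if y: "y \<in> X" for y
  proof -
    obtain n where n: "n \<in> omega" "y \<in> el (rec tcG x n)" using y by (auto simp: X_def)
    have "n \<in> el (sc n)" using n(1) by simp
    then have "el y \<subseteq> el (rec tcG x (sc n))"
      using el_tc_rec[OF x sc_Ord[OF omega_Ord[OF n(1)]]] n(2) by blast
    then show ?thesis using n(1) by (auto simp: X_def)
  qed
  ultimately show ?thesis using that[of "setof X"] eX by (simp add: transitive_def)
qed

text \<open>A counterexample to the induction hypothesis has a counterexample among its members, and foundation
  applies to the set of the counterexamples inside a transitive set containing these members.\<close>

lemma mem_induct:
  assumes P: "Dfb U (\<lambda>e. P (e 0))" and step: "\<And>x. x \<in> U \<Longrightarrow> (\<And>y. y \<in> el x \<Longrightarrow> P y) \<Longrightarrow> P x"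
    and x: "x \<in> U"
  shows "P x"
proof (rule ccontr)
  assume "\<not> P x"
  then obtain y where y: "y \<in> el x" "\<not> P y" using step[OF x] by blast
  obtain t where t: "t \<in> U" "transitive t" "el x \<subseteq> el t" by (rule transitive_superset[OF x])
  define X where "X = {z \<in> el t. \<not> P z}"
  have "isset X" unfolding X_def by (rule isset_sep[OF isset_el[OF t(1)] dfb_not[OF P]])
  moreover have "X \<noteq> {}" using y t(3) by (auto simp: X_def)
  ultimately obtain z where z: "z \<in> X" "el z \<inter> X = {}" using found by blast
  have "P w" if "w \<in> el z" for w
    using z that transitiveD[OF t(2) that] by (auto simp: X_def)
  moreover have "z \<in> U" using z(1) el_U[of z t] by (simp add: X_def)
  ultimately have "P z" using step by blast
  then show False using z(1) by (simp add: X_def)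
qed

section \<open>Hierarchies\<close>

definition Ds :: "'a set \<Rightarrow> ('a \<Rightarrow> 'a \<Rightarrow> 'a) \<Rightarrow> bool" where
  "Ds C st \<longleftrightarrow> (\<forall>i j. Dft C (\<lambda>e. st (e i) (e j)))"

lemma DsD: "Ds C st \<Longrightarrow> Dft C a \<Longrightarrow> Dft C b \<Longrightarrow> Dft C (\<lambda>e. st (a e) (b e))"
  unfolding Ds_def by (rule dft_lift2) auto

text \<open>The hierarchy that iterates \<open>st p\<close> from the empty set; the instances are the \<open>V\<close>-hierarchy, the
  constructible hierarchy relative to \<open>p\<close>, and the stages of a truth definition.\<close>

definition levG :: "('a \<Rightarrow> 'a \<Rightarrow> 'a) \<Rightarrow> 'a \<Rightarrow> 'a \<Rightarrow> 'a \<Rightarrow> 'a" where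
  "levG st p a h = (if a = emp then emp
     else if \<exists>b\<in>el a. a = sc b then st p (fn h (uniq (\<lambda>b. a = sc b)))
     else setof (\<Union>b\<in>el a. el (fn h b)))"

definition lev :: "('a \<Rightarrow> 'a \<Rightarrow> 'a) \<Rightarrow> 'a \<Rightarrow> 'a \<Rightarrow> 'a" where
  "lev st = rec (levG st)"

lemma Dg_levG: "Ds C st \<Longrightarrow> Dg C (levG st)"
  unfolding Dg_def levG_def by (intro allI) (rule dfb DsD | assumption)+

lemma dft_lev: "Ds C st \<Longrightarrow> Dft C p \<Longrightarrow> Dft C a \<Longrightarrow> Dft C (\<lambda>e. lev st (p e) (a e))"
  unfolding lev_def by (rule dft_rec[OF Dg_levG])

lemma lev_U: "Ds U st \<Longrightarrow> p \<in> U \<Longrightarrow> lev st p a \<in> U"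
  unfolding lev_def by (rule rec_U[OF Dg_levG])

lemma lev_eq: "Ds U st \<Longrightarrow> p \<in> U \<Longrightarrow> a \<in> Ord \<Longrightarrow> lev st p a = levG st p a (lam (el a) (lev st p))"
  unfolding lev_def by (rule rec_eq[OF Dg_levG])

lemma lev_emp: "Ds U st \<Longrightarrow> p \<in> U \<Longrightarrow> lev st p emp = emp"
  using lev_eq[OF _ _ emp_Ord] by (simp add: levG_def)

lemma uniq_sc: "b \<in> U \<Longrightarrow> uniq (\<lambda>c. sc b = sc c) = b"
  by (rule uniq_eq) (auto dest: sc_inj)

lemma fn_lev: "Ds U st \<Longrightarrow> p \<in> U \<Longrightarrow> a \<in> Ord \<Longrightarrow> b \<in> el a \<Longrightarrow> fn (lam (el a) (lev st p)) b = lev st p b"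
  unfolding lev_def by (rule fn_rec[OF Dg_levG])

lemma lev_sc: "Ds U st \<Longrightarrow> p \<in> U \<Longrightarrow> b \<in> Ord \<Longrightarrow> lev st p (sc b) = st p (lev st p b)"
proof -
  assume *: "Ds U st" "p \<in> U" "b \<in> Ord"
  have 1: "\<exists>c\<in>el (sc b). sc b = sc c" using *(3) by (intro bexI[of _ b]) auto
  have 2: "b \<in> el (sc b)" using *(3) by simp
  show ?thesis
    using 1 fn_lev[OF *(1,2) sc_Ord[OF *(3)] 2]
    unfolding lev_eq[OF *(1,2) sc_Ord[OF *(3)]] levG_def uniq_sc[OF Ord_U[OF *(3)]]
    by (simp only: sc_not_emp[OF Ord_U[OF *(3)]] if_False if_True)
qed

lemma lev_limit:
  assumes "Ds U st" "p \<in> U" "a \<in> U" "limit_ordinal a"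
  shows "el (lev st p a) = (\<Union>b\<in>el a. el (lev st p b))"
proof -
  have a: "a \<in> Ord" using limit_Ord assms by blast
  have 1: "a \<noteq> emp" using assms(4) emp_not_limit by blast
  have 2: "\<not> (\<exists>b\<in>el a. a = sc b)" using assms(4) sc_not_limit Ord_elem[OF a] by metis
  have 3: "(\<Union>b\<in>el a. el (fn (lam (el a) (lev st p)) b)) = (\<Union>b\<in>el a. el (lev st p b))"
    using fn_lev[OF assms(1,2) a] by simp
  have 4: "isset (\<Union>b\<in>el a. el (lev st p b))"
    by (rule isset_UN[OF isset_el[OF assms(3)]]) (rule dft_lev assms(1) dfb dft_const_U[OF assms(2)])+
  show ?thesis
    unfolding lev_eq[OF assms(1,2) a] levG_def 3 using 1 2 4 by (simp add: el_setof)
qed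

definition step_ok :: "('a \<Rightarrow> 'a \<Rightarrow> 'a) \<Rightarrow> 'a \<Rightarrow> bool" where
  "step_ok st p \<longleftrightarrow> (\<forall>A\<in>U. transitive A \<longrightarrow> el A \<subseteq> el (st p A) \<and> transitive (st p A))"

lemma lev_trans_mono:
  assumes st: "Ds U st" "p \<in> U" "step_ok st p" and a: "a \<in> Ord"
  shows "transitive (lev st p a) \<and> (\<forall>b\<in>el a. el (lev st p b) \<subseteq> el (lev st p a))"
proof (rule Ord_induct[of "\<lambda>a. transitive (lev st p a) \<and> (\<forall>b\<in>el a. el (lev st p b) \<subseteq> el (lev st p a))", OF _ a])
  show "Dfb U (\<lambda>e. transitive (lev st p (e 0)) \<and> (\<forall>b\<in>el (e 0). el (lev st p b) \<subseteq> el (lev st p (e 0))))"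
    by (rule dfb dft_lev st(1) dft_const_U[OF st(2)])+
next
  fix a assume a: "a \<in> Ord" and
    IH: "\<And>c. c \<in> el a \<Longrightarrow> transitive (lev st p c) \<and> (\<forall>b\<in>el c. el (lev st p b) \<subseteq> el (lev st p c))"
  from Ord_cases[OF a] show "transitive (lev st p a) \<and> (\<forall>b\<in>el a. el (lev st p b) \<subseteq> el (lev st p a))"
  proof cases
    case 1
    then show ?thesis by (simp add: lev_emp st transitive_def)
  next
    case (2 b)
    have e: "lev st p a = st p (lev st p b)" using lev_sc[OF st(1,2) 2(1)] 2(2) by simp
    have IHb: "transitive (lev st p b)" "\<forall>c\<in>el b. el (lev st p c) \<subseteq> el (lev st p b)" using IH[OF 2(3)] by auto
    have "el (lev st p b) \<subseteq> el (lev st p a)" "transitive (lev st p a)"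
      using st(3) IHb(1) lev_U[OF st(1,2)] unfolding step_ok_def e by auto
    moreover have "el a = insert b (el b)" using 2 by simp
    ultimately show ?thesis using IHb(2) by auto
  next
    case 3
    have e: "el (lev st p a) = (\<Union>b\<in>el a. el (lev st p b))"
      by (rule lev_limit[OF st(1,2) Ord_U[OF a] 3])
    have "transitive (lev st p a)"
      unfolding transitive_def e using IH unfolding transitive_def by blast
    then show ?thesis using e by blast
  qed
qed

lemma lev_mono:
  assumes "Ds U st" "p \<in> U" "step_ok st p" "a \<in> Ord" "b \<in> el a \<or> b = a"
  shows "el (lev st p b) \<subseteq> el (lev st p a)"
  using lev_trans_mono[OF assms(1-4)] assms(5) by auto

text \<open>The recursively defined levels satisfy the first-order description of a hierarchy, which is how
  they enter the notions of admissibility and ordinal definability.\<close>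

lemma lev_level:
  assumes st: "Ds U st" "p \<in> U"
    and R: "\<And>A. A \<in> U \<Longrightarrow> R A (st p A)" and a: "a \<in> Ord"
  shows "level R emp a (lev st p a)"
proof -
  define h where "h = lam (el (sc a)) (lev st p)"
  have app: "app h b A \<longleftrightarrow> b \<in> el (sc a) \<and> A = lev st p b" if "b \<in> U" "A \<in> U" for b A
    unfolding h_def by (rule app_lam[OF _ _ that]) (simp, (rule dft_lev st(1) dfb dft_const_U[OF st(2)])+)
  have eq: "insert a (el a) = el (sc a)" using a by simp
  have sa: "sc a \<in> Ord" using a by simp
  have lU: "lev st p b \<in> U" for b by (rule lev_U[OF st])
  have "hierarchy R emp a h" unfolding hierarchy_def eq
  proof (intro ballI conjI impI)
    fix b assume b: "b \<in> el (sc a)"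
    then have bU: "b \<in> U" and bO: "b \<in> Ord" using Ord_elem[OF sa] by auto
    show "\<exists>!A. A \<in> U \<and> app h b A"
    proof (rule ex1I[of _ "lev st p b"])
      show "lev st p b \<in> U \<and> app h b (lev st p b)" using app[OF bU lU] b lU by simp
      show "A = lev st p b" if "A \<in> U \<and> app h b A" for A using app[OF bU conjunct1[OF that]] that by simp
    qed
    fix A assume A: "A \<in> U" "app h b A"
    then have AE: "A = lev st p b" using app[OF bU] by simp
    show "A = emp" if "el b = {}"
      using that bU lev_emp[OF st] by (simp add: AE el_emp_iff)
    show "R C A" if "c \<in> U" "C \<in> U" "is_succ c b \<and> app h c C" for c C
    proof -
      have bc: "b = sc c" using that is_succ_iff[OF that(1) bU] by simp
      then have "c \<in> el b" using that(1) by simp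
      then have "c \<in> Ord" using Ord_elem[OF bO] by blast
      then have "A = st p C" using app[OF that(1,2)] that(3) lev_sc[OF st] by (simp add: AE bc)
      then show ?thesis using R[OF that(2)] by simp
    qed
    show "el A = {z \<in> U. \<exists>c\<in>el b. \<exists>C\<in>U. app h c C \<and> z \<in> el C}" if l: "limit_ordinal b"
    proof -
      have 1: "(\<exists>C\<in>U. app h c C \<and> z \<in> el C) \<longleftrightarrow> z \<in> el (lev st p c)" if c: "c \<in> el b" for c z
      proof -
        have "app h c C \<longleftrightarrow> C = lev st p c" if "C \<in> U" for C
          using app[OF el_U[OF c] that] Ord_trans[OF sa c b] by simp
        then show ?thesis using lU[of c] by auto
      qed
      have "z \<in> el A \<longleftrightarrow> z \<in> U \<and> (\<exists>c\<in>el b. z \<in> el (lev st p c))" for z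
        unfolding AE lev_limit[OF st bU l] by auto
      then show ?thesis using 1 by auto
    qed
  qed
  moreover have "app h a (lev st p a)" using app[OF Ord_U[OF a] lU] a by simp
  moreover have "h \<in> U" by (simp add: h_def)
  moreover have "ordinal a" using a unfolding Ord_def by blast
  ultimately show ?thesis unfolding level_def by blast
qed

definition vstep :: "'a \<Rightarrow> 'a \<Rightarrow> 'a" where "vstep p A = setof {X \<in> U. el X \<subseteq> el A}"
definition V :: "'a \<Rightarrow> 'a" where "V a = lev vstep emp a"

lemma Ds_vstep: "Ds C vstep"
  unfolding Ds_def vstep_def by (intro allI) (rule dfb)+

lemma dft_V[dfb]: "Dft C a \<Longrightarrow> Dft C (\<lambda>e. V (a e))"
  unfolding V_def by (rule dft_lev Ds_vstep dfb | assumption)+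

lemma V_U[simp, intro]: "V a \<in> U" unfolding V_def by (rule lev_U[OF Ds_vstep emp_U])

lemma el_vstep: "A \<in> U \<Longrightarrow> el (vstep p A) = {X \<in> U. el X \<subseteq> el A}"
  unfolding vstep_def by (rule el_setof[OF isset_Pow[OF isset_el]])

lemma vstep_ok: "step_ok vstep p"
  unfolding step_ok_def
proof (intro ballI impI)
  fix A assume A: "A \<in> U" "transitive A"
  then show "el A \<subseteq> el (vstep p A) \<and> transitive (vstep p A)"
    unfolding transitive_def el_vstep[OF A(1)] by auto
qed

lemma V_sc: "a \<in> Ord \<Longrightarrow> el (V (sc a)) = {X \<in> U. el X \<subseteq> el (V a)}"
  unfolding V_def lev_sc[OF Ds_vstep emp_U] by (rule el_vstep) (rule lev_U[OF Ds_vstep emp_U])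

lemma V_limit: "a \<in> U \<Longrightarrow> limit_ordinal a \<Longrightarrow> el (V a) = (\<Union>b\<in>el a. el (V b))"
  unfolding V_def by (rule lev_limit[OF Ds_vstep emp_U])

lemma V_trans: "a \<in> Ord \<Longrightarrow> transitive (V a)"
  unfolding V_def using lev_trans_mono[OF Ds_vstep emp_U vstep_ok] by blast

lemma V_mono: "a \<in> Ord \<Longrightarrow> b \<in> el a \<or> b = a \<Longrightarrow> el (V b) \<subseteq> el (V a)"
  unfolding V_def by (rule lev_mono[OF Ds_vstep emp_U vstep_ok])

lemma V_level_V: "a \<in> Ord \<Longrightarrow> V_level a (V a)"
  unfolding V_level_def V_def
  by (intro bexI[of _ emp] conjI lev_level[OF Ds_vstep emp_U])
     (simp_all add: is_Pow_def el_vstep)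

definition least :: "('a \<Rightarrow> bool) \<Rightarrow> 'a" where
  "least P = uniq (\<lambda>a. a \<in> Ord \<and> P a \<and> (\<forall>c\<in>el a. \<not> P c))"

lemma dft_least[dfb]:
  assumes "Dfb C (\<lambda>e. P (\<lambda>n. e (Suc n)) (e 0))" shows "Dft C (\<lambda>e. least (P e))"
proof -
  have 1: "Dfb C (\<lambda>e. P (\<lambda>n. e (Suc (Suc n))) (e 0))" by (rule dfb_skip[OF assms])
  show ?thesis unfolding least_def by (rule dfb assms 1)+
qed

lemma least:
  assumes P: "Dfb U (\<lambda>e. P (e 0))" and a: "a \<in> Ord" "P a"
  shows "least P \<in> Ord" "P (least P)" "\<And>c. c \<in> el (least P) \<Longrightarrow> \<not> P c"
    "el (least P) \<subseteq> el a"
proof -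
  obtain b where b: "b \<in> Ord" "P b" "\<And>c. c \<in> el b \<Longrightarrow> \<not> P c"
    by (rule Ord_least[OF P a], rule that)
  have "least P = b" unfolding least_def
  proof (rule uniq_eq)
    fix c assume "c \<in> U" "c \<in> Ord \<and> P c \<and> (\<forall>d\<in>el c. \<not> P d)"
    then show "c = b" using Ord_linear[of b c] b by blast
  qed (use b in auto)
  with b show "least P \<in> Ord" "P (least P)" "\<And>c. c \<in> el (least P) \<Longrightarrow> \<not> P c" by auto
  show "el (least P) \<subseteq> el a"
    using Ord_not_mem[OF a(1) b(1)] b(3) a(2) \<open>least P = b\<close> by blast
qed

text \<open>If all members of a set occur in levels of the hierarchy, replacement bounds the least such levels.\<close>

lemma ranked:
  assumes x: "x \<in> U" shows "\<exists>a\<in>Ord. x \<in> el (V a)"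
proof (rule mem_induct[of "\<lambda>x. \<exists>a\<in>Ord. x \<in> el (V a)", OF _ _ x])
  show "Dfb U (\<lambda>e. \<exists>a\<in>Ord. e 0 \<in> el (V a))" by (rule dfb)+
next
  fix x assume x: "x \<in> U" and IH: "\<And>y. y \<in> el x \<Longrightarrow> \<exists>a\<in>Ord. y \<in> el (V a)"
  define r where "r y = least (\<lambda>a. y \<in> el (V a))" for y
  have r: "r y \<in> Ord" "y \<in> el (V (r y))" if y: "y \<in> el x" for y
  proof -
    obtain a where a: "a \<in> Ord" "y \<in> el (V a)" using IH[OF y] by blast
    have "Dfb U (\<lambda>e. y \<in> el (V (e 0)))" by (rule dfb dft_const_U[OF el_U[OF y]])+
    from least(1,2)[of "\<lambda>a. y \<in> el (V a)", OF this a] show "r y \<in> Ord" "y \<in> el (V (r y))"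
      by (simp_all add: r_def)
  qed
  have "isset (r ` el x)" unfolding r_def
    by (rule isset_image[OF isset_el[OF x]]) (rule dfb)+
  then obtain b where b: "b \<in> Ord" "r ` el x \<subseteq> el b" using Ord_bound[of "r ` el x"] r(1) by blast
  have "el x \<subseteq> el (V b)"
  proof
    fix y assume y: "y \<in> el x"
    then have "r y \<in> el b" using b(2) by blast
    then show "y \<in> el (V b)" using V_mono[OF b(1), of "r y"] r(2)[OF y] by blast
  qed
  then have "x \<in> el (V (sc b))" using V_sc[OF b(1)] x by simp
  then show "\<exists>a\<in>Ord. x \<in> el (V a)" using sc_Ord[OF b(1)] by blast
qed

lemma V_setof:
  assumes a: "a \<in> U" "limit_ordinal a" and b: "b \<in> el a" and X: "isset X" "X \<subseteq> el (V b)"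
  shows "setof X \<in> el (V a)"
proof -
  have aO: "a \<in> Ord" using limit_Ord a by blast
  have "setof X \<in> el (V (sc b))" using V_sc[OF Ord_elem[OF aO b]] el_setof[OF X(1)] X(2) by simp
  then show ?thesis using V_mono[OF aO] limit_sc[OF a b] by blast
qed

lemma V_common:
  assumes a: "a \<in> U" "limit_ordinal a" and x: "x \<in> el (V a)" and y: "y \<in> el (V a)"
  shows "\<exists>b\<in>el a. x \<in> el (V b) \<and> y \<in> el (V b)"
proof -
  have aO: "a \<in> Ord" using limit_Ord a by blast
  obtain b c where b: "b \<in> el a" "x \<in> el (V b)" and c: "c \<in> el a" "y \<in> el (V c)"
    using x y V_limit[OF a] by blast
  have "b \<in> Ord" "c \<in> Ord" using Ord_elem[OF aO] b c by auto
  then show ?thesis using Ord_linear[of b c] V_mono[of b c] V_mono[of c b] b c by blast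
qed

lemma V_pair:
  assumes a: "a \<in> U" "limit_ordinal a" and x: "x \<in> el (V a)" and y: "y \<in> el (V a)"
  shows "pair x y \<in> el (V a)"
proof -
  have dbl: "setof {u, v} \<in> el (V a)" if "u \<in> el (V a)" "v \<in> el (V a)" for u v
  proof -
    obtain b where b: "b \<in> el a" "u \<in> el (V b)" "v \<in> el (V b)" using V_common[OF a \<open>u \<in> _\<close> \<open>v \<in> _\<close>] by blast
    show ?thesis by (rule V_setof[OF a b(1)]) (use b in auto)
  qed
  have "setof {x} \<in> el (V a)" using dbl[OF x x] by simp
  then show ?thesis unfolding pair_def by (rule dbl[OF _ dbl[OF x y]])
qed

lemma Ord_sub_V:
  assumes a: "a \<in> Ord" shows "el a \<subseteq> el (V a)"
proof (rule Ord_induct[of "\<lambda>a. el a \<subseteq> el (V a)", OF _ a])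
  show "Dfb U (\<lambda>e. el (e 0) \<subseteq> el (V (e 0)))" by (rule dfb)+
  fix a assume a: "a \<in> Ord" and IH: "\<And>c. c \<in> el a \<Longrightarrow> el c \<subseteq> el (V c)"
  show "el a \<subseteq> el (V a)"
  proof
    fix b assume b: "b \<in> el a"
    have "b \<in> el (V (sc b))" using V_sc[OF Ord_elem[OF a b]] IH[OF b] b by simp
    moreover have "sc b \<in> el a \<or> sc b = a" using Ord_sc_mem[OF a b] by blast
    ultimately show "b \<in> el (V a)" using V_mono[OF a, of "sc b"] by blast
  qed
qed

section \<open>Closure ordinals\<close>

text \<open>Iterate \<open>\<omega>\<close> times an operation that majorises \<open>F\<close> on everything reached so far.\<close>

lemma Ord_closure:
  assumes dF: "Dft U (\<lambda>e. F (e 0))" and FO: "\<And>a. a \<in> Ord \<Longrightarrow> F a \<in> Ord" and b: "b \<in> Ord"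
  obtains a where "a \<in> Ord" "limit_ordinal a" "b \<in> el a" "\<And>x. x \<in> el a \<Longrightarrow> F x \<in> el a"
proof -
  have bU: "b \<in> U" using b by simp
  \<comment> \<open>\<open>H y\<close> is an ordinal above \<open>y\<close> and all \<open>F z\<close> with \<open>z \<le> y\<close>\<close>
  define K where "K y = sc ` (insert y (F ` el (sc y)))" for y
  define H where "H y = setof (\<Union>x\<in>K y. el x)" for y
  have dH: "Dft U (\<lambda>e. H (e 0))" unfolding H_def K_def by (rule dfb dft_comp[OF dF])+
  have KO: "K y \<subseteq> Ord" "isset (K y)" if y: "y \<in> Ord" for y
  proof -
    have "F z \<in> Ord" if "z \<in> el (sc y)" for z using FO[OF Ord_elem[OF sc_Ord[OF y] that]] .
    then show "K y \<subseteq> Ord" using y by (auto simp: K_def)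
    show "isset (K y)" unfolding K_def
      by (rule isset_image[OF isset_insert[OF Ord_U[OF y] isset_image[OF isset_el dF]]]) (simp, (rule dfb)+)
  qed
  have HO: "H y \<in> Ord" and elH: "el (H y) = (\<Union>x\<in>K y. el x)" if "y \<in> Ord" for y
    using Ord_Union[OF KO(2,1)[OF that]] by (simp_all add: H_def)
  have H1: "y \<in> el (H y)" if y: "y \<in> Ord" for y
    using elH[OF y] y by (auto simp: K_def)
  have H2: "F z \<in> el (H y)" if y: "y \<in> Ord" and z: "z \<in> el (sc y)" for y z
  proof -
    have "F z \<in> el (sc (F z))" using FO[OF Ord_elem[OF sc_Ord[OF y] z]] by simp
    then show ?thesis using elH[OF y] z by (auto simp: K_def)
  qed
  define G where "G p n h = setof (\<Union>x\<in>insert (sc b) ((\<lambda>m. H (fn h m)) ` el n). el x)" for p n h :: 'a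
  have dG: "Dg U G" unfolding Dg_def G_def by (intro allI) (rule dfb dft_comp[OF dH] dft_const_U[OF bU])+
  define g where "g = rec G emp"
  have dg: "Dft U (\<lambda>e. g (e 0))" unfolding g_def by (rule dft_rec[OF dG] dfb)+
  have g_eq: "g n = setof (\<Union>x\<in>insert (sc b) ((\<lambda>m. H (g m)) ` el n). el x)" if n: "n \<in> Ord" for n
    unfolding g_def
    by (subst rec_eq[OF dG emp_U n], subst G_def, simp add: fn_rec[OF dG emp_U n])
  have gX: "isset (insert (sc b) ((\<lambda>m. H (g m)) ` el n))" if "n \<in> Ord" for n
    by (rule isset_insert[OF _ isset_image]) (use b in simp, use that in simp, (rule dft_comp[OF dH] dg)+)
  have gO: "g n \<in> Ord" if "n \<in> Ord" for n
  proof (rule Ord_induct[of "\<lambda>n. g n \<in> Ord", OF _ that])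
    show "Dfb U (\<lambda>e. g (e 0) \<in> Ord)" by (rule dfb dft_comp[OF dg])+
    fix n assume n: "n \<in> Ord" and IH: "\<And>m. m \<in> el n \<Longrightarrow> g m \<in> Ord"
    show "g n \<in> Ord" unfolding g_eq[OF n]
      by (rule Ord_Union(1)[OF gX[OF n]]) (use IH HO b in auto)
  qed
  have elg: "el (g n) = el (sc b) \<union> (\<Union>m\<in>el n. el (H (g m)))" if n: "n \<in> Ord" for n
  proof -
    have "insert (sc b) ((\<lambda>m. H (g m)) ` el n) \<subseteq> Ord" using HO gO Ord_elem[OF n] b by auto
    from Ord_Union(2)[OF gX[OF n] this] show ?thesis by (simp add: g_eq[OF n])
  qed
  have gs: "isset (g ` omega)" by (rule isset_image[OF isset_omega dg])
  have gsO: "g ` omega \<subseteq> Ord" using gO omega_Ord by auto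
  define a where "a = setof (\<Union>x\<in>g ` omega. el x)"
  have a: "a \<in> Ord" "el a = (\<Union>n\<in>omega. el (g n))"
    using Ord_Union[OF gs gsO] by (simp_all add: a_def)
  have Hg: "el (H (g n)) \<subseteq> el a" if n: "n \<in> omega" for n
  proof -
    have "n \<in> el (sc n)" using n by simp
    then have "el (H (g n)) \<subseteq> el (g (sc n))" using elg[OF sc_Ord[OF omega_Ord[OF n]]] by blast
    then show ?thesis using a(2) n by blast
  qed
  have ba: "b \<in> el a" using elg[OF emp_Ord] a(2) bU by auto
  have key: "F x \<in> el a \<and> sc x \<in> el a" if x: "x \<in> el a" for x
  proof -
    obtain n where n: "n \<in> omega" "x \<in> el (g n)" using x a(2) by blast
    have gn: "g n \<in> Ord" by (rule gO[OF omega_Ord[OF n(1)]])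
    have "x \<in> el (sc (g n))" unfolding el_sc[OF Ord_U[OF gn]] using n(2) by (rule insertI2)
    then have Fx: "F x \<in> el a" by (rule subsetD[OF Hg[OF n(1)] H2[OF gn]])
    have "sc x \<in> el a" using Ord_sc_mem[OF gn n(2)]
    proof
      assume "sc x = g n"
      then show ?thesis using subsetD[OF Hg[OF n(1)] H1[OF gn]] by simp
    next
      assume "sc x \<in> el (g n)"
      then show ?thesis unfolding a(2) using n(1) by (rule UN_I[rotated])
    qed
    with Fx show ?thesis by (rule conjI)
  qed
  have "limit_ordinal a" by (rule limitI[OF a(1) ba]) (rule conjunct2[OF key])
  then show ?thesis by (rule that[OF a(1) _ ba]) (rule conjunct1[OF key])
qed

section \<open>Pairing of ordinals\<close>

text \<open>Ordinal addition: \<open>a + b = a \<union> {a + c | c < b}\<close>.\<close>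

definition addG :: "'a \<Rightarrow> 'a \<Rightarrow> 'a \<Rightarrow> 'a" where "addG a b h = setof (el a \<union> fn h ` el b)"
definition add :: "'a \<Rightarrow> 'a \<Rightarrow> 'a" where "add = rec addG"

lemma Dg_addG: "Dg C addG" unfolding Dg_def addG_def by (intro allI) (rule dfb)+
lemma dft_add[dfb]: "Dft C a \<Longrightarrow> Dft C b \<Longrightarrow> Dft C (\<lambda>e. add (a e) (b e))"
  unfolding add_def by (rule dft_rec[OF Dg_addG])

lemma el_add:
  assumes a: "a \<in> Ord" and b: "b \<in> Ord" shows "el (add a b) = el a \<union> add a ` el b"
proof -
  have aU: "a \<in> U" using a by simp
  have 1: "fn (lam (el b) (rec addG a)) ` el b = rec addG a ` el b"
    using fn_rec[OF Dg_addG aU b] by (rule image_cong[OF refl])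
  have "isset (el a \<union> rec addG a ` el b)"
    by (rule isset_Un[OF isset_el[OF aU] isset_image[OF isset_el[OF Ord_U[OF b]]]])
       (rule dft_rec[OF Dg_addG] dfb dft_const_U[OF aU])+
  then show ?thesis unfolding add_def rec_eq[OF Dg_addG aU b]
    unfolding addG_def[of a b "lam (el b) (rec addG a)"] 1 by (rule el_setof)
qed

lemma add_U[simp]: "a \<in> U \<Longrightarrow> add a b \<in> U" unfolding add_def by (rule rec_U[OF Dg_addG])

lemma add_Ord[simp]:
  assumes a: "a \<in> Ord" and b: "b \<in> Ord" shows "add a b \<in> Ord"
proof (rule Ord_induct[of "\<lambda>b. add a b \<in> Ord", OF _ b])
  show "Dfb U (\<lambda>e. add a (e 0) \<in> Ord)" by (rule dfb dft_const_U[OF Ord_U[OF a]])+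
  fix b assume b: "b \<in> Ord" and IH: "\<And>c. c \<in> el b \<Longrightarrow> add a c \<in> Ord"
  have O: "x \<in> Ord" if "x \<in> el (add a b)" for x
    using that IH Ord_elem[OF a] by (auto simp: el_add[OF a b])
  show "add a b \<in> Ord"
  proof (rule OrdI)
    fix x y assume x: "x \<in> el y" and "y \<in> el (add a b)"
    then consider "y \<in> el a" | c where "c \<in> el b" "y = add a c" by (auto simp: el_add[OF a b])
    then show "x \<in> el (add a b)"
    proof cases
      case 1 then show ?thesis using Ord_trans[OF a x] by (simp add: el_add[OF a b])
    next
      case (2 c)
      have "x \<in> el a \<union> add a ` el c" using x 2 el_add[OF a Ord_elem[OF b 2(1)]] by simp
      moreover have "el c \<subseteq> el b" using Ord_trans[OF b _ 2(1)] by blast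
      ultimately show ?thesis unfolding el_add[OF a b] by blast
    qed
  next
    fix x y assume "x \<in> el (add a b)" "y \<in> el (add a b)"
    then show "x \<in> el y \<or> x = y \<or> y \<in> el x" using Ord_linear[OF O O] by blast
  qed (use a in simp)
qed

lemma add_strict: "a \<in> Ord \<Longrightarrow> b \<in> Ord \<Longrightarrow> c \<in> el b \<Longrightarrow> add a c \<in> el (add a b)"
  by (simp add: el_add)

lemma add_cancel: "a \<in> Ord \<Longrightarrow> b \<in> Ord \<Longrightarrow> c \<in> Ord \<Longrightarrow> add a b = add a c \<Longrightarrow> b = c"
  using Ord_linear[of b c] add_strict[of a b c] add_strict[of a c b] no_self by metis

lemma add_ge1: "a \<in> Ord \<Longrightarrow> b \<in> Ord \<Longrightarrow> el a \<subseteq> el (add a b)" by (simp add: el_add)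

lemma Ord_le_less: "c \<in> Ord \<Longrightarrow> a \<in> Ord \<Longrightarrow> el a \<subseteq> el b \<Longrightarrow> b \<in> el c \<Longrightarrow> a \<in> el c"
proof -
  assume *: "c \<in> Ord" "a \<in> Ord" "el a \<subseteq> el b" "b \<in> el c"
  have "b \<in> Ord" using Ord_elem *(1,4) by blast
  then have "a = b \<or> a \<in> el b" using Ord_le_iff[OF *(2)] *(3) by blast
  then show ?thesis using *(4) Ord_trans[OF *(1) _ *(4)] by blast
qed

lemma add_ge2:
  assumes a: "a \<in> Ord" and b: "b \<in> Ord" shows "el b \<subseteq> el (add a b)"
proof (rule Ord_induct[of "\<lambda>b. el b \<subseteq> el (add a b)", OF _ b])
  show "Dfb U (\<lambda>e. el (e 0) \<subseteq> el (add a (e 0)))" by (rule dfb dft_const_U[OF Ord_U[OF a]])+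
  fix b assume b: "b \<in> Ord" and IH: "\<And>c. c \<in> el b \<Longrightarrow> el c \<subseteq> el (add a c)"
  show "el b \<subseteq> el (add a b)"
  proof
    fix c assume c: "c \<in> el b"
    show "c \<in> el (add a b)"
      by (rule Ord_le_less[OF add_Ord[OF a b] Ord_elem[OF b c] IH[OF c] add_strict[OF a b c]])
  qed
qed

text \<open>\<open>blk m\<close> is the start of the block of values that the pairing function \<open>cp\<close> assigns to the pairs with
  sum \<open>m\<close>.  A block with sum \<open>k\<close> has its values at \<open>blk k + a\<close> for \<open>a \<le> k\<close>.  The final successor in \<open>cp\<close>
  makes its values exceed both arguments, as recursion on codes requires.\<close>

definition blkG :: "'a \<Rightarrow> 'a \<Rightarrow> 'a \<Rightarrow> 'a" where
  "blkG p m h = setof (\<Union>x\<in>(\<lambda>k. sc (add (fn h k) k)) ` el m. el x)"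
definition blk :: "'a \<Rightarrow> 'a" where "blk = rec blkG emp"
definition cp :: "'a \<Rightarrow> 'a \<Rightarrow> 'a" where "cp a b = sc (add (blk (add a b)) a)"

lemma Dg_blkG: "Dg C blkG" unfolding Dg_def blkG_def by (intro allI) (rule dfb)+
lemma dft_blk[dfb]: "Dft C a \<Longrightarrow> Dft C (\<lambda>e. blk (a e))"
  unfolding blk_def by (rule dft_rec[OF Dg_blkG]) (rule dfb | assumption)+
lemma dft_cp[dfb]: "Dft C a \<Longrightarrow> Dft C b \<Longrightarrow> Dft C (\<lambda>e. cp (a e) (b e))"
  unfolding cp_def by (rule dfb | assumption)+

lemma blk_eq: "m \<in> Ord \<Longrightarrow> blk m = setof (\<Union>x\<in>(\<lambda>k. sc (add (blk k) k)) ` el m. el x)"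
  unfolding blk_def by (subst rec_eq[OF Dg_blkG emp_U], assumption, subst blkG_def, simp add: fn_rec[OF Dg_blkG emp_U])

lemma blk_isset: "m \<in> Ord \<Longrightarrow> isset ((\<lambda>k. sc (add (blk k) k)) ` el m)"
  by (rule isset_image) (simp, (rule dfb)+)

lemma blk_Ord[simp]:
  assumes m: "m \<in> Ord" shows "blk m \<in> Ord"
proof (rule Ord_induct[of "\<lambda>m. blk m \<in> Ord", OF _ m])
  show "Dfb U (\<lambda>e. blk (e 0) \<in> Ord)" by (rule dfb)+
  fix m assume m: "m \<in> Ord" and IH: "\<And>k. k \<in> el m \<Longrightarrow> blk k \<in> Ord"
  show "blk m \<in> Ord" unfolding blk_eq[OF m]
    by (rule Ord_Union(1)[OF blk_isset[OF m]]) (use IH Ord_elem[OF m] in auto)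
qed

lemma el_blk: "m \<in> Ord \<Longrightarrow> el (blk m) = (\<Union>k\<in>el m. el (sc (add (blk k) k)))"
proof -
  assume m: "m \<in> Ord"
  have "(\<lambda>k. sc (add (blk k) k)) ` el m \<subseteq> Ord" using Ord_elem[OF m] by auto
  from Ord_Union(2)[OF blk_isset[OF m] this] show ?thesis by (simp add: blk_eq[OF m])
qed

lemma blk_less: "m \<in> Ord \<Longrightarrow> k \<in> el m \<Longrightarrow> add (blk k) k \<in> el (blk m)"
proof -
  assume m: "m \<in> Ord" and k: "k \<in> el m"
  have "add (blk k) k \<in> U" using Ord_elem[OF m k] by simp
  then have "add (blk k) k \<in> el (sc (add (blk k) k))" by simp
  then show ?thesis using el_blk[OF m] k by blast
qed

lemma blk_ge:
  assumes m: "m \<in> Ord" shows "el m \<subseteq> el (blk m)"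
proof
  fix k assume k: "k \<in> el m"
  have kO: "k \<in> Ord" by (rule Ord_elem[OF m k])
  show "k \<in> el (blk m)"
    by (rule Ord_le_less[OF blk_Ord[OF m] kO add_ge2[OF blk_Ord[OF kO] kO] blk_less[OF m k]])
qed

lemma cp_Ord[simp]: "a \<in> Ord \<Longrightarrow> b \<in> Ord \<Longrightarrow> cp a b \<in> Ord" by (simp add: cp_def)

lemma cp_gt:
  assumes a: "a \<in> Ord" and b: "b \<in> Ord" shows "a \<in> el (cp a b)" "b \<in> el (cp a b)"
proof -
  let ?s = "add a b"
  have s: "?s \<in> Ord" using a b by simp
  have t: "add (blk ?s) a \<in> Ord" using a s by simp
  have le: "el ?s \<subseteq> el (add (blk ?s) a)" using blk_ge[OF s] add_ge1[OF blk_Ord[OF s] a] by blast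
  have m: "add (blk ?s) a \<in> el (cp a b)" using t by (simp add: cp_def)
  show "a \<in> el (cp a b)"
    by (rule Ord_le_less[OF cp_Ord[OF a b] a _ m]) (use add_ge1[OF a b] le in blast)
  show "b \<in> el (cp a b)"
    by (rule Ord_le_less[OF cp_Ord[OF a b] b _ m]) (use add_ge2[OF a b] le in blast)
qed

text \<open>Cantor's pairing function: the pairs with sum \<open>s\<close> are numbered consecutively from \<open>blk s\<close>,
  and \<open>blk\<close> grows fast enough for the blocks to be disjoint.\<close>

lemma cp_inject:
  assumes o: "a \<in> Ord" "b \<in> Ord" "c \<in> Ord" "d \<in> Ord" and eq: "cp a b = cp c d"
  shows "a = c \<and> b = d"
proof -
  let ?s = "add a b" and ?t = "add c d"
  have st: "?s \<in> Ord" "?t \<in> Ord" using o by simp_all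
  have O: "add (blk ?s) a \<in> Ord" "add (blk ?t) c \<in> Ord" using st o by simp_all
  have e: "add (blk ?s) a = add (blk ?t) c"
    by (rule sc_inj[OF Ord_U[OF O(1)] Ord_U[OF O(2)]]) (use eq in \<open>simp add: cp_def\<close>)
  have no: "add a b \<notin> el (add c d)"
    if "a \<in> Ord" "b \<in> Ord" "c \<in> Ord" "d \<in> Ord" "add (blk (add a b)) a = add (blk (add c d)) c" for a b c d
  proof
    assume m: "add a b \<in> el (add c d)"
    let ?s = "add a b" and ?t = "add c d"
    have st: "?s \<in> Ord" "?t \<in> Ord" using that by simp_all
    have "a = ?s \<or> a \<in> el ?s" using add_ge1[OF that(1,2)] Ord_le_iff[OF that(1) st(1)] by blast
    then have "add (blk ?s) a = add (blk ?s) ?s \<or> add (blk ?s) a \<in> el (add (blk ?s) ?s)"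
      using add_strict[OF blk_Ord[OF st(1)] st(1)] by metis
    then have "add (blk ?s) a \<in> el (blk ?t)"
      using blk_less[OF st(2) m] Ord_trans[OF blk_Ord[OF st(2)] _ blk_less[OF st(2) m]] by auto
    then have "add (blk ?t) c \<in> el (add (blk ?t) c)"
      using that(5) add_ge1[OF blk_Ord[OF st(2)] that(3)] by auto
    then show False using no_self by blast
  qed
  have "?s = ?t" using Ord_linear[OF st] no[OF o e] no[OF o(3,4,1,2) e[symmetric]] by blast
  with e have "a = c" using add_cancel[OF blk_Ord[OF st(2)] o(1,3)] by simp
  with \<open>?s = ?t\<close> show ?thesis using add_cancel[OF o(1,2,4)] by simp
qed

lemma cp_closure:
  assumes b: "b \<in> Ord"
  obtains a where "a \<in> Ord" "limit_ordinal a" "b \<in> el a" "\<And>x y. x \<in> el a \<Longrightarrow> y \<in> el a \<Longrightarrow> cp x y \<in> el a"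
proof -
  define X where "X x = (\<Union>u\<in>el (sc x). cp u ` el (sc x))" for x
  define F where "F x = setof (\<Union>y\<in>X x. el y)" for x
  have dF: "Dft U (\<lambda>e. F (e 0))" unfolding F_def X_def by (rule dfb)+
  have X: "isset (X x)" "X x \<subseteq> Ord" if x: "x \<in> Ord" for x
  proof -
    have e: "el (setof (cp u ` el (sc x))) = cp u ` el (sc x)" if "u \<in> el (sc x)" for u
      by (rule el_setof[OF isset_image]) (simp, (rule dfb dft_const_U[OF el_U[OF that]])+)
    have "isset (\<Union>u\<in>el (sc x). el (setof (cp u ` el (sc x))))"
      by (rule isset_UN) (simp, (rule dfb dft_const_U[OF Ord_U[OF x]])+)
    then show "isset (X x)" unfolding X_def using e by simp
    show "X x \<subseteq> Ord" unfolding X_def using Ord_elem[OF sc_Ord[OF x]] by auto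
  qed
  have FO: "F x \<in> Ord" if "x \<in> Ord" for x unfolding F_def by (rule Ord_Union(1)[OF X[OF that]])
  have le: "el (cp u v) \<subseteq> el (F x)" if x: "x \<in> Ord" and "u \<in> el (sc x)" "v \<in> el (sc x)" for u v x
    unfolding F_def Ord_Union(2)[OF X[OF x]] using that by (auto simp: X_def)
  obtain a where a: "a \<in> Ord" "limit_ordinal a" "b \<in> el a" "\<And>x. x \<in> el a \<Longrightarrow> F x \<in> el a"
    by (rule Ord_closure[OF dF FO b], assumption, rule that)
  have "cp x y \<in> el a" if xy: "x \<in> el a" "y \<in> el a" for x y
  proof -
    have O: "x \<in> Ord" "y \<in> Ord" using Ord_elem[OF a(1)] xy by auto
    obtain z where z: "z \<in> el a" "x \<in> el (sc z)" "y \<in> el (sc z)"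
    proof (cases "x \<in> el y")
      case True then show ?thesis using that[of y] xy O by simp
    next
      case False then show ?thesis using that[of x] xy O Ord_linear[OF O] by auto
    qed
    have zO: "z \<in> Ord" using Ord_elem[OF a(1) z(1)] .
    show ?thesis by (rule Ord_le_less[OF a(1) cp_Ord[OF O] le[OF zO z(2,3)] a(4)[OF z(1)]])
  qed
  with a show ?thesis using that by blast
qed

section \<open>Formulas inside the model\<close>

definition memc :: "'a \<Rightarrow> 'a \<Rightarrow> 'a" where "memc i j = pair (num 0) (pair i j)"
definition eqc :: "'a \<Rightarrow> 'a \<Rightarrow> 'a" where "eqc i j = pair (num 1) (pair i j)"
definition predc :: "'a \<Rightarrow> 'a" where "predc i = pair (num 2) i"
definition negc :: "'a \<Rightarrow> 'a" where "negc f = pair (num 3) f"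
definition conjc :: "'a \<Rightarrow> 'a \<Rightarrow> 'a" where "conjc f g = pair (num 4) (pair f g)"
definition exc :: "'a \<Rightarrow> 'a \<Rightarrow> 'a" where "exc i f = pair (num 5) (pair i f)"

lemmas code_defs = memc_def eqc_def predc_def negc_def conjc_def exc_def

lemma codes_U[simp, intro]:
  "memc i j \<in> U" "eqc i j \<in> U" "predc i \<in> U" "negc f \<in> U" "conjc f g \<in> U" "exc i f \<in> U"
  by (simp_all add: code_defs)

lemma tagged_iff: "a \<in> U \<Longrightarrow> c \<in> U \<Longrightarrow> tagged k a c \<longleftrightarrow> c = pair (num k) a"
  unfolding tagged_def
proof
  assume "a \<in> U" "c \<in> U" "\<exists>t\<in>U. is_numeral k t \<and> is_pair t a c"
  then show "c = pair (num k) a" using is_numeral_iff is_pair_iff by metis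
next
  assume "a \<in> U" "c \<in> U" "c = pair (num k) a"
  then show "\<exists>t\<in>U. is_numeral k t \<and> is_pair t a c"
    by (intro bexI[of _ "num k"]) (simp_all add: is_numeral_iff)
qed

lemma tagged2_iff: "a \<in> U \<Longrightarrow> b \<in> U \<Longrightarrow> c \<in> U \<Longrightarrow> tagged2 k a b c \<longleftrightarrow> c = pair (num k) (pair a b)"
  unfolding tagged2_def
proof
  assume *: "a \<in> U" "b \<in> U" "c \<in> U" "\<exists>p\<in>U. is_pair a b p \<and> tagged k p c"
  then show "c = pair (num k) (pair a b)" using is_pair_iff tagged_iff by metis
next
  assume "a \<in> U" "b \<in> U" "c \<in> U" "c = pair (num k) (pair a b)"
  then show "\<exists>p\<in>U. is_pair a b p \<and> tagged k p c"
    by (intro bexI[of _ "pair a b"]) (simp_all add: tagged_iff)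
qed

lemma code_iffs:
  "i \<in> U \<Longrightarrow> j \<in> U \<Longrightarrow> c \<in> U \<Longrightarrow> mem_code i j c \<longleftrightarrow> c = memc i j"
  "i \<in> U \<Longrightarrow> j \<in> U \<Longrightarrow> c \<in> U \<Longrightarrow> eq_code i j c \<longleftrightarrow> c = eqc i j"
  "i \<in> U \<Longrightarrow> c \<in> U \<Longrightarrow> pred_code i c \<longleftrightarrow> c = predc i"
  "f \<in> U \<Longrightarrow> c \<in> U \<Longrightarrow> neg_code f c \<longleftrightarrow> c = negc f"
  "f \<in> U \<Longrightarrow> g \<in> U \<Longrightarrow> c \<in> U \<Longrightarrow> conj_code f g c \<longleftrightarrow> c = conjc f g"
  "i \<in> U \<Longrightarrow> f \<in> U \<Longrightarrow> c \<in> U \<Longrightarrow> ex_code i f c \<longleftrightarrow> c = exc i f"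
  unfolding mem_code_def eq_code_def pred_code_def neg_code_def conj_code_def ex_code_def code_defs
  by (simp_all add: tagged_iff tagged2_iff del: num.simps One_nat_def)

lemma code_inject[simp]:
  "i \<in> U \<Longrightarrow> j \<in> U \<Longrightarrow> i' \<in> U \<Longrightarrow> j' \<in> U \<Longrightarrow> memc i j = memc i' j' \<longleftrightarrow> i = i' \<and> j = j'"
  "i \<in> U \<Longrightarrow> j \<in> U \<Longrightarrow> i' \<in> U \<Longrightarrow> j' \<in> U \<Longrightarrow> eqc i j = eqc i' j' \<longleftrightarrow> i = i' \<and> j = j'"
  "i \<in> U \<Longrightarrow> i' \<in> U \<Longrightarrow> predc i = predc i' \<longleftrightarrow> i = i'"
  "f \<in> U \<Longrightarrow> f' \<in> U \<Longrightarrow> negc f = negc f' \<longleftrightarrow> f = f'"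
  "f \<in> U \<Longrightarrow> g \<in> U \<Longrightarrow> f' \<in> U \<Longrightarrow> g' \<in> U \<Longrightarrow> conjc f g = conjc f' g' \<longleftrightarrow> f = f' \<and> g = g'"
  "i \<in> U \<Longrightarrow> f \<in> U \<Longrightarrow> i' \<in> U \<Longrightarrow> f' \<in> U \<Longrightarrow> exc i f = exc i' f' \<longleftrightarrow> i = i' \<and> f = f'"
  by (simp_all add: code_defs del: num.simps One_nat_def)

lemma tag_distinct: "i \<noteq> j \<Longrightarrow> x \<in> U \<Longrightarrow> y \<in> U \<Longrightarrow> pair (num i) x \<noteq> pair (num j) y"
  using pair_inject[of "num i" x "num j" y] num_eq_iff[of i j] num_U by blast

lemma code_distinct_aux:
  "memc a b \<noteq> eqc a' b'" "i \<in> U \<Longrightarrow> memc a b \<noteq> predc i" "f \<in> U \<Longrightarrow> memc a b \<noteq> negc f"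
  "memc a b \<noteq> conjc a' b'" "memc a b \<noteq> exc a' b'" "i \<in> U \<Longrightarrow> eqc a b \<noteq> predc i"
  "f \<in> U \<Longrightarrow> eqc a b \<noteq> negc f" "eqc a b \<noteq> conjc a' b'" "eqc a b \<noteq> exc a' b'"
  "i \<in> U \<Longrightarrow> f \<in> U \<Longrightarrow> predc i \<noteq> negc f" "i \<in> U \<Longrightarrow> predc i \<noteq> conjc a' b'"
  "i \<in> U \<Longrightarrow> predc i \<noteq> exc a' b'" "f \<in> U \<Longrightarrow> negc f \<noteq> conjc a' b'" "f \<in> U \<Longrightarrow> negc f \<noteq> exc a' b'"
  "conjc a b \<noteq> exc a' b'"
  unfolding code_defs by (rule tag_distinct; simp)+

lemmas code_distinct[simp] = code_distinct_aux code_distinct_aux[symmetric]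

lemma dft_codes[dfb]:
  "Dft C a \<Longrightarrow> Dft C b \<Longrightarrow> Dft C (\<lambda>e. memc (a e) (b e))"
  "Dft C a \<Longrightarrow> Dft C b \<Longrightarrow> Dft C (\<lambda>e. eqc (a e) (b e))"
  "Dft C a \<Longrightarrow> Dft C (\<lambda>e. predc (a e))"
  "Dft C a \<Longrightarrow> Dft C (\<lambda>e. negc (a e))"
  "Dft C a \<Longrightarrow> Dft C b \<Longrightarrow> Dft C (\<lambda>e. conjc (a e) (b e))"
  "Dft C a \<Longrightarrow> Dft C b \<Longrightarrow> Dft C (\<lambda>e. exc (a e) (b e))"
  unfolding code_defs by (rule dfb | assumption)+

lemma dfb_is_numeral[dfb]: "Dft C a \<Longrightarrow> Dfb C (\<lambda>e. is_numeral k (a e))"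
proof (induction k arbitrary: a)
  case 0 then show ?case unfolding is_numeral.simps by - (rule dfb | assumption)+
next
  case (Suc k)
  show ?case
    by (rule dfb_lift1[of C "is_numeral (Suc k)", OF _ Suc.prems])
       (unfold is_numeral.simps, (rule dfb Suc.IH)+)
qed

lemma dfb_tagged[dfb]: "Dft C a \<Longrightarrow> Dft C c \<Longrightarrow> Dfb C (\<lambda>e. tagged k (a e) (c e))"
  by (rule dfb_lift2[of C "tagged k"]) (unfold tagged_def, (rule dfb)+)

lemma dfb_tagged2[dfb]:
  "Dft C a \<Longrightarrow> Dft C b \<Longrightarrow> Dft C c \<Longrightarrow> Dfb C (\<lambda>e. tagged2 k (a e) (b e) (c e))"
  by (rule dfb_lift3[of C "tagged2 k"]) (unfold tagged2_def, (rule dfb)+)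

lemma dfb_code[dfb]:
  "Dft C a \<Longrightarrow> Dft C b \<Longrightarrow> Dft C c \<Longrightarrow> Dfb C (\<lambda>e. mem_code (a e) (b e) (c e))"
  "Dft C a \<Longrightarrow> Dft C b \<Longrightarrow> Dft C c \<Longrightarrow> Dfb C (\<lambda>e. eq_code (a e) (b e) (c e))"
  "Dft C a \<Longrightarrow> Dft C c \<Longrightarrow> Dfb C (\<lambda>e. pred_code (a e) (c e))"
  "Dft C a \<Longrightarrow> Dft C c \<Longrightarrow> Dfb C (\<lambda>e. neg_code (a e) (c e))"
  "Dft C a \<Longrightarrow> Dft C b \<Longrightarrow> Dft C c \<Longrightarrow> Dfb C (\<lambda>e. conj_code (a e) (b e) (c e))"
  "Dft C a \<Longrightarrow> Dft C b \<Longrightarrow> Dft C c \<Longrightarrow> Dfb C (\<lambda>e. ex_code (a e) (b e) (c e))"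
  unfolding mem_code_def eq_code_def pred_code_def neg_code_def conj_code_def ex_code_def
  by (rule dfb | assumption)+

lemma dfb_atomic[dfb]: "Dft C c \<Longrightarrow> Dfb C (\<lambda>e. atomic_code (c e))"
  by (rule dfb_lift1[of C atomic_code]) (unfold atomic_code_def, (rule dfb)+)

lemma dfb_boolean_closed[dfb]: "Dft C s \<Longrightarrow> Dfb C (\<lambda>e. boolean_closed (el (s e)))"
  by (rule dfb_lift1[of C "\<lambda>s. boolean_closed (el s)"]) (unfold boolean_closed_def, (rule dfb)+)

lemma dfb_ex_closed[dfb]: "Dft C s \<Longrightarrow> Dfb C (\<lambda>e. ex_closed (el (s e)))"
  by (rule dfb_lift1[of C "\<lambda>s. ex_closed (el s)"]) (unfold ex_closed_def, (rule dfb)+)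

lemma dfb_bounded_ex_closed[dfb]: "Dft C s \<Longrightarrow> Dfb C (\<lambda>e. bounded_ex_closed (el (s e)))"
  by (rule dfb_lift1[of C "\<lambda>s. bounded_ex_closed (el s)"]) (unfold bounded_ex_closed_def, (rule dfb)+)

lemma dfc_Formula[dfb]: "Dfc C (\<lambda>e. Formula)"
  unfolding Formula_def by (rule dfb)+

lemma dfc_Delta0[dfb]: "Dfc C (\<lambda>e. Delta0)"
  unfolding Delta0_def by (rule dfb)+

lemma dfc_Sigma1[dfb]: "Dfc C (\<lambda>e. Sigma1)"
  unfolding Sigma1_def by (rule dfb)+

lemma atomic_iff: "c \<in> U \<Longrightarrow> atomic_code c \<longleftrightarrow>
   (\<exists>i\<in>omega. \<exists>j\<in>omega. c = memc i j \<or> c = eqc i j \<or> c = predc i)"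
  unfolding atomic_code_def by (intro bex_cong refl) (simp add: code_iffs)

text \<open>This and the following equivalences replace the relational closure conditions by operations on
  codes.\<close>

lemma boolean_closed_iff: "S \<subseteq> U \<Longrightarrow> boolean_closed S \<longleftrightarrow> (\<forall>f\<in>S. negc f \<in> S) \<and> (\<forall>f\<in>S. \<forall>g\<in>S. conjc f g \<in> S)"
proof -
  assume S: "S \<subseteq> U"
  have 1: "(\<exists>f\<in>S. neg_code f c) \<longleftrightarrow> (\<exists>f\<in>S. c = negc f)" if "c \<in> U" for c
    by (rule bex_cong[OF refl]) (use code_iffs(4) S that in blast)
  have 2: "(\<exists>f\<in>S. \<exists>g\<in>S. conj_code f g c) \<longleftrightarrow> (\<exists>f\<in>S. \<exists>g\<in>S. c = conjc f g)" if "c \<in> U" for c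
    by (rule bex_cong[OF refl], rule bex_cong[OF refl]) (use code_iffs(5) S that in blast)
  have "boolean_closed S \<longleftrightarrow> (\<forall>c\<in>U. (\<exists>f\<in>S. c = negc f) \<or> (\<exists>f\<in>S. \<exists>g\<in>S. c = conjc f g) \<longrightarrow> c \<in> S)"
    unfolding boolean_closed_def by (rule ball_cong[OF refl]) (simp only: 1 2)
  then show ?thesis using codes_U(4,5) by blast
qed

lemma ex_closed_iff: "S \<subseteq> U \<Longrightarrow> ex_closed S \<longleftrightarrow> (\<forall>i\<in>omega. \<forall>f\<in>S. exc i f \<in> S)"
  unfolding ex_closed_def using code_iffs(6) codes_U(6) omega_U by (auto simp: subset_iff)

lemma bounded_ex_closed_iff: "S \<subseteq> U \<Longrightarrow> bounded_ex_closed S \<longleftrightarrow>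
   (\<forall>i\<in>omega. \<forall>j\<in>omega. \<forall>f\<in>S. i \<noteq> j \<longrightarrow> exc i (conjc (memc i j) f) \<in> S)"
proof -
  assume S: "S \<subseteq> U"
  have "(\<exists>m\<in>U. \<exists>g\<in>U. i \<noteq> j \<and> mem_code i j m \<and> conj_code m f g \<and> ex_code i g c) \<longleftrightarrow>
     i \<noteq> j \<and> c = exc i (conjc (memc i j) f)"
    if "i \<in> omega" "j \<in> omega" "f \<in> S" "c \<in> U" for i j f c
  proof -
    have "i \<in> U" "j \<in> U" "f \<in> U" using that S by auto
    then show ?thesis using that(4) by (auto simp: code_iffs)
  qed
  then have "(\<exists>i\<in>omega. \<exists>j\<in>omega. \<exists>f\<in>S. \<exists>m\<in>U. \<exists>g\<in>U.
        i \<noteq> j \<and> mem_code i j m \<and> conj_code m f g \<and> ex_code i g c) \<longleftrightarrow>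
      (\<exists>i\<in>omega. \<exists>j\<in>omega. \<exists>f\<in>S. i \<noteq> j \<and> c = exc i (conjc (memc i j) f))" if "c \<in> U" for c
    using that by (intro bex_cong refl) blast
  then have "bounded_ex_closed S \<longleftrightarrow>
      (\<forall>c\<in>U. (\<exists>i\<in>omega. \<exists>j\<in>omega. \<exists>f\<in>S. i \<noteq> j \<and> c = exc i (conjc (memc i j) f)) \<longrightarrow> c \<in> S)"
    unfolding bounded_ex_closed_def by (intro ball_cong refl) simp
  then show ?thesis using codes_U(6) by blast
qed

definition fclosed :: "'a set \<Rightarrow> bool" where
  "fclosed S \<longleftrightarrow> (\<forall>i\<in>omega. \<forall>j\<in>omega. memc i j \<in> S \<and> eqc i j \<in> S \<and> predc i \<in> S) \<and>
     (\<forall>f\<in>S. negc f \<in> S) \<and> (\<forall>f\<in>S. \<forall>g\<in>S. conjc f g \<in> S) \<and> (\<forall>i\<in>omega. \<forall>f\<in>S. exc i f \<in> S)"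

lemma atomic_all: "(\<forall>d\<in>U. atomic_code d \<longrightarrow> d \<in> S) \<longleftrightarrow>
    (\<forall>i\<in>omega. \<forall>j\<in>omega. memc i j \<in> S \<and> eqc i j \<in> S \<and> predc i \<in> S)"
  using atomic_iff codes_U(1-3) by (auto 0 3)

lemma Formula_iff: "c \<in> Formula \<longleftrightarrow> c \<in> U \<and> (\<forall>S\<in>U. fclosed (el S) \<longrightarrow> c \<in> el S)"
  unfolding Formula_def atomic_all fclosed_def
  using boolean_closed_iff[OF el_subset] ex_closed_iff[OF el_subset] by simp

lemma omega_sub_V: "omega \<subseteq> el (V om)" using Ord_sub_V[OF om_Ord] by simp

text \<open>Some set must be closed under the formation rules, since otherwise the intersection defining
  \<open>Formula\<close> would be the whole universe; the hereditarily finite sets are closed.\<close>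

lemma fclosed_Vom: "fclosed (el (V om))"
proof -
  have P: "pair x y \<in> el (V om)" if "x \<in> el (V om)" "y \<in> el (V om)" for x y
    by (rule V_pair[OF om_U om_limit that])
  have N: "num k \<in> el (V om)" for k using omega_sub_V by blast
  have O: "i \<in> el (V om)" if "i \<in> omega" for i using omega_sub_V that by blast
  show ?thesis unfolding fclosed_def code_defs
    by (intro conjI ballI P N; (assumption | rule O, assumption))
qed

lemma Formula_sub: "Formula \<subseteq> el (V om)"
  using Formula_iff fclosed_Vom V_U by blast

lemma isset_Formula[simp, intro]: "isset Formula"
  by (rule isset_subset[OF isset_el[OF V_U] Formula_sub]) (rule dfb)

lemma fclosed_Formula: "fclosed Formula"
  unfolding fclosed_def
  by (intro conjI ballI; unfold Formula_iff fclosed_def; blast intro: codes_U)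

lemma Formula_intros:
  "i \<in> omega \<Longrightarrow> j \<in> omega \<Longrightarrow> memc i j \<in> Formula"
  "i \<in> omega \<Longrightarrow> j \<in> omega \<Longrightarrow> eqc i j \<in> Formula"
  "i \<in> omega \<Longrightarrow> predc i \<in> Formula"
  "f \<in> Formula \<Longrightarrow> negc f \<in> Formula"
  "f \<in> Formula \<Longrightarrow> g \<in> Formula \<Longrightarrow> conjc f g \<in> Formula"
  "i \<in> omega \<Longrightarrow> f \<in> Formula \<Longrightarrow> exc i f \<in> Formula"
  using fclosed_Formula unfolding fclosed_def by blast+

lemma Formula_U[simp]: "c \<in> Formula \<Longrightarrow> c \<in> U" using Formula_iff by blast

lemma Formula_induct:
  assumes P: "Dfb U (\<lambda>e. P (e 0))" and c: "c \<in> Formula"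
    and mem: "\<And>i j. i \<in> omega \<Longrightarrow> j \<in> omega \<Longrightarrow> P (memc i j)"
    and eq: "\<And>i j. i \<in> omega \<Longrightarrow> j \<in> omega \<Longrightarrow> P (eqc i j)"
    and pred: "\<And>i. i \<in> omega \<Longrightarrow> P (predc i)"
    and neg: "\<And>f. f \<in> Formula \<Longrightarrow> P f \<Longrightarrow> P (negc f)"
    and conj: "\<And>f g. f \<in> Formula \<Longrightarrow> g \<in> Formula \<Longrightarrow> P f \<Longrightarrow> P g \<Longrightarrow> P (conjc f g)"
    and ex: "\<And>i f. i \<in> omega \<Longrightarrow> f \<in> Formula \<Longrightarrow> P f \<Longrightarrow> P (exc i f)"
  shows "P c"
proof -
  have s: "isset {c \<in> Formula. P c}" by (rule isset_sep[OF isset_Formula P])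
  have "fclosed {c \<in> Formula. P c}" unfolding fclosed_def
    using mem eq pred neg conj ex by (auto intro: Formula_intros)
  then have "fclosed (el (setof {c \<in> Formula. P c}))" by (simp only: el_setof[OF s])
  then have "c \<in> el (setof {c \<in> Formula. P c})" using c Formula_iff setof_U by blast
  then show ?thesis by (simp add: el_setof[OF s])
qed

section \<open>Assignments\<close>

lemma dfc_assignments[dfb]: "Dft C a \<Longrightarrow> Dfc C (\<lambda>e. assignments (el (a e)))"
  by (rule dfc_lift1[of C "\<lambda>a. assignments (el a)"]) (unfold assignments_def, (rule dfb)+)

lemma dfb_update[dfb]:
  "Dft C a \<Longrightarrow> Dft C b \<Longrightarrow> Dft C c \<Longrightarrow> Dft C d \<Longrightarrow> Dfb C (\<lambda>e. update (a e) (b e) (c e) (d e))"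
  by (rule dfb_lift4[of C update]) (unfold update_def, (rule dfb)+)

abbreviation As :: "'a \<Rightarrow> 'a set" where "As A \<equiv> assignments (el A)"

text \<open>Assignments may have infinite domain; \<open>Sat_support\<close> below allows to cut them down.\<close>

lemma As_iff: "e \<in> As A \<longleftrightarrow> e \<in> U \<and> (\<forall>p\<in>el e. \<exists>i\<in>omega. \<exists>a\<in>el A. p = pair i a) \<and>
    (\<forall>i\<in>U. \<forall>a\<in>U. \<forall>b\<in>U. app e i a \<and> app e i b \<longrightarrow> a = b)"
proof -
  have "is_pair i a p \<longleftrightarrow> p = pair i a" if "i \<in> omega" "a \<in> el A" "p \<in> el e" for i a p
    using that is_pair_iff by simp
  then show ?thesis unfolding assignments_def by auto
qed

lemma As_U[simp]: "e \<in> As A \<Longrightarrow> e \<in> U" by (simp add: As_iff)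

lemma As_app: "e \<in> As A \<Longrightarrow> i \<in> U \<Longrightarrow> a \<in> U \<Longrightarrow> app e i a \<Longrightarrow> i \<in> omega \<and> a \<in> el A"
proof -
  assume *: "e \<in> As A" "i \<in> U" "a \<in> U" "app e i a"
  then have "pair i a \<in> el e" using app_iff[OF As_U[OF *(1)] *(2,3)] by simp
  with *(1) have "\<exists>j\<in>omega. \<exists>b\<in>el A. pair i a = pair j b" unfolding As_iff by blast
  then obtain j b where j: "j \<in> omega" "b \<in> el A" "pair i a = pair j b" by blast
  then show ?thesis using pair_inject[OF *(2,3), of j b] by simp
qed

lemma As_fun: "e \<in> As A \<Longrightarrow> i \<in> U \<Longrightarrow> a \<in> U \<Longrightarrow> b \<in> U \<Longrightarrow> app e i a \<Longrightarrow> app e i b \<Longrightarrow> a = b"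
  unfolding As_iff by blast

lemma isset_As[simp, intro]: "A \<in> U \<Longrightarrow> isset (As A)"
proof -
  assume A: "A \<in> U"
  have e: "el (setof (pair i ` el A)) = pair i ` el A" if "i \<in> omega" for i
    by (rule el_setof[OF isset_image[OF isset_el[OF A]]]) (rule dfb dft_const_U[OF omega_U[OF that]])+
  have s: "isset (\<Union>i\<in>omega. el (setof (pair i ` el A)))"
    by (rule isset_UN[OF isset_omega]) (rule dfb dft_const_U[OF A])+
  have "As A \<subseteq> {y \<in> U. el y \<subseteq> (\<Union>i\<in>omega. el (setof (pair i ` el A)))}"
  proof
    fix y assume y: "y \<in> As A"
    have "p \<in> (\<Union>i\<in>omega. el (setof (pair i ` el A)))" if p: "p \<in> el y" for p
    proof -
      have "\<exists>i\<in>omega. \<exists>a\<in>el A. p = pair i a" using y p unfolding As_iff by blast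
      then obtain i a where "i \<in> omega" "a \<in> el A" "p = pair i a" by blast
      then show ?thesis using e[of i] by auto
    qed
    then show "y \<in> {y \<in> U. el y \<subseteq> (\<Union>i\<in>omega. el (setof (pair i ` el A)))}"
      using As_U[OF y] by blast
  qed
  from isset_subset[OF isset_Pow[OF s] this] show ?thesis
    using dfc_assignments[OF dft_const_U[OF A]] by blast
qed

definition upd :: "'a \<Rightarrow> 'a \<Rightarrow> 'a \<Rightarrow> 'a" where
  "upd e i a = setof (insert (pair i a) {p \<in> el e. \<not> (\<exists>b\<in>U. p = pair i b)})"

lemma upd_U[simp, intro]: "upd e i a \<in> U" by (simp add: upd_def)

lemma dft_upd[dfb]: "Dft C a \<Longrightarrow> Dft C b \<Longrightarrow> Dft C c \<Longrightarrow> Dft C (\<lambda>e. upd (a e) (b e) (c e))"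
  by (rule dft_lift3[of C upd]) (unfold upd_def, (rule dfb)+)

lemma el_upd: "e \<in> U \<Longrightarrow> i \<in> U \<Longrightarrow> el (upd e i a) = insert (pair i a) {p \<in> el e. \<not> (\<exists>b\<in>U. p = pair i b)}"
  unfolding upd_def
  by (rule el_setof[OF isset_insert[OF pair_U isset_sep[OF isset_el]]])
     (assumption, (rule dfb dft_const_U | assumption)+)

lemma update_iff:
  assumes "e \<in> U" "i \<in> U" "a \<in> U" "e' \<in> U" shows "update e i a e' \<longleftrightarrow> e' = upd e i a"
proof -
  have 1: "{p \<in> U. is_pair i a p} = {pair i a}" using assms is_pair_iff by auto
  have 2: "is_pair i b p \<longleftrightarrow> p = pair i b" if "b \<in> U" "p \<in> el e" for b p
    using assms that is_pair_iff by simp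
  have 3: "{p \<in> el e. \<not> (\<exists>b\<in>U. is_pair i b p)} = {p \<in> el e. \<not> (\<exists>b\<in>U. p = pair i b)}"
    using 2 by auto
  have "update e i a e' \<longleftrightarrow> el e' = el (upd e i a)"
    unfolding update_def 1 3 el_upd[OF assms(1,2)] by simp
  then show ?thesis using el_inj[OF assms(4) upd_U] by simp
qed

lemma app_upd:
  assumes "e \<in> U" "i \<in> U" "a \<in> U" "j \<in> U" "b \<in> U"
  shows "app (upd e i a) j b \<longleftrightarrow> (if j = i then b = a else app e j b)"
  using assms by (auto simp: app_iff el_upd)

lemma upd_As:
  assumes e: "e \<in> As A" and i: "i \<in> omega" and a: "a \<in> el A" shows "upd e i a \<in> As A"
  unfolding As_iff
proof (intro conjI ballI impI upd_U)
  have eU: "e \<in> U" using e by simp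
  have iU: "i \<in> U" "a \<in> U" using i a by auto
  fix p assume "p \<in> el (upd e i a)"
  then show "\<exists>i\<in>omega. \<exists>a\<in>el A. p = pair i a" using e i a unfolding el_upd[OF eU iU(1)] As_iff by blast
next
  have eU: "e \<in> U" using e by simp
  have iU: "i \<in> U" "a \<in> U" using i a by auto
  fix j b c assume j: "j \<in> U" "b \<in> U" "c \<in> U" "app (upd e i a) j b \<and> app (upd e i a) j c"
  then show "b = c" using As_fun[OF e j(1-3)]
    by (simp add: app_upd[OF eU iU j(1)] split: if_splits)
qed

section \<open>Satisfaction\<close>

definition pfst :: "'a \<Rightarrow> 'a" where "pfst p = uniq (\<lambda>a. \<exists>b\<in>U. p = pair a b)"
definition psnd :: "'a \<Rightarrow> 'a" where "psnd p = uniq (\<lambda>b. \<exists>a\<in>U. p = pair a b)"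

lemma pfst_pair[simp]: "a \<in> U \<Longrightarrow> b \<in> U \<Longrightarrow> pfst (pair a b) = a"
  unfolding pfst_def by (rule uniq_eq) auto
lemma psnd_pair[simp]: "a \<in> U \<Longrightarrow> b \<in> U \<Longrightarrow> psnd (pair a b) = b"
  unfolding psnd_def by (rule uniq_eq) auto
lemma dft_pfst[dfb]: "Dft C a \<Longrightarrow> Dft C (\<lambda>e. pfst (a e))"
  by (rule dft_lift1[of C pfst]) (unfold pfst_def, (rule dfb)+)
lemma dft_psnd[dfb]: "Dft C a \<Longrightarrow> Dft C (\<lambda>e. psnd (a e))"
  by (rule dft_lift1[of C psnd]) (unfold psnd_def, (rule dfb)+)

lemma dfb_satrel[dfb]:
  "Dft C a \<Longrightarrow> Dft C p \<Longrightarrow> Dft C t \<Longrightarrow> Dfb C (\<lambda>e. satisfaction_relation (el (a e)) (el (p e)) (t e))"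
  by (rule dfb_lift3[of C "\<lambda>a p t. satisfaction_relation (el a) (el p) t"])
     (unfold satisfaction_relation_def, (rule dfb)+)

definition Sat :: "'a \<Rightarrow> 'a \<Rightarrow> 'a \<Rightarrow> 'a \<Rightarrow> bool" where
  "Sat A P c e \<longleftrightarrow> satisfies (el A) (el P) c e"

lemma dfb_Sat[dfb]:
  "Dft C a \<Longrightarrow> Dft C p \<Longrightarrow> Dft C c \<Longrightarrow> Dft C d \<Longrightarrow> Dfb C (\<lambda>e. Sat (a e) (p e) (c e) (d e))"
  by (rule dfb_lift4[of C Sat]) (unfold Sat_def satisfies_def, (rule dfb)+)

text \<open>The clauses of the definition of truth, with \<open>T\<close> in the recursive calls.\<close>

definition clause :: "'a \<Rightarrow> 'a \<Rightarrow> 'a \<Rightarrow> 'a \<Rightarrow> 'a \<Rightarrow> bool" where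
  "clause A P T c e \<longleftrightarrow>
     (\<exists>i\<in>omega. \<exists>j\<in>omega. c = memc i j \<and> (\<exists>a\<in>U. \<exists>b\<in>U. app e i a \<and> app e j b \<and> mem a b)) \<or>
     (\<exists>i\<in>omega. \<exists>j\<in>omega. c = eqc i j \<and> (\<exists>a\<in>U. app e i a \<and> app e j a)) \<or>
     (\<exists>i\<in>omega. c = predc i \<and> (\<exists>a\<in>U. app e i a \<and> a \<in> el P)) \<or>
     (\<exists>f\<in>Formula. c = negc f \<and> \<not> app T f e) \<or>
     (\<exists>f\<in>Formula. \<exists>g\<in>Formula. c = conjc f g \<and> app T f e \<and> app T g e) \<or>
     (\<exists>i\<in>omega. \<exists>f\<in>Formula. c = exc i f \<and> (\<exists>a\<in>el A. app T f (upd e i a)))"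

lemma clause_simps:
  "i \<in> omega \<Longrightarrow> j \<in> omega \<Longrightarrow> clause A P T (memc i j) e \<longleftrightarrow> (\<exists>a\<in>U. \<exists>b\<in>U. app e i a \<and> app e j b \<and> mem a b)"
  "i \<in> omega \<Longrightarrow> j \<in> omega \<Longrightarrow> clause A P T (eqc i j) e \<longleftrightarrow> (\<exists>a\<in>U. app e i a \<and> app e j a)"
  "i \<in> omega \<Longrightarrow> clause A P T (predc i) e \<longleftrightarrow> (\<exists>a\<in>U. app e i a \<and> a \<in> el P)"
  "f \<in> Formula \<Longrightarrow> clause A P T (negc f) e \<longleftrightarrow> \<not> app T f e"
  "f \<in> Formula \<Longrightarrow> g \<in> Formula \<Longrightarrow> clause A P T (conjc f g) e \<longleftrightarrow> app T f e \<and> app T g e"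
  "i \<in> omega \<Longrightarrow> f \<in> Formula \<Longrightarrow> clause A P T (exc i f) e \<longleftrightarrow> (\<exists>a\<in>el A. app T f (upd e i a))"
  unfolding clause_def by (simp_all cong: bex_cong conj_cong)

text \<open>One application of the clauses to an approximation \<open>T\<close> of the truth predicate, for the structure and
  the unary predicate coded by the pair \<open>p\<close>.\<close>

definition truth_step :: "'a \<Rightarrow> 'a \<Rightarrow> 'a" where
  "truth_step p T = setof (\<Union>c\<in>Formula. pair c ` {e \<in> As (pfst p). clause (pfst p) (psnd p) T c e})"

lemma Ds_truth_step: "Ds C truth_step"
  unfolding Ds_def truth_step_def clause_def by (intro allI) (rule dfb)+

lemma el_truth_step:
  assumes A: "A \<in> U" "P \<in> U" "T \<in> U"
  shows "el (truth_step (pair A P) T) = (\<Union>c\<in>Formula. pair c ` {e \<in> As A. clause A P T c e})"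
proof -
  have 1: "isset (pair c ` {e \<in> As A. clause A P T c e})" if "c \<in> Formula" for c
    by (rule isset_image[OF isset_sep[OF isset_As[OF A(1)]]])
       (unfold clause_def, (rule dfb dft_const_U[OF A(1)] dft_const_U[OF A(2)] dft_const_U[OF A(3)]
          dft_const_U[OF Formula_U[OF that]])+)
  have "isset (\<Union>c\<in>Formula. el (setof (pair c ` {e \<in> As A. clause A P T c e})))"
    by (rule isset_UN[OF isset_Formula])
       (unfold clause_def, (rule dfb dft_const_U[OF A(1)] dft_const_U[OF A(2)] dft_const_U[OF A(3)])+)
  then have "isset (\<Union>c\<in>Formula. pair c ` {e \<in> As A. clause A P T c e})"
    using 1 by (simp add: el_setof)
  then show ?thesis unfolding truth_step_def using A by (simp add: el_setof)
qed

lemma app_truth_step: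
  assumes A: "A \<in> U" "P \<in> U" "T \<in> U" and c: "c \<in> Formula" "e \<in> As A"
  shows "app (truth_step (pair A P) T) c e \<longleftrightarrow> clause A P T c e"
proof -
  have "truth_step (pair A P) T \<in> U" by (simp add: truth_step_def)
  then have "app (truth_step (pair A P) T) c e \<longleftrightarrow> pair c e \<in> el (truth_step (pair A P) T)"
    using c by (simp add: app_iff)
  also have "\<dots> \<longleftrightarrow> clause A P T c e"
    unfolding el_truth_step[OF A] using c by auto
  finally show ?thesis .
qed

definition truth_stage :: "'a \<Rightarrow> 'a \<Rightarrow> 'a \<Rightarrow> 'a" where "truth_stage A P n = lev truth_step (pair A P) n"

lemma truth_stage_U[simp, intro]: "truth_stage A P n \<in> U" unfolding truth_stage_def by (rule lev_U[OF Ds_truth_step pair_U])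

lemma dft_truth_stage[dfb]: "Dft C a \<Longrightarrow> Dft C p \<Longrightarrow> Dft C n \<Longrightarrow> Dft C (\<lambda>e. truth_stage (a e) (p e) (n e))"
  unfolding truth_stage_def by (rule dft_lev[OF Ds_truth_step] dfb | assumption)+

lemma app_truth_stage_sc:
  assumes "A \<in> U" "P \<in> U" "k \<in> omega" "c \<in> Formula" "e \<in> As A"
  shows "app (truth_stage A P (sc k)) c e \<longleftrightarrow> clause A P (truth_stage A P k) c e"
proof -
  have "truth_stage A P (sc k) = truth_step (pair A P) (truth_stage A P k)"
    unfolding truth_stage_def by (rule lev_sc[OF Ds_truth_step pair_U omega_Ord[OF assms(3)]])
  then show ?thesis using app_truth_step[OF assms(1,2) truth_stage_U assms(4,5)] by simp
qed

text \<open>The approximations need not increase, because of negation.  But the value of a formula is constant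
  from the stage given by its depth on, so its eventual value is a truth definition.\<close>

definition truth_limit :: "'a \<Rightarrow> 'a \<Rightarrow> 'a \<Rightarrow> 'a \<Rightarrow> bool" where
  "truth_limit A P c e \<longleftrightarrow> (\<exists>n\<in>omega. \<forall>k\<in>omega. el n \<subseteq> el k \<longrightarrow> app (truth_stage A P k) c e)"

definition stable :: "'a \<Rightarrow> 'a \<Rightarrow> 'a \<Rightarrow> bool" where
  "stable A P c \<longleftrightarrow> (\<exists>n\<in>omega. \<forall>k\<in>omega. el n \<subseteq> el k \<longrightarrow>
     (\<forall>e\<in>As A. app (truth_stage A P k) c e \<longleftrightarrow> truth_limit A P c e))"

lemma omega_max:
  assumes "m \<in> omega" "n \<in> omega" obtains k where "k \<in> omega" "el m \<subseteq> el k" "el n \<subseteq> el k"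
proof -
  have "el m \<subseteq> el n \<or> el n \<subseteq> el m"
    using Ord_not_mem[of m n] Ord_not_mem[of n m] omega_Ord[OF assms(1)] omega_Ord[OF assms(2)]
      Ord_linear[of m n] no_cycle2[of m n] by blast
  then show ?thesis using that[of m] that[of n] assms by blast
qed

text \<open>If the clauses compute from all late stages the same values \<open>Q\<close> for \<open>c\<close>, then \<open>c\<close> is stable with
  eventual values \<open>Q\<close>.\<close>

lemma stable_intro:
  assumes n: "n \<in> omega"
    and Q: "\<And>k e. k \<in> omega \<Longrightarrow> el n \<subseteq> el k \<Longrightarrow> e \<in> As A \<Longrightarrow> app (truth_stage A P (sc k)) c e \<longleftrightarrow> Q e"
  shows "stable A P c \<and> (\<forall>e\<in>As A. truth_limit A P c e \<longleftrightarrow> Q e)"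
proof -
  have 1: "app (truth_stage A P k) c e \<longleftrightarrow> Q e" if k: "k \<in> omega" "el (sc n) \<subseteq> el k" "e \<in> As A" for k e
  proof -
    have nk: "n \<in> el k" using k(2) n by auto
    then have "k \<noteq> emp" by auto
    then obtain m where m: "m \<in> omega" "k = sc m" using omega_cases[OF k(1)] by blast
    have "n = m \<or> n \<in> el m" using nk m by simp
    then have "el n \<subseteq> el m" using Ord_le_iff[OF omega_Ord[OF n] omega_Ord[OF m(1)]] by blast
    from Q[OF m(1) this k(3)] show ?thesis using m(2) by simp
  qed
  have sn: "sc n \<in> omega" using n by simp
  have 2: "truth_limit A P c e \<longleftrightarrow> Q e" if e: "e \<in> As A" for e
  proof
    assume "Q e"
    then show "truth_limit A P c e" unfolding truth_limit_def using 1[OF _ _ e] sn by blast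
  next
    assume "truth_limit A P c e"
    then obtain m where m: "m \<in> omega" "\<forall>k\<in>omega. el m \<subseteq> el k \<longrightarrow> app (truth_stage A P k) c e"
      unfolding truth_limit_def by blast
    obtain k where k: "k \<in> omega" "el m \<subseteq> el k" "el (sc n) \<subseteq> el k" by (rule omega_max[OF m(1) sn])
    then show "Q e" using 1[OF k(1,3) e] m(2) by blast
  qed
  show ?thesis unfolding stable_def using 1 2 sn by blast
qed

lemma stable_cases:
  assumes A: "A \<in> U" "P \<in> U"
  shows
    "i \<in> omega \<Longrightarrow> j \<in> omega \<Longrightarrow> stable A P (memc i j) \<and> (\<forall>e\<in>As A. truth_limit A P (memc i j) e \<longleftrightarrow> (\<exists>a\<in>U. \<exists>b\<in>U. app e i a \<and> app e j b \<and> mem a b))"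
    "i \<in> omega \<Longrightarrow> j \<in> omega \<Longrightarrow> stable A P (eqc i j) \<and> (\<forall>e\<in>As A. truth_limit A P (eqc i j) e \<longleftrightarrow> (\<exists>a\<in>U. app e i a \<and> app e j a))"
    "i \<in> omega \<Longrightarrow> stable A P (predc i) \<and> (\<forall>e\<in>As A. truth_limit A P (predc i) e \<longleftrightarrow> (\<exists>a\<in>U. app e i a \<and> a \<in> el P))"
    "f \<in> Formula \<Longrightarrow> stable A P f \<Longrightarrow> stable A P (negc f) \<and> (\<forall>e\<in>As A. truth_limit A P (negc f) e \<longleftrightarrow> \<not> truth_limit A P f e)"
    "f \<in> Formula \<Longrightarrow> g \<in> Formula \<Longrightarrow> stable A P f \<Longrightarrow> stable A P g \<Longrightarrow>
       stable A P (conjc f g) \<and> (\<forall>e\<in>As A. truth_limit A P (conjc f g) e \<longleftrightarrow> truth_limit A P f e \<and> truth_limit A P g e)"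
    "i \<in> omega \<Longrightarrow> f \<in> Formula \<Longrightarrow> stable A P f \<Longrightarrow>
       stable A P (exc i f) \<and> (\<forall>e\<in>As A. truth_limit A P (exc i f) e \<longleftrightarrow> (\<exists>a\<in>el A. truth_limit A P f (upd e i a)))"
proof -
  assume i: "i \<in> omega" and j: "j \<in> omega"
  show "stable A P (memc i j) \<and> (\<forall>e\<in>As A. truth_limit A P (memc i j) e \<longleftrightarrow> (\<exists>a\<in>U. \<exists>b\<in>U. app e i a \<and> app e j b \<and> mem a b))"
    by (rule stable_intro[OF emp_omega]) (simp only: app_truth_stage_sc[OF A _ Formula_intros(1)[OF i j]] clause_simps i j)
  show "stable A P (eqc i j) \<and> (\<forall>e\<in>As A. truth_limit A P (eqc i j) e \<longleftrightarrow> (\<exists>a\<in>U. app e i a \<and> app e j a))"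
    by (rule stable_intro[OF emp_omega]) (simp only: app_truth_stage_sc[OF A _ Formula_intros(2)[OF i j]] clause_simps i j)
next
  assume i: "i \<in> omega"
  show "stable A P (predc i) \<and> (\<forall>e\<in>As A. truth_limit A P (predc i) e \<longleftrightarrow> (\<exists>a\<in>U. app e i a \<and> a \<in> el P))"
    by (rule stable_intro[OF emp_omega]) (simp only: app_truth_stage_sc[OF A _ Formula_intros(3)[OF i]] clause_simps i)
next
  assume f: "f \<in> Formula" and sf: "stable A P f"
  from sf obtain n where n: "n \<in> omega"
    "\<And>k e. k \<in> omega \<Longrightarrow> el n \<subseteq> el k \<Longrightarrow> e \<in> As A \<Longrightarrow> app (truth_stage A P k) f e \<longleftrightarrow> truth_limit A P f e"
    unfolding stable_def by blast
  show "stable A P (negc f) \<and> (\<forall>e\<in>As A. truth_limit A P (negc f) e \<longleftrightarrow> \<not> truth_limit A P f e)"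
    by (rule stable_intro[OF n(1)])
       (simp only: app_truth_stage_sc[OF A _ Formula_intros(4)[OF f]] clause_simps f n(2))
next
  assume f: "f \<in> Formula" and g: "g \<in> Formula" and sf: "stable A P f" and sg: "stable A P g"
  from sf obtain m where m: "m \<in> omega"
    "\<And>k e. k \<in> omega \<Longrightarrow> el m \<subseteq> el k \<Longrightarrow> e \<in> As A \<Longrightarrow> app (truth_stage A P k) f e \<longleftrightarrow> truth_limit A P f e"
    unfolding stable_def by blast
  from sg obtain m' where m': "m' \<in> omega"
    "\<And>k e. k \<in> omega \<Longrightarrow> el m' \<subseteq> el k \<Longrightarrow> e \<in> As A \<Longrightarrow> app (truth_stage A P k) g e \<longleftrightarrow> truth_limit A P g e"
    unfolding stable_def by blast
  obtain n where n: "n \<in> omega" "el m \<subseteq> el n" "el m' \<subseteq> el n" by (rule omega_max[OF m(1) m'(1)])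
  show "stable A P (conjc f g) \<and> (\<forall>e\<in>As A. truth_limit A P (conjc f g) e \<longleftrightarrow> truth_limit A P f e \<and> truth_limit A P g e)"
  proof (rule stable_intro[OF n(1)])
    fix k e assume k: "k \<in> omega" "el n \<subseteq> el k" "e \<in> As A"
    have k': "el m \<subseteq> el k" "el m' \<subseteq> el k" using n k by auto
    show "app (truth_stage A P (sc k)) (conjc f g) e \<longleftrightarrow> truth_limit A P f e \<and> truth_limit A P g e"
      by (simp only: app_truth_stage_sc[OF A k(1) Formula_intros(5)[OF f g] k(3)] clause_simps f g
          m(2)[OF k(1) k'(1) k(3)] m'(2)[OF k(1) k'(2) k(3)])
  qed
next
  assume i: "i \<in> omega" and f: "f \<in> Formula" and sf: "stable A P f"
  from sf obtain n where n: "n \<in> omega"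
    "\<And>k e. k \<in> omega \<Longrightarrow> el n \<subseteq> el k \<Longrightarrow> e \<in> As A \<Longrightarrow> app (truth_stage A P k) f e \<longleftrightarrow> truth_limit A P f e"
    unfolding stable_def by blast
  show "stable A P (exc i f) \<and> (\<forall>e\<in>As A. truth_limit A P (exc i f) e \<longleftrightarrow> (\<exists>a\<in>el A. truth_limit A P f (upd e i a)))"
  proof (rule stable_intro[OF n(1)])
    fix k e assume k: "k \<in> omega" "el n \<subseteq> el k" "e \<in> As A"
    have "app (truth_stage A P k) f (upd e i a) \<longleftrightarrow> truth_limit A P f (upd e i a)" if "a \<in> el A" for a
      by (rule n(2)[OF k(1,2) upd_As[OF k(3) i that]])
    then show "app (truth_stage A P (sc k)) (exc i f) e \<longleftrightarrow> (\<exists>a\<in>el A. truth_limit A P f (upd e i a))"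
      by (simp only: app_truth_stage_sc[OF A k(1) Formula_intros(6)[OF i f] k(3)] clause_simps i f cong: bex_cong)
  qed
qed

lemma dfb_truth_limit[dfb]: "Dft C a \<Longrightarrow> Dft C p \<Longrightarrow> Dft C c \<Longrightarrow> Dft C d \<Longrightarrow> Dfb C (\<lambda>e. truth_limit (a e) (p e) (c e) (d e))"
  by (rule dfb_lift4[of C truth_limit]) (unfold truth_limit_def, (rule dfb)+)

lemma stable_all:
  assumes A: "A \<in> U" "P \<in> U" and c: "c \<in> Formula" shows "stable A P c"
proof (rule Formula_induct[of "stable A P", OF _ c])
  show "Dfb U (\<lambda>e. stable A P (e 0))"
    unfolding stable_def by (rule dfb dft_const_U[OF A(1)] dft_const_U[OF A(2)])+
qed ((rule stable_cases[OF A, THEN conjunct1]; assumption)+)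

lemma Formula_cases:
  assumes "c \<in> Formula"
  shows "(\<exists>i\<in>omega. \<exists>j\<in>omega. c = memc i j) \<or> (\<exists>i\<in>omega. \<exists>j\<in>omega. c = eqc i j) \<or>
    (\<exists>i\<in>omega. c = predc i) \<or> (\<exists>f\<in>Formula. c = negc f) \<or>
    (\<exists>f\<in>Formula. \<exists>g\<in>Formula. c = conjc f g) \<or> (\<exists>i\<in>omega. \<exists>f\<in>Formula. c = exc i f)"
    (is "?P c")
proof (rule Formula_induct[of ?P, OF _ assms])
  show "Dfb U (\<lambda>e. ?P (e 0))" by (rule dfb)+
qed blast+

lemma Formula_casesE:
  assumes "c \<in> Formula"
  obtains (1) i j where "i \<in> omega" "j \<in> omega" "c = memc i j" | (2) i j where "i \<in> omega" "j \<in> omega" "c = eqc i j"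
    | (3) i where "i \<in> omega" "c = predc i" | (4) f where "f \<in> Formula" "c = negc f"
    | (5) f g where "f \<in> Formula" "g \<in> Formula" "c = conjc f g" | (6) i f where "i \<in> omega" "f \<in> Formula" "c = exc i f"
  using Formula_cases[OF assms]
proof (elim disjE bexE)
  show thesis if "i \<in> omega" "j \<in> omega" "c = memc i j" for i j by (rule 1[OF that])
  show thesis if "i \<in> omega" "j \<in> omega" "c = eqc i j" for i j by (rule 2[OF that])
  show thesis if "i \<in> omega" "c = predc i" for i by (rule 3[OF that])
  show thesis if "f \<in> Formula" "c = negc f" for f by (rule 4[OF that])
  show thesis if "f \<in> Formula" "g \<in> Formula" "c = conjc f g" for f g by (rule 5[OF that])
  show thesis if "i \<in> omega" "f \<in> Formula" "c = exc i f" for i f by (rule 6[OF that])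
qed

text \<open>By unique readability, the six conditions on a satisfaction relation amount to the one clause that
  applies to the formula at hand.\<close>

lemma satrel_iff:
  assumes A: "A \<in> U" "P \<in> U" and T: "T \<in> U"
  shows "satisfaction_relation (el A) (el P) T \<longleftrightarrow> (\<forall>c\<in>Formula. \<forall>e\<in>As A. app T c e \<longleftrightarrow> clause A P T c e)"
proof -
  have "(\<forall>i\<in>omega. \<forall>j\<in>omega. mem_code i j c \<longrightarrow> (app T c e \<longleftrightarrow> (\<exists>a\<in>U. \<exists>b\<in>U. app e i a \<and> app e j b \<and> mem a b))) \<and>
     (\<forall>i\<in>omega. \<forall>j\<in>omega. eq_code i j c \<longrightarrow> (app T c e \<longleftrightarrow> (\<exists>a\<in>U. app e i a \<and> app e j a))) \<and>
     (\<forall>i\<in>omega. pred_code i c \<longrightarrow> (app T c e \<longleftrightarrow> (\<exists>a\<in>U. app e i a \<and> a \<in> el P))) \<and>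
     (\<forall>f\<in>Formula. neg_code f c \<longrightarrow> (app T c e \<longleftrightarrow> \<not> app T f e)) \<and>
     (\<forall>f\<in>Formula. \<forall>g\<in>Formula. conj_code f g c \<longrightarrow> (app T c e \<longleftrightarrow> app T f e \<and> app T g e)) \<and>
     (\<forall>i\<in>omega. \<forall>f\<in>Formula. ex_code i f c \<longrightarrow>
        (app T c e \<longleftrightarrow> (\<exists>a\<in>el A. \<exists>e'\<in>U. update e i a e' \<and> app T f e'))) \<longleftrightarrow>
     (app T c e \<longleftrightarrow> clause A P T c e)" (is "?L \<longleftrightarrow> ?R") if c: "c \<in> Formula" and e: "e \<in> As A" for c e
  proof -
    have cU: "c \<in> U" and eU: "e \<in> U" using c e by simp_all
    have U: "(\<exists>e'\<in>U. update e i a e' \<and> app T f e') \<longleftrightarrow> app T f (upd e i a)" if "i \<in> omega" "a \<in> el A" for i a f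
      using update_iff[OF eU omega_U[OF that(1)] el_U[OF that(2)]] upd_U by blast
    have 1: "(\<forall>i\<in>omega. \<forall>j\<in>omega. mem_code i j c \<longrightarrow> R i j) \<longleftrightarrow> (\<forall>i\<in>omega. \<forall>j\<in>omega. c = memc i j \<longrightarrow> R i j)" for R
      by (intro ball_cong refl) (simp add: code_iffs cU)
    have 2: "(\<forall>i\<in>omega. \<forall>j\<in>omega. eq_code i j c \<longrightarrow> R i j) \<longleftrightarrow> (\<forall>i\<in>omega. \<forall>j\<in>omega. c = eqc i j \<longrightarrow> R i j)" for R
      by (intro ball_cong refl) (simp add: code_iffs cU)
    have 3: "(\<forall>i\<in>omega. pred_code i c \<longrightarrow> R i) \<longleftrightarrow> (\<forall>i\<in>omega. c = predc i \<longrightarrow> R i)" for R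
      by (intro ball_cong refl) (simp add: code_iffs cU)
    have 4: "(\<forall>f\<in>Formula. neg_code f c \<longrightarrow> R f) \<longleftrightarrow> (\<forall>f\<in>Formula. c = negc f \<longrightarrow> R f)" for R
      by (intro ball_cong refl) (simp add: code_iffs cU)
    have 5: "(\<forall>f\<in>Formula. \<forall>g\<in>Formula. conj_code f g c \<longrightarrow> R f g) \<longleftrightarrow> (\<forall>f\<in>Formula. \<forall>g\<in>Formula. c = conjc f g \<longrightarrow> R f g)" for R
      by (intro ball_cong refl) (simp add: code_iffs cU)
    have 6: "(\<forall>i\<in>omega. \<forall>f\<in>Formula. ex_code i f c \<longrightarrow> (app T c e \<longleftrightarrow> (\<exists>a\<in>el A. \<exists>e'\<in>U. update e i a e' \<and> app T f e'))) \<longleftrightarrow>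
       (\<forall>i\<in>omega. \<forall>f\<in>Formula. c = exc i f \<longrightarrow> (app T c e \<longleftrightarrow> (\<exists>a\<in>el A. app T f (upd e i a))))"
      by (intro ball_cong refl) (simp add: code_iffs cU U cong: bex_cong)
    show ?thesis unfolding 1 2 3 4 5 6
    proof (rule iffI, goal_cases)
      case L: 1
      from c show ?case
      proof (cases rule: Formula_casesE)
        case 1 then show ?thesis using bspec[OF bspec[OF conjunct1[OF L] 1(1)] 1(2)] by (simp add: clause_simps)
      next
        case 2 then show ?thesis using bspec[OF bspec[OF conjunct1[OF conjunct2[OF L]] 2(1)] 2(2)] by (simp add: clause_simps)
      next
        case 3 then show ?thesis using bspec[OF conjunct1[OF conjunct2[OF conjunct2[OF L]]] 3(1)] by (simp add: clause_simps)
      next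
        case 4 then show ?thesis using bspec[OF conjunct1[OF conjunct2[OF conjunct2[OF conjunct2[OF L]]]] 4(1)] by (simp add: clause_simps)
      next
        case 5 then show ?thesis
          using bspec[OF bspec[OF conjunct1[OF conjunct2[OF conjunct2[OF conjunct2[OF conjunct2[OF L]]]]] 5(1)] 5(2)] by (simp add: clause_simps)
      next
        case 6 then show ?thesis
          using bspec[OF bspec[OF conjunct2[OF conjunct2[OF conjunct2[OF conjunct2[OF conjunct2[OF L]]]]] 6(1)] 6(2)] by (simp add: clause_simps)
      qed
    next
      case R: 2
      show ?case by (intro conjI ballI impI; subst R; simp add: clause_simps)
    qed
  qed
  then show ?thesis unfolding satisfaction_relation_def by (simp cong: ball_cong)
qed

lemma satrel_exists:
  assumes A: "A \<in> U" "P \<in> U" shows "\<exists>T\<in>U. satisfaction_relation (el A) (el P) T"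
proof -
  have 1: "isset (pair c ` {e \<in> As A. truth_limit A P c e})" if "c \<in> Formula" for c
    by (rule isset_image[OF isset_sep[OF isset_As[OF A(1)]]])
       (rule dfb dft_const_U[OF A(1)] dft_const_U[OF A(2)] dft_const_U[OF Formula_U[OF that]])+
  have "isset (\<Union>c\<in>Formula. el (setof (pair c ` {e \<in> As A. truth_limit A P c e})))"
    by (rule isset_UN[OF isset_Formula]) (rule dfb dft_const_U[OF A(1)] dft_const_U[OF A(2)])+
  then have 2: "isset (\<Union>c\<in>Formula. pair c ` {e \<in> As A. truth_limit A P c e})"
    using 1 by (simp add: el_setof)
  define T where "T = setof (\<Union>c\<in>Formula. pair c ` {e \<in> As A. truth_limit A P c e})"
  have T: "T \<in> U" by (simp add: T_def)
  have app: "app T c e \<longleftrightarrow> truth_limit A P c e" if "c \<in> Formula" "e \<in> As A" for c e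
    unfolding app_iff[OF T Formula_U[OF that(1)] As_U[OF that(2)]] unfolding T_def el_setof[OF 2]
    using that by auto
  have "app T c e \<longleftrightarrow> clause A P T c e" if c: "c \<in> Formula" and e: "e \<in> As A" for c e
  proof -
    have st: "stable A P f" if "f \<in> Formula" for f using stable_all[OF A that] .
    have ex: "(\<exists>a\<in>el A. truth_limit A P f (upd e i a)) \<longleftrightarrow> (\<exists>a\<in>el A. app T f (upd e i a))"
      if "i \<in> omega" "f \<in> Formula" for i f
      using app[OF that(2) upd_As[OF e that(1)]] by (simp cong: bex_cong)
    from c show ?thesis
    proof (cases rule: Formula_casesE)
      case 1 then show ?thesis using stable_cases(1)[OF A 1(1,2)] e app[OF c e] by (simp add: clause_simps)
    next
      case 2 then show ?thesis using stable_cases(2)[OF A 2(1,2)] e app[OF c e] by (simp add: clause_simps)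
    next
      case 3 then show ?thesis using stable_cases(3)[OF A 3(1)] e app[OF c e] by (simp add: clause_simps)
    next
      case 4 then show ?thesis using stable_cases(4)[OF A 4(1) st] e app[OF c e] app[OF 4(1) e] by (simp add: clause_simps)
    next
      case 5 then show ?thesis using stable_cases(5)[OF A 5(1,2) st st] e app[OF c e] app[OF 5(1) e] app[OF 5(2) e]
        by (simp add: clause_simps)
    next
      case 6 then show ?thesis using stable_cases(6)[OF A 6(1,2) st] e app[OF c e] ex[OF 6(1,2)]
        by (simp add: clause_simps)
    qed
  qed
  then show ?thesis using satrel_iff[OF A T] T by blast
qed

lemma satrel_unique:
  assumes A: "A \<in> U" "P \<in> U" and T: "T \<in> U" "satisfaction_relation (el A) (el P) T"
    and T': "T' \<in> U" "satisfaction_relation (el A) (el P) T'" and c: "c \<in> Formula"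
  shows "\<forall>e\<in>As A. app T c e \<longleftrightarrow> app T' c e"
proof -
  have t: "\<And>c e. c \<in> Formula \<Longrightarrow> e \<in> As A \<Longrightarrow> app T c e \<longleftrightarrow> clause A P T c e"
    using T satrel_iff[OF A T(1)] by blast
  have t': "\<And>c e. c \<in> Formula \<Longrightarrow> e \<in> As A \<Longrightarrow> app T' c e \<longleftrightarrow> clause A P T' c e"
    using T' satrel_iff[OF A T'(1)] by blast
  show ?thesis
  proof (rule Formula_induct[of "\<lambda>c. \<forall>e\<in>As A. app T c e \<longleftrightarrow> app T' c e", OF _ c])
    show "Dfb U (\<lambda>e. \<forall>x\<in>As A. app T (e 0) x \<longleftrightarrow> app T' (e 0) x)"
      by (rule dfb dft_const_U[OF A(1)] dft_const_U[OF T(1)] dft_const_U[OF T'(1)])+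
  next
    fix i f assume i: "i \<in> omega" and f: "f \<in> Formula" and IH: "\<forall>e\<in>As A. app T f e \<longleftrightarrow> app T' f e"
    have "(\<exists>a\<in>el A. app T f (upd e i a)) \<longleftrightarrow> (\<exists>a\<in>el A. app T' f (upd e i a))" if "e \<in> As A" for e
      by (rule bex_cong[OF refl]) (use IH upd_As[OF that i] in blast)
    then show "\<forall>e\<in>As A. app T (exc i f) e \<longleftrightarrow> app T' (exc i f) e"
      by (simp add: t t' i f clause_simps Formula_intros)
  qed (simp_all add: t t' clause_simps Formula_intros)
qed

lemma Sat_app:
  assumes "A \<in> U" "P \<in> U" "T \<in> U" "satisfaction_relation (el A) (el P) T" "c \<in> Formula" "e \<in> As A"
  shows "Sat A P c e \<longleftrightarrow> app T c e"
  unfolding Sat_def satisfies_def using satrel_unique[OF assms(1-4) _ _ assms(5)] assms by blast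

text \<open>Satisfaction relations exist and agree with one another, so \<open>Sat\<close> obeys the recursive clauses.\<close>

lemma Sat_clause:
  assumes A: "A \<in> U" "P \<in> U" and e: "e \<in> As A"
  shows "i \<in> omega \<Longrightarrow> j \<in> omega \<Longrightarrow> Sat A P (memc i j) e \<longleftrightarrow> (\<exists>a\<in>U. \<exists>b\<in>U. app e i a \<and> app e j b \<and> mem a b)"
    "i \<in> omega \<Longrightarrow> j \<in> omega \<Longrightarrow> Sat A P (eqc i j) e \<longleftrightarrow> (\<exists>a\<in>U. app e i a \<and> app e j a)"
    "i \<in> omega \<Longrightarrow> Sat A P (predc i) e \<longleftrightarrow> (\<exists>a\<in>U. app e i a \<and> a \<in> el P)"
    "f \<in> Formula \<Longrightarrow> Sat A P (negc f) e \<longleftrightarrow> \<not> Sat A P f e"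
    "f \<in> Formula \<Longrightarrow> g \<in> Formula \<Longrightarrow> Sat A P (conjc f g) e \<longleftrightarrow> Sat A P f e \<and> Sat A P g e"
    "i \<in> omega \<Longrightarrow> f \<in> Formula \<Longrightarrow> Sat A P (exc i f) e \<longleftrightarrow> (\<exists>a\<in>el A. Sat A P f (upd e i a))"
proof -
  obtain T where T: "T \<in> U" "satisfaction_relation (el A) (el P) T" using satrel_exists[OF A] by blast
  have S: "Sat A P c d \<longleftrightarrow> app T c d" if "c \<in> Formula" "d \<in> As A" for c d
    by (rule Sat_app[OF A T that])
  have t: "\<And>c d. c \<in> Formula \<Longrightarrow> d \<in> As A \<Longrightarrow> app T c d \<longleftrightarrow> clause A P T c d"
    using T satrel_iff[OF A T(1)] by blast
  show "i \<in> omega \<Longrightarrow> j \<in> omega \<Longrightarrow> Sat A P (memc i j) e \<longleftrightarrow> (\<exists>a\<in>U. \<exists>b\<in>U. app e i a \<and> app e j b \<and> mem a b)"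
    "i \<in> omega \<Longrightarrow> j \<in> omega \<Longrightarrow> Sat A P (eqc i j) e \<longleftrightarrow> (\<exists>a\<in>U. app e i a \<and> app e j a)"
    "i \<in> omega \<Longrightarrow> Sat A P (predc i) e \<longleftrightarrow> (\<exists>a\<in>U. app e i a \<and> a \<in> el P)"
    "f \<in> Formula \<Longrightarrow> Sat A P (negc f) e \<longleftrightarrow> \<not> Sat A P f e"
    "f \<in> Formula \<Longrightarrow> g \<in> Formula \<Longrightarrow> Sat A P (conjc f g) e \<longleftrightarrow> Sat A P f e \<and> Sat A P g e"
    by (simp_all add: S t e Formula_intros clause_simps)
  show "Sat A P (exc i f) e \<longleftrightarrow> (\<exists>a\<in>el A. Sat A P f (upd e i a))" if "i \<in> omega" "f \<in> Formula"
    using that by (simp add: S t e upd_As Formula_intros clause_simps cong: bex_cong)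
qed

section \<open>Finite support\<close>

definition agree :: "'a \<Rightarrow> 'a \<Rightarrow> 'a \<Rightarrow> bool" where
  "agree n e d \<longleftrightarrow> (\<forall>i\<in>el n. \<forall>a\<in>U. app e i a \<longleftrightarrow> app d i a)"

lemma dfb_agree[dfb]: "Dft C a \<Longrightarrow> Dft C b \<Longrightarrow> Dft C c \<Longrightarrow> Dfb C (\<lambda>e. agree (a e) (b e) (c e))"
  by (rule dfb_lift3[of C agree]) (unfold agree_def, (rule dfb)+)

lemma agree_mono: "agree n e d \<Longrightarrow> el m \<subseteq> el n \<Longrightarrow> agree m e d" unfolding agree_def by blast

lemma agree_upd:
  assumes "e \<in> U" "d \<in> U" "i \<in> U" "a \<in> U" "agree n e d" shows "agree n (upd e i a) (upd d i a)"
  unfolding agree_def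
proof (intro ballI)
  fix j b assume "j \<in> el n" "b \<in> U"
  then show "app (upd e i a) j b \<longleftrightarrow> app (upd d i a) j b"
    using assms app_upd[of e i a j b] app_upd[of d i a j b] by (simp add: agree_def)
qed

text \<open>A formula has only finitely many variables, in the sense of the model.\<close>

lemma Sat_support:
  assumes A: "A \<in> U" "P \<in> U" and c: "c \<in> Formula"
  shows "\<exists>n\<in>omega. \<forall>e\<in>As A. \<forall>d\<in>As A. agree n e d \<longrightarrow> (Sat A P c e \<longleftrightarrow> Sat A P c d)"
    (is "?Q c")
proof (rule Formula_induct[of ?Q, OF _ c])
  show "Dfb U (\<lambda>e. ?Q (e 0))" by (rule dfb dft_const_U[OF A(1)] dft_const_U[OF A(2)])+
next
  fix i j assume i: "i \<in> omega" and j: "j \<in> omega"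
  obtain n where n: "n \<in> omega" "el (sc i) \<subseteq> el n" "el (sc j) \<subseteq> el n"
    by (rule omega_max[OF sc_omega[OF i] sc_omega[OF j]])
  have ij: "i \<in> el n" "j \<in> el n" using n i j by auto
  have "Sat A P (memc i j) e \<longleftrightarrow> Sat A P (memc i j) d" "Sat A P (eqc i j) e \<longleftrightarrow> Sat A P (eqc i j) d"
    if "e \<in> As A" "d \<in> As A" "agree n e d" for e d
    using that ij by (simp_all add: Sat_clause[OF A] i j agree_def cong: bex_cong)
  with n(1) show "?Q (memc i j)" "?Q (eqc i j)" by blast+
next
  fix i assume i: "i \<in> omega"
  have "Sat A P (predc i) e \<longleftrightarrow> Sat A P (predc i) d" if "e \<in> As A" "d \<in> As A" "agree (sc i) e d" for e d
    using that i by (simp add: Sat_clause[OF A] i agree_def cong: bex_cong)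
  then show "?Q (predc i)" using sc_omega[OF i] by blast
next
  fix f assume f: "f \<in> Formula" "?Q f"
  then show "?Q (negc f)" by (simp add: Sat_clause[OF A])
next
  fix f g assume f: "f \<in> Formula" "g \<in> Formula" "?Q f" "?Q g"
  then obtain m m' where m: "m \<in> omega" "m' \<in> omega"
    "\<And>e d. e \<in> As A \<Longrightarrow> d \<in> As A \<Longrightarrow> agree m e d \<Longrightarrow> Sat A P f e \<longleftrightarrow> Sat A P f d"
    "\<And>e d. e \<in> As A \<Longrightarrow> d \<in> As A \<Longrightarrow> agree m' e d \<Longrightarrow> Sat A P g e \<longleftrightarrow> Sat A P g d" by blast
  obtain n where n: "n \<in> omega" "el m \<subseteq> el n" "el m' \<subseteq> el n" by (rule omega_max[OF m(1,2)])
  have "Sat A P (conjc f g) e \<longleftrightarrow> Sat A P (conjc f g) d" if "e \<in> As A" "d \<in> As A" "agree n e d" for e d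
    using m(3)[OF that(1,2) agree_mono[OF that(3) n(2)]] m(4)[OF that(1,2) agree_mono[OF that(3) n(3)]] that
    by (simp add: Sat_clause[OF A] f)
  with n(1) show "?Q (conjc f g)" by blast
next
  fix i f assume f: "i \<in> omega" "f \<in> Formula" "?Q f"
  then obtain n where n: "n \<in> omega"
    "\<And>e d. e \<in> As A \<Longrightarrow> d \<in> As A \<Longrightarrow> agree n e d \<Longrightarrow> Sat A P f e \<longleftrightarrow> Sat A P f d" by blast
  have "Sat A P (exc i f) e \<longleftrightarrow> Sat A P (exc i f) d" if ed: "e \<in> As A" "d \<in> As A" "agree n e d" for e d
  proof -
    have "Sat A P f (upd e i a) \<longleftrightarrow> Sat A P f (upd d i a)" if a: "a \<in> el A" for a
      by (rule n(2)[OF upd_As[OF ed(1) f(1) a] upd_As[OF ed(2) f(1) a] agree_upd[OF _ _ _ _ ed(3)]])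
         (use ed f a in auto)
    then show ?thesis by (simp add: Sat_clause[OF A] ed f cong: bex_cong)
  qed
  with n(1) show "?Q (exc i f)" by blast
qed

definition restr :: "'a \<Rightarrow> 'a \<Rightarrow> 'a" where
  "restr e n = setof {p \<in> el e. \<exists>k\<in>el n. \<exists>v\<in>U. p = pair k v}"

lemma dft_restr[dfb]: "Dft C a \<Longrightarrow> Dft C b \<Longrightarrow> Dft C (\<lambda>e. restr (a e) (b e))"
  by (rule dft_lift2[of C restr]) (unfold restr_def, (rule dfb)+)

lemma el_restr: "e \<in> U \<Longrightarrow> n \<in> U \<Longrightarrow> el (restr e n) = {p \<in> el e. \<exists>k\<in>el n. \<exists>v\<in>U. p = pair k v}"
  unfolding restr_def by (rule el_setof[OF isset_sep[OF isset_el]]) (assumption, (rule dfb dft_const_U | assumption)+)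

lemma app_restr: "e \<in> U \<Longrightarrow> n \<in> U \<Longrightarrow> i \<in> U \<Longrightarrow> a \<in> U \<Longrightarrow> app (restr e n) i a \<longleftrightarrow> i \<in> el n \<and> app e i a"
proof -
  assume *: "e \<in> U" "n \<in> U" "i \<in> U" "a \<in> U"
  have r: "restr e n \<in> U" by (simp add: restr_def)
  have "(\<exists>k\<in>el n. \<exists>v\<in>U. pair i a = pair k v) \<longleftrightarrow> i \<in> el n" using * by auto
  then show ?thesis unfolding app_iff[OF r *(3,4)] app_iff[OF *(1,3,4)] el_restr[OF *(1,2)] by blast
qed

lemma restr_As: "e \<in> As A \<Longrightarrow> n \<in> U \<Longrightarrow> restr e n \<in> As A"
proof -
  assume e: "e \<in> As A" and n: "n \<in> U"
  have r: "restr e n \<in> U" by (simp add: restr_def)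
  have "el (restr e n) \<subseteq> el e" using e n by (auto simp: el_restr)
  then have "\<forall>p\<in>el (restr e n). \<exists>i\<in>omega. \<exists>a\<in>el A. p = pair i a" using e unfolding As_iff by blast
  moreover have "\<forall>i\<in>U. \<forall>a\<in>U. \<forall>b\<in>U. app (restr e n) i a \<and> app (restr e n) i b \<longrightarrow> a = b"
    using As_fun[OF e] app_restr[OF As_U[OF e] n] by blast
  ultimately show ?thesis unfolding As_iff using r by blast
qed

lemma agree_restr: "e \<in> U \<Longrightarrow> n \<in> U \<Longrightarrow> agree n e (restr e n)"
  unfolding agree_def by (simp add: app_restr)


section \<open>Reflection and ordinal definability\<close>

text \<open>The code inside the model of a formula of the metalanguage.\<close>

primrec fcode :: "fm \<Rightarrow> 'a" where
  "fcode (Mem i j) = memc (num i) (num j)"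
| "fcode (Equal i j) = eqc (num i) (num j)"
| "fcode (Neg p) = negc (fcode p)"
| "fcode (Conj p p2) = conjc (fcode p) (fcode p2)"
| "fcode (Exists i p) = exc (num i) (fcode p)"

lemma fcode_Formula[simp, intro]: "fcode \<phi> \<in> Formula"
  by (induction \<phi>) (simp_all add: Formula_intros)

text \<open>For such codes, satisfaction inside the model is satisfaction in the metalanguage over the same
  carrier.\<close>

lemma Sat_fcode:
  assumes A: "A \<in> U" "P \<in> U"
  shows "e \<in> As A \<Longrightarrow> vbound \<phi> \<le> N \<Longrightarrow> (\<And>n. n < N \<Longrightarrow> E n \<in> el A \<and> app e (num n) (E n)) \<Longrightarrow>
    Sat A P (fcode \<phi>) e \<longleftrightarrow> set_structure.sat (el A) mem \<phi> E"
proof (induction \<phi> arbitrary: e E)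
  case (Mem i j)
  have ij: "E i \<in> el A" "app e (num i) (E i)" "E j \<in> el A" "app e (num j) (E j)"
    using Mem.prems(2,3) by auto
  have "a = E i" if "a \<in> U" "app e (num i) a" for a
    by (rule As_fun[OF Mem.prems(1) _ that(1) _ that(2) ij(2)]) (use ij in auto)
  moreover have "a = E j" if "a \<in> U" "app e (num j) a" for a
    by (rule As_fun[OF Mem.prems(1) _ that(1) _ that(2) ij(4)]) (use ij in auto)
  ultimately have "(\<exists>a\<in>U. \<exists>b\<in>U. app e (num i) a \<and> app e (num j) b \<and> mem a b) \<longleftrightarrow> mem (E i) (E j)"
    using ij el_U by blast
  then show ?case
    by (simp add: Sat_clause(1)[OF A Mem.prems(1)] set_structure.sat.simps)
next
  case (Equal i j)
  have ij: "E i \<in> el A" "app e (num i) (E i)" "E j \<in> el A" "app e (num j) (E j)"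
    using Equal.prems(2,3) by auto
  have "a = E i" if "a \<in> U" "app e (num i) a" for a
    by (rule As_fun[OF Equal.prems(1) _ that(1) _ that(2) ij(2)]) (use ij in auto)
  moreover have "a = E j" if "a \<in> U" "app e (num j) a" for a
    by (rule As_fun[OF Equal.prems(1) _ that(1) _ that(2) ij(4)]) (use ij in auto)
  ultimately have "(\<exists>a\<in>U. app e (num i) a \<and> app e (num j) a) \<longleftrightarrow> E i = E j"
    using ij el_U by metis
  then show ?case
    by (simp add: Sat_clause(2)[OF A Equal.prems(1)] set_structure.sat.simps)
next
  case (Neg p)
  have "Sat A P (fcode p) e \<longleftrightarrow> set_structure.sat (el A) mem p E"
    by (rule Neg.IH[OF Neg.prems(1) _ Neg.prems(3)]) (use Neg.prems(2) in simp)
  then show ?case by (simp add: Sat_clause(4)[OF A Neg.prems(1)] set_structure.sat.simps)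
next
  case (Conj p p2)
  have "Sat A P (fcode p) e \<longleftrightarrow> set_structure.sat (el A) mem p E"
    by (rule Conj.IH(1)[OF Conj.prems(1) _ Conj.prems(3)]) (use Conj.prems(2) in simp)
  moreover have "Sat A P (fcode p2) e \<longleftrightarrow> set_structure.sat (el A) mem p2 E"
    by (rule Conj.IH(2)[OF Conj.prems(1) _ Conj.prems(3)]) (use Conj.prems(2) in simp)
  ultimately show ?case by (simp add: Sat_clause(5)[OF A Conj.prems(1)] set_structure.sat.simps)
next
  case (Exists i p)
  have "Sat A P (fcode p) (upd e (num i) a) \<longleftrightarrow> set_structure.sat (el A) mem p (E(i := a))"
    if a: "a \<in> el A" for a
  proof (rule Exists.IH)
    show "upd e (num i) a \<in> As A" by (rule upd_As[OF Exists.prems(1) num_omega a])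
    show "vbound p \<le> N" using Exists.prems(2) by simp
    fix n assume n: "n < N"
    have "E n \<in> U" "a \<in> U" "e \<in> U" using Exists.prems(3)[OF n] a As_U[OF Exists.prems(1)] by auto
    then show "(E(i := a)) n \<in> el A \<and> app (upd e (num i) a) (num n) ((E(i := a)) n)"
      using Exists.prems(3)[OF n] a by (simp add: app_upd)
  qed
  then show ?case
    by (simp add: Sat_clause(6)[OF A Exists.prems(1)] set_structure.sat.simps cong: bex_cong)
qed

text \<open>The assignment of \<open>E n\<close> to variable \<open>n\<close> for \<open>n < N\<close>, as an element of the model.\<close>

primrec asg :: "(nat \<Rightarrow> 'a) \<Rightarrow> nat \<Rightarrow> 'a" where
  "asg E 0 = emp"
| "asg E (Suc N) = upd (asg E N) (num N) (E N)"

lemma asg_U[simp, intro]: "asg E N \<in> U" by (cases N) auto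

lemma emp_As: "emp \<in> As A"
  unfolding As_iff app_def by simp

lemma asg_As: "(\<And>n. n < N \<Longrightarrow> E n \<in> el A) \<Longrightarrow> asg E N \<in> As A"
proof (induction N)
  case (Suc N)
  have "asg E N \<in> As A" by (rule Suc.IH) (use Suc.prems in simp)
  then show ?case using upd_As[OF _ num_omega] Suc.prems[of N] by simp
qed (simp add: emp_As)

lemma app_asg: "(\<And>n. n < N \<Longrightarrow> E n \<in> U) \<Longrightarrow> b \<in> U \<Longrightarrow> app (asg E N) (num k) b \<longleftrightarrow> k < N \<and> b = E k"
proof (induction N)
  case 0 then show ?case by (simp add: app_iff)
next
  case (Suc N)
  have "app (asg E N) (num k) b \<longleftrightarrow> k < N \<and> b = E k" by (rule Suc.IH) (use Suc.prems in auto)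
  moreover have "app (asg E (Suc N)) (num k) b \<longleftrightarrow> (if num k = num N then b = E N else app (asg E N) (num k) b)"
    unfolding asg.simps by (rule app_upd) (use Suc.prems in auto)
  ultimately show ?case by auto
qed

lemma V_upd:
  assumes a: "a \<in> U" "limit_ordinal a" and x: "e \<in> el (V a)" "i \<in> el (V a)" "x \<in> el (V a)"
  shows "upd e i x \<in> el (V a)"
proof -
  have aO: "a \<in> Ord" by (rule limit_Ord[OF a])
  have p: "pair i x \<in> el (V a)" by (rule V_pair[OF a x(2,3)])
  obtain b where b: "b \<in> el a" "pair i x \<in> el (V b)" "e \<in> el (V b)" using V_common[OF a p x(1)] by blast
  have eU: "e \<in> U" "i \<in> U" using x by auto
  have "el e \<subseteq> el (V b)" using V_trans[OF Ord_elem[OF aO b(1)]] b(3) unfolding transitive_def by blast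
  then have "el (upd e i x) \<subseteq> el (V b)" using b(2) unfolding el_upd[OF eU] by blast
  from V_setof[OF a b(1) isset_el[OF upd_U] this] show ?thesis by (simp add: setof_el)
qed

lemma asg_V:
  assumes a: "a \<in> U" "limit_ordinal a" and E: "\<And>n. n < N \<Longrightarrow> E n \<in> el (V a)"
  shows "asg E N \<in> el (V a)"
  using E
proof (induction N)
  case 0
  show ?case using limit_nonempty[OF a] Ord_sub_V[OF limit_Ord[OF a]] by auto
next
  case (Suc N)
  have n: "num N \<in> el (V a)"
  proof -
    have "num k \<in> el a" for k
      by (induction k) (use limit_nonempty[OF a] limit_sc[OF a] in simp_all)
    then show ?thesis using Ord_sub_V[OF limit_Ord[OF a]] by blast
  qed
  have "asg E N \<in> el (V a)" by (rule Suc.IH) (use Suc.prems in simp)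
  then show ?case using V_upd[OF a _ n] Suc.prems[of N] by simp
qed

lemma fn_asg: "(\<And>n. n < N \<Longrightarrow> E n \<in> U) \<Longrightarrow> k < N \<Longrightarrow> fn (asg E N) (num k) = E k"
  unfolding fn_def
proof (rule uniq_eq)
  assume *: "\<And>n. n < N \<Longrightarrow> E n \<in> U" "k < N"
  show "E k \<in> U" using * by simp
  show "pair (num k) (E k) \<in> el (asg E N)"
    using app_asg[OF *(1), where b = "E k" and k = k] * by (simp add: app_iff)
  fix b assume "b \<in> U" "pair (num k) b \<in> el (asg E N)"
  then show "b = E k" using app_asg[OF *(1), where b = b and k = k] by (simp add: app_iff)
qed

text \<open>The reflection argument codes the values of all free variables into one set \<open>s\<close>; this makes truth in
  the universe of a fixed formula definable in \<open>s\<close>.\<close>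

lemma dfb_sat_terms:
  "(\<And>n. Dft C (ts n)) \<Longrightarrow> Dfb C (\<lambda>e. sat \<phi> (\<lambda>n. ts n e))"
proof (induction \<phi> arbitrary: ts)
  case (Exists i p)
  have "Dfb C (\<lambda>e. sat p (\<lambda>n. (if n = i then (\<lambda>e. e 0) else (\<lambda>e. ts n (\<lambda>m. e (Suc m)))) e))"
  proof (rule Exists.IH)
    fix n show "Dft C (if n = i then \<lambda>e. e 0 else (\<lambda>e. ts n (\<lambda>m. e (Suc m))))"
      using dft_shift[OF Exists.prems] dft_var by simp
  qed
  then have "Dfb C (\<lambda>e. sat p ((\<lambda>n. ts n (\<lambda>m. e (Suc m)))(i := e 0)))"
    by (simp add: fun_upd_def if_distrib[of "\<lambda>f. f _"])
  from dfb_bex[OF dfc_U, of C "\<lambda>e a. sat p ((\<lambda>n. ts n e)(i := a))", OF this]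
  show ?case by (simp only: sat.simps)
next
  case (Mem i j)
  show ?case unfolding sat.simps by (rule dfb_mem; rule Mem.prems)
next
  case (Equal i j)
  show ?case unfolding sat.simps by (rule dfb_eq; rule Equal.prems)
next
  case (Neg p)
  show ?case unfolding sat.simps by (rule dfb_not, rule Neg.IH, rule Neg.prems)
next
  case (Conj p p2)
  show ?case unfolding sat.simps
    by (rule dfb_conj, rule Conj.IH(1), rule Conj.prems, rule Conj.IH(2), rule Conj.prems)
qed

lemma dfb_sat_fn[dfb]:
  assumes "Dft C s" "Dft C a" shows "Dfb C (\<lambda>e. sat p ((\<lambda>n. fn (s e) (num n))(i := a e)))"
proof -
  have "Dfb C (\<lambda>e. sat p (\<lambda>n. (if n = i then a else (\<lambda>e. fn (s e) (num n))) e))"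
  proof (rule dfb_sat_terms)
    fix n show "Dft C (if n = i then a else (\<lambda>e. fn (s e) (num n)))"
      using dft_fn[OF assms(1) dft_num] assms(2) by simp
  qed
  then show ?thesis by (simp add: fun_upd_def if_distrib[of "\<lambda>f. f _"])
qed

lemma least_Ord: "least P \<in> Ord"
proof (cases "\<exists>a\<in>U. a \<in> Ord \<and> P a \<and> (\<forall>c\<in>el a. \<not> P c)")
  case True
  then obtain a where a: "a \<in> Ord" "P a" "\<forall>c\<in>el a. \<not> P c" by blast
  have "least P = a" unfolding least_def
  proof (rule uniq_eq)
    fix b assume "b \<in> U" "b \<in> Ord \<and> P b \<and> (\<forall>d\<in>el b. \<not> P d)"
    then show "b = a" using Ord_linear[of b a] a by blast
  qed (use a in auto)
  with a show ?thesis by simp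
next
  case False
  then have "{a \<in> U. (a \<in> Ord \<and> P a \<and> (\<forall>c\<in>el a. \<not> P c)) \<and>
      (\<forall>b\<in>U. b \<in> Ord \<and> P b \<and> (\<forall>c\<in>el b. \<not> P c) \<longrightarrow> b = a)} = {}" by blast
  then have "least P = emp" unfolding least_def uniq_def emp_def by (simp only: UN_empty)
  then show ?thesis by simp
qed

definition omax :: "'a \<Rightarrow> 'a \<Rightarrow> 'a" where "omax a b = setof (el a \<union> el b)"

lemma dft_omax[dfb]: "Dft C a \<Longrightarrow> Dft C b \<Longrightarrow> Dft C (\<lambda>e. omax (a e) (b e))"
  unfolding omax_def by (rule dfb | assumption)+

lemma omax:
  assumes "a \<in> Ord" "b \<in> Ord" shows "omax a b \<in> Ord" "el (omax a b) = el a \<union> el b"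
proof -
  have "el (omax a b) = el a \<union> el b" unfolding omax_def using assms by (intro el_setof isset_Un isset_el) auto
  moreover have "el a \<subseteq> el b \<or> el b \<subseteq> el a"
    using Ord_linear[OF assms] Ord_le_iff[OF assms] Ord_le_iff[OF assms(2,1)] by blast
  ultimately show "omax a b \<in> Ord" "el (omax a b) = el a \<union> el b"
    using el_ext[of "omax a b" a] el_ext[of "omax a b" b] assms
    by (auto simp: Un_absorb1 Un_absorb2 omax_def)
qed

definition closed_under :: "('a \<Rightarrow> 'a) \<Rightarrow> 'a \<Rightarrow> bool" where
  "closed_under F a \<longleftrightarrow> a \<in> Ord \<and> limit_ordinal a \<and> (\<forall>x\<in>el a. F x \<in> el a)"

definition reflects :: "'a \<Rightarrow> fm \<Rightarrow> bool" where
  "reflects a \<phi> \<longleftrightarrow> (\<forall>E. (\<forall>n. E n \<in> el (V a)) \<longrightarrow> (set_structure.sat (el (V a)) mem \<phi> E \<longleftrightarrow> sat \<phi> E))"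

text \<open>For each existential subformula it suffices to be closed under the function that bounds, for the
  parameters in a given level, the first level containing a witness.\<close>

lemma reflection_function:
  "\<exists>F. Dft U (\<lambda>e. F (e 0)) \<and> (\<forall>a\<in>Ord. F a \<in> Ord) \<and> (\<forall>a. closed_under F a \<longrightarrow> reflects a \<phi>)"
proof (induction \<phi>)
  case (Mem i j)
  show ?case
    by (intro exI[of _ "\<lambda>x. x"] conjI dft_var) (simp_all add: reflects_def set_structure.sat.simps)
next
  case (Equal i j)
  show ?case
    by (intro exI[of _ "\<lambda>x. x"] conjI dft_var) (simp_all add: reflects_def set_structure.sat.simps)
next
  case (Neg p)
  then obtain F where "Dft U (\<lambda>e. F (e 0))" "\<forall>a\<in>Ord. F a \<in> Ord" "\<forall>a. closed_under F a \<longrightarrow> reflects a p" by blast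
  then show ?case
    by (intro exI[of _ F] conjI) (simp_all add: reflects_def set_structure.sat.simps)
next
  case (Conj p p2)
  then obtain F H where F: "Dft U (\<lambda>e. F (e 0))" "\<forall>a\<in>Ord. F a \<in> Ord" "\<forall>a. closed_under F a \<longrightarrow> reflects a p"
    and H: "Dft U (\<lambda>e. H (e 0))" "\<forall>a\<in>Ord. H a \<in> Ord" "\<forall>a. closed_under H a \<longrightarrow> reflects a p2" by blast
  show ?case
  proof (intro exI[of _ "\<lambda>x. omax (F x) (H x)"] conjI ballI allI impI)
    show "Dft U (\<lambda>e. omax (F (e 0)) (H (e 0)))" by (rule dfb dft_comp[OF F(1)] dft_comp[OF H(1)])+
    show "omax (F a) (H a) \<in> Ord" if "a \<in> Ord" for a using omax(1) F(2) H(2) that by blast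
    fix a assume a: "closed_under (\<lambda>x. omax (F x) (H x)) a"
    have aO: "a \<in> Ord" using a by (simp add: closed_under_def)
    have "F x \<in> el a \<and> H x \<in> el a" if x: "x \<in> el a" for x
    proof -
      have O: "F x \<in> Ord" "H x \<in> Ord" using F(2) H(2) Ord_elem[OF aO x] by auto
      have m: "omax (F x) (H x) \<in> el a" using a x by (simp add: closed_under_def)
      show ?thesis
        using Ord_le_less[OF aO O(1) _ m] Ord_le_less[OF aO O(2) _ m] omax(2)[OF O] by blast
    qed
    then have "closed_under F a" "closed_under H a" using a by (simp_all add: closed_under_def)
    then show "reflects a (Conj p p2)" using F(3) H(3) by (simp add: reflects_def set_structure.sat.simps)
  qed
next
  case (Exists i p)
  then obtain F where F: "Dft U (\<lambda>e. F (e 0))" "\<forall>a\<in>Ord. F a \<in> Ord" "\<forall>a. closed_under F a \<longrightarrow> reflects a p" by blast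
  define W where "W s a = sat p ((\<lambda>n. fn s (num n))(i := a))" for s a
  have dW: "Dft C s \<Longrightarrow> Dft C a \<Longrightarrow> Dfb C (\<lambda>e. W (s e) (a e))" for C s a
    unfolding W_def by (rule dfb_sat_fn)
  \<comment> \<open>the first level that contains a witness for the parameters coded by \<open>s\<close>\<close>
  define h where "h s = least (\<lambda>b. \<exists>a\<in>el (V b). W s a)" for s
  have dh: "Dft C s \<Longrightarrow> Dft C (\<lambda>e. h (s e))" for C s
    by (rule dft_lift1[of C h]) (unfold h_def, (rule dfb dW)+)
  have hO: "h s \<in> Ord" for s unfolding h_def by (rule least_Ord)
  define H where "H x = setof (\<Union>y\<in>h ` el (V x). el y)" for x
  have dH: "Dft U (\<lambda>e. H (e 0))" unfolding H_def by (rule dfb dh)+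
  have hs: "isset (h ` el (V x))" for x
    by (rule isset_image[OF isset_el[OF V_U]]) (rule dh dfb)+
  have hsO: "h ` el (V x) \<subseteq> Ord" for x using hO by auto
  have HO: "H x \<in> Ord" and elH: "el (H x) = (\<Union>y\<in>h ` el (V x). el y)" for x
    unfolding H_def by (rule Ord_Union[OF hs hsO])+
  show ?case
  proof (intro exI[of _ "\<lambda>x. omax (F x) (H x)"] conjI ballI allI impI)
    show "Dft U (\<lambda>e. omax (F (e 0)) (H (e 0)))" by (rule dfb dft_comp[OF F(1)] dft_comp[OF dH])+
    show "omax (F a) (H a) \<in> Ord" if "a \<in> Ord" for a using omax(1) F(2) HO that by blast
    fix a assume a: "closed_under (\<lambda>x. omax (F x) (H x)) a"
    have aO: "a \<in> Ord" "limit_ordinal a" using a by (simp_all add: closed_under_def)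
    have aU: "a \<in> U" using aO by simp
    have cl: "F x \<in> el a \<and> H x \<in> el a" if x: "x \<in> el a" for x
    proof -
      have O: "F x \<in> Ord" "H x \<in> Ord" using F(2) HO Ord_elem[OF aO(1) x] by auto
      have m: "omax (F x) (H x) \<in> el a" using a x by (simp add: closed_under_def)
      show ?thesis
        using Ord_le_less[OF aO(1) O(1) _ m] Ord_le_less[OF aO(1) O(2) _ m] omax(2)[OF O] by blast
    qed
    then have "closed_under F a" using a by (simp add: closed_under_def)
    then have rp: "reflects a p" using F(3) by blast
    show "reflects a (Exists i p)" unfolding reflects_def
    proof (intro allI impI)
      fix E :: "nat \<Rightarrow> 'a" assume E: "\<forall>n. E n \<in> el (V a)"
      have EU: "E n \<in> U" for n using E el_U by blast
      have r: "set_structure.sat (el (V a)) mem p (E(i := x)) \<longleftrightarrow> sat p (E(i := x))" if "x \<in> el (V a)" for x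
        using rp E that unfolding reflects_def by simp
      have "\<exists>x\<in>el (V a). sat p (E(i := x))" if "\<exists>x\<in>U. sat p (E(i := x))"
      proof -
        define s where "s = asg E (vbound p)"
        have Ws: "W s x \<longleftrightarrow> sat p (E(i := x))" for x
          unfolding W_def s_def by (rule sat_cong) (simp add: fn_asg[of _ E, OF EU])
        have "s \<in> el (V a)" unfolding s_def by (rule asg_V[OF aU aO(2)]) (use E in blast)
        then obtain y where y: "y \<in> el a" "s \<in> el (V y)" using V_limit[OF aU aO(2)] by blast
        obtain x where x: "x \<in> U" "sat p (E(i := x))" using \<open>\<exists>x\<in>U. _\<close> by blast
        obtain b where b: "b \<in> Ord" "x \<in> el (V b)" using ranked[OF x(1)] by blast
        have sU: "s \<in> U" by (simp add: s_def)
        have "Dfb U (\<lambda>e. \<exists>a\<in>el (V (e 0)). W s a)" by (rule dfb dW dft_const_U[OF sU])+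
        from least(2)[of "\<lambda>b. \<exists>a\<in>el (V b). W s a", OF this b(1)]
        have "\<exists>z\<in>el (V (h s)). W s z" using b(2) x(2) Ws unfolding h_def by blast
        then obtain z where z: "z \<in> el (V (h s))" "W s z" by blast
        have "el (h s) \<subseteq> el (H y)" using elH y(2) by blast
        moreover have "H y \<in> el a" using cl[OF y(1)] by blast
        ultimately have "h s \<in> el a" using Ord_le_less[OF aO(1) hO] by blast
        then have "z \<in> el (V a)" using V_mono[OF aO(1), of "h s"] z(1) by blast
        then show ?thesis using z(2) Ws by blast
      qed
      then have "(\<exists>x\<in>el (V a). sat p (E(i := x))) \<longleftrightarrow> (\<exists>x\<in>U. sat p (E(i := x)))" using el_U by blast
      then show "set_structure.sat (el (V a)) mem (Exists i p) E \<longleftrightarrow> sat (Exists i p) E"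
        by (simp add: set_structure.sat.simps r cong: bex_cong)
    qed
  qed
qed

lemma reflection:
  assumes "b \<in> Ord"
  obtains a where "a \<in> Ord" "limit_ordinal a" "b \<in> el a" "reflects a \<phi>"
proof -
  obtain F where F: "Dft U (\<lambda>e. F (e 0))" "\<forall>a\<in>Ord. F a \<in> Ord" "\<forall>a. closed_under F a \<longrightarrow> reflects a \<phi>"
    using reflection_function by blast
  obtain a where a: "a \<in> Ord" "limit_ordinal a" "b \<in> el a" "\<And>x. x \<in> el a \<Longrightarrow> F x \<in> el a"
    by (rule Ord_closure[OF F(1) _ assms]) (use F(2) in blast, rule that)
  then have "closed_under F a" by (simp add: closed_under_def)
  then show ?thesis using that a F(3) by blast
qed

lemma isset_finite: "finite X \<Longrightarrow> X \<subseteq> U \<Longrightarrow> isset X"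
  by (induction X rule: finite_induct) (auto intro: isset_insert)

text \<open>A set defined in the universe from ordinals is defined by the same formula over any level that
  contains it and the parameters, and that reflects the formula.\<close>

lemma OD_intro:
  assumes Q: "Dfb Ord (\<lambda>e. Q (e 0))" and a: "a \<in> U" "Q a" and un: "\<And>b. b \<in> U \<Longrightarrow> Q b \<Longrightarrow> b = a"
  shows "a \<in> OD"
proof -
  obtain \<phi> k c where c: "\<And>n. n < k \<Longrightarrow> c n \<in> Ord"
    and \<phi>: "\<And>e. range e \<subseteq> U \<Longrightarrow> Q (e 0) = sat \<phi> (env k c e)"
    by (rule dfbE[OF Q], rule that)
  define E where "E b n = (if n < k then c n else if n = k then b else emp)" for b n
  have QE: "Q b \<longleftrightarrow> sat \<phi> (E b)" if "b \<in> U" for b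
  proof -
    have "range (\<lambda>m::nat. if m = 0 then b else emp) \<subseteq> U" using that by auto
    from \<phi>[OF this] have "Q b = sat \<phi> (env k c (\<lambda>m. if m = 0 then b else emp))" by simp
    moreover have "env k c (\<lambda>m. if m = 0 then b else emp) = E b"
      by (rule HOL.ext) (auto simp: env_def E_def)
    ultimately show ?thesis by simp
  qed
  define X where "X = insert a (c ` {..<k})"
  have "isset X" unfolding X_def by (rule isset_finite) (use a c in auto)
  then have X: "el (setof X) = X" by (rule el_setof)
  obtain b where b: "b \<in> Ord" "setof X \<in> el (V b)" using ranked[OF setof_U] by blast
  obtain \<alpha> where \<alpha>: "\<alpha> \<in> Ord" "limit_ordinal \<alpha>" "b \<in> el \<alpha>" "reflects \<alpha> \<phi>" by (rule reflection[OF b(1)], rule that)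
  have \<alpha>U: "\<alpha> \<in> U" using \<alpha> by simp
  have "setof X \<in> el (V \<alpha>)" using V_mono[OF \<alpha>(1), of b] \<alpha>(3) b(2) by blast
  then have XV: "X \<subseteq> el (V \<alpha>)" using V_trans[OF \<alpha>(1)] X unfolding transitive_def by blast
  have eV: "emp \<in> el (V \<alpha>)" using limit_nonempty[OF \<alpha>U \<alpha>(2)] Ord_sub_V[OF \<alpha>(1)] by blast
  define A where "A = V \<alpha>"
  have A: "A \<in> U" by (simp add: A_def)
  define N where "N = max (vbound \<phi>) (Suc k)"
  have EA: "E b n \<in> el A" if "b \<in> el A" for b n
    using XV eV that by (auto simp: E_def X_def A_def)
  define B where "B = setof {\<beta> \<in> el A. ordinal \<beta>}"
  have "isset {\<beta> \<in> el A. ordinal \<beta>}" by (rule isset_sep[OF isset_el[OF A]]) (rule dfb)+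
  then have B: "el B = {\<beta> \<in> el A. ordinal \<beta>}" unfolding B_def by (rule el_setof)
  define e where "e = asg (E emp) N"
  have Eo: "E emp n \<in> el B" for n
    using EA[of emp n] eV c unfolding B E_def A_def using emp_Ord unfolding Ord_def by auto
  have eB: "e \<in> As B" unfolding e_def by (rule asg_As) (rule Eo)
  have eA: "e \<in> As A" unfolding e_def by (rule asg_As) (use Eo B in blast)
  have key: "b = a \<longleftrightarrow> (\<exists>e'\<in>U. update e (num k) b e' \<and> satisfies (el A) {} (fcode \<phi>) e')" if b: "b \<in> el A" for b
  proof -
    have bU: "b \<in> U" and eU: "e \<in> U" using b eA by auto
    have "(\<exists>e'\<in>U. update e (num k) b e' \<and> satisfies (el A) {} (fcode \<phi>) e') \<longleftrightarrow>
        Sat A emp (fcode \<phi>) (upd e (num k) b)"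
      unfolding Sat_def using update_iff[OF eU num_U bU] by auto
    also have "\<dots> \<longleftrightarrow> set_structure.sat (el A) mem \<phi> (E b)"
    proof (rule Sat_fcode[OF A emp_U upd_As[OF eA num_omega b]])
      show "vbound \<phi> \<le> N" by (simp add: N_def)
      fix n assume n: "n < N"
      have "E emp n \<in> U" for n using Eo el_U by blast
      then have "app e (num n) (E emp n)" unfolding e_def using app_asg[of N "E emp" "E emp n" n] n by simp
      moreover have "app (upd e (num k) b) (num n) (E b n) \<longleftrightarrow> (if num n = num k then E b n = b else app e (num n) (E b n))"
        by (rule app_upd[OF eU num_U bU num_U]) (use EA[OF b] el_U in blast)
      ultimately show "E b n \<in> el A \<and> app (upd e (num k) b) (num n) (E b n)"
        using EA[OF b, of n] by (auto simp: E_def)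
    qed
    also have "\<dots> \<longleftrightarrow> sat \<phi> (E b)"
      using \<alpha>(4) EA[OF b] unfolding reflects_def A_def by blast
    also have "\<dots> \<longleftrightarrow> b = a" using QE[OF bU] a un[OF bU] by blast
    finally show ?thesis by blast
  qed
  have aA: "a \<in> el A" using XV by (simp add: X_def A_def)
  have eB': "e \<in> assignments {\<beta> \<in> el A. ordinal \<beta>}" using eB by (simp only: B)
  have "\<forall>b\<in>el A. b = a \<longleftrightarrow> (\<exists>e'\<in>U. update e (num k) b e' \<and> satisfies (el A) {} (fcode \<phi>) e')"
    using key by (rule ballI)
  then have 1: "\<exists>c\<in>Formula. \<exists>e\<in>assignments {\<beta> \<in> el A. ordinal \<beta>}. \<exists>i\<in>omega. \<forall>b\<in>el A.
      b = a \<longleftrightarrow> (\<exists>e'\<in>U. update e i b e' \<and> satisfies (el A) {} c e')"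
    by (intro bexI[of _ "fcode \<phi>"] bexI[of _ e] bexI[of _ "num k"] fcode_Formula eB' num_omega)
  have 2: "V_level \<alpha> A" unfolding A_def by (rule V_level_V[OF \<alpha>(1)])
  show ?thesis unfolding OD_def
    by (intro CollectI conjI a(1) bexI[of _ \<alpha>] bexI[of _ A] 2 aA 1 A \<alpha>U)
qed

text \<open>The transitive closure of \<open>{z}\<close> is the intersection of the transitive subsets of \<open>s\<close> containing \<open>z\<close>, so
  one transitive set of ordinal definable sets puts all its members into HOD.\<close>

lemma HOD_intro:
  assumes s: "s \<in> U" "transitive s" "el s \<subseteq> OD" and z: "z \<in> el s"
  shows "z \<in> HOD"
proof -
  have zU: "z \<in> U" using z by simp
  define X where "X = {w \<in> el s. \<forall>t\<in>U. transitive t \<and> z \<in> el t \<longrightarrow> w \<in> el t}"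
  have "isset X" unfolding X_def
    by (rule isset_sep[OF isset_el[OF s(1)]]) (rule dfb dft_const_U[OF zU])+
  then have e: "el (setof X) = X" by (rule el_setof)
  have "transitive (setof X)" unfolding transitive_def e
  proof
    fix y assume y: "y \<in> X"
    then have "el y \<subseteq> el s" using s(2) unfolding transitive_def X_def by blast
    then show "el y \<subseteq> X" using y transitiveD unfolding X_def by blast
  qed
  then have "is_tc z (setof X)" unfolding is_tc_def e using z unfolding X_def by blast
  moreover have "X \<subseteq> OD" using s(3) unfolding X_def by blast
  then have "el (setof X) \<subseteq> OD" by (simp only: e)
  ultimately show ?thesis unfolding HOD_def using zU by blast
qed

text \<open>A bijection in HOD witnesses that an ordinal is not a cardinal there; it suffices that the
  bijection itself is ordinal definable, because its members are built from ordinals.\<close>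

lemma not_HOD_cardinal:
  assumes f: "f \<in> OD" "bijection f (el \<tau>) (el \<alpha>)" and \<alpha>: "\<alpha> \<in> Ord" and \<tau>: "\<tau> \<in> el \<alpha>"
  shows "\<not> set_structure.cardinal HOD mem \<alpha>"
proof -
  have fU: "f \<in> U" using f(1) by (simp add: OD_def)
  have \<alpha>U: "\<alpha> \<in> U" using \<alpha> by simp
  have \<tau>\<alpha>: "el \<tau> \<subseteq> el \<alpha>" using Ord_trans[OF \<alpha> _ \<tau>] by blast
  obtain b1 b2 where b: "b1 \<in> Ord" "f \<in> el (V b1)" "b2 \<in> Ord" "\<alpha> \<in> el (V b2)" using ranked[OF fU] ranked[OF \<alpha>U] by blast
  obtain \<theta> where \<theta>: "\<theta> \<in> Ord" "limit_ordinal \<theta>" "omax b1 b2 \<in> el \<theta>"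
    by (rule reflection[OF omax(1)[OF b(1,3)], of "Mem 0 0"], rule that)
  have \<theta>U: "\<theta> \<in> U" using \<theta> by simp
  have "b1 \<in> el \<theta>" "b2 \<in> el \<theta>"
    using Ord_le_less[OF \<theta>(1) _ _ \<theta>(3)] omax(2)[OF b(1,3)] b by auto
  then have fV: "f \<in> el (V \<theta>)" and \<alpha>V: "\<alpha> \<in> el (V \<theta>)"
    using V_mono[OF \<theta>(1), of b1] V_mono[OF \<theta>(1), of b2] b by auto
  have \<alpha>s: "el \<alpha> \<subseteq> el (V \<theta>)" using V_trans[OF \<theta>(1)] \<alpha>V unfolding transitive_def by blast
  \<comment> \<open>a transitive set of ordinal definable sets containing \<open>f\<close>; it suffices to compute in it, since its
    members have the same members in HOD as in the universe\<close>
  define X where "X = {z \<in> el (V \<theta>). z = f \<or> z \<in> el \<alpha> \<or> (\<exists>a\<in>el \<alpha>. \<exists>b\<in>el \<alpha>. z = setof {a, b} \<or> z = pair a b)}"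
  have "isset X" unfolding X_def
    by (rule isset_sep[OF isset_el[OF V_U]]) (rule dfb dft_const_U[OF fU] dft_const_U[OF \<alpha>U])+
  then have e: "el (setof X) = X" by (rule el_setof)
  have pV: "pair a b \<in> X \<and> setof {a, b} \<in> X" if ab: "a \<in> el \<alpha>" "b \<in> el \<alpha>" for a b
  proof -
    have p: "pair a b \<in> el (V \<theta>)" by (rule V_pair[OF \<theta>U \<theta>(2)]) (use \<alpha>s ab in auto)
    have abU: "a \<in> U" "b \<in> U" using ab by auto
    have "setof {a, b} \<in> el (pair a b)" unfolding el_pair[OF abU] by simp
    then have "setof {a, b} \<in> el (V \<theta>)" using transitiveD[OF V_trans[OF \<theta>(1)] _ p] by blast
    then show ?thesis unfolding X_def using p ab by blast
  qed
  have sX: "setof {a} \<in> X" if "a \<in> el \<alpha>" for a using pV[OF that that] by simp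
  have \<alpha>X: "el \<alpha> \<subseteq> X" using \<alpha>s unfolding X_def by blast
  have felt: "\<exists>a\<in>el \<alpha>. \<exists>b\<in>el \<alpha>. p = pair a b" if p: "p \<in> el f" for p
  proof -
    obtain a b where ab: "a \<in> el \<tau>" "b \<in> el \<alpha>" "is_pair a b p"
      using f(2) p unfolding bijection_def maps_def by blast
    then have "p = pair a b" using is_pair_iff[of a b p] p by simp
    then show ?thesis using ab \<tau>\<alpha> by blast
  qed
  have tr: "el z \<subseteq> X" if z: "z \<in> X" for z
  proof -
    consider "z = f" | "z \<in> el \<alpha>" | a b where "a \<in> el \<alpha>" "b \<in> el \<alpha>" "z = setof {a, b}"
      | a b where "a \<in> el \<alpha>" "b \<in> el \<alpha>" "z = pair a b" using z unfolding X_def by blast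
    then show ?thesis
    proof cases
      case 1 then show ?thesis using felt pV by blast
    next
      case 2
      then have "el z \<subseteq> el \<alpha>" using Ord_trans[OF \<alpha> _ 2] by blast
      then show ?thesis using \<alpha>X by blast
    next
      case (3 a b)
      then have "el z = {a, b}" using el_setof[OF isset_pair[of a b]] by simp
      then show ?thesis using 3(1,2) \<alpha>X by auto
    next
      case (4 a b)
      then have "el z = {setof {a}, setof {a, b}}" using el_pair[of a b] by simp
      then show ?thesis using sX[OF 4(1)] pV[OF 4(1,2)] by auto
    qed
  qed
  have XOD: "X \<subseteq> OD"
  proof
    fix z assume z: "z \<in> X"
    have abO: "a \<in> Ord" if "a \<in> el \<alpha>" for a by (rule Ord_elem[OF \<alpha> that])
    have od: "t \<in> OD" if "t \<in> U" "Dfb Ord (\<lambda>e. e 0 = t)" for t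
      by (rule OD_intro[of "\<lambda>x. x = t"]) (use that in auto)
    consider "z = f" | "z \<in> el \<alpha>" | a b where "a \<in> el \<alpha>" "b \<in> el \<alpha>" "z = setof {a, b}"
      | a b where "a \<in> el \<alpha>" "b \<in> el \<alpha>" "z = pair a b" using z unfolding X_def by blast
    then show "z \<in> OD"
    proof cases
      case 1 then show ?thesis using f(1) by simp
    next
      case 2 then show ?thesis
        by (intro od) (simp, (rule dfb dft_const[OF el_U[OF 2] abO[OF 2]])+)
    next
      case (3 a b) then show ?thesis
        by (simp only:, intro od) (simp, (rule dfb dft_const[OF el_U[OF 3(1)] abO[OF 3(1)]] dft_const[OF el_U[OF 3(2)] abO[OF 3(2)]])+)
    next
      case (4 a b) then show ?thesis
        by (simp only:, intro od) (simp, (rule dfb dft_const[OF el_U[OF 4(1)] abO[OF 4(1)]] dft_const[OF el_U[OF 4(2)] abO[OF 4(2)]])+)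
    qed
  qed
  have XH: "X \<subseteq> HOD"
  proof
    fix z assume "z \<in> X"
    then show "z \<in> HOD" using XOD tr e by (intro HOD_intro[of "setof X"]) (auto simp: transitive_def)
  qed
  have elH: "set_structure.el HOD mem z = el z" if "z \<in> X \<or> z = \<alpha>" for z
  proof -
    have "el z \<subseteq> HOD" using tr XH \<alpha>X that by blast
    moreover have "HOD \<subseteq> U" unfolding HOD_def by blast
    ultimately show ?thesis unfolding set_structure.el_def by blast
  qed
  have fX: "f \<in> X" using fV by (simp add: X_def)
  have \<tau>X: "\<tau> \<in> X" using \<tau> \<alpha>X by blast
  have pairH: "set_structure.is_pair HOD mem a b p \<longleftrightarrow> is_pair a b p"
    if ab: "a \<in> el \<alpha>" "b \<in> el \<alpha>" and p: "p \<in> X" for a b p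
  proof
    assume "set_structure.is_pair HOD mem a b p"
    then obtain s d where sd: "s \<in> HOD" "d \<in> HOD" "set_structure.el HOD mem s = {a}"
      "set_structure.el HOD mem d = {a, b}" "el p = {s, d}"
      unfolding set_structure.is_pair_def using elH[of p] p by auto
    have "s \<in> X" "d \<in> X" using tr[OF p] sd(5) by auto
    then show "is_pair a b p" unfolding is_pair_def using sd elH[of s] elH[of d] el_U[of s p] el_U[of d p] by auto
  next
    assume "is_pair a b p"
    then obtain s d where sd: "el s = {a}" "el d = {a, b}" "el p = {s, d}" unfolding is_pair_def by blast
    have sX: "s \<in> X" "d \<in> X" using tr[OF p] sd(3) by auto
    then have "s \<in> HOD" "d \<in> HOD" using XH by auto
    moreover have "set_structure.el HOD mem s = {a} \<and> set_structure.el HOD mem d = {a, b} \<and>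
        set_structure.el HOD mem p = {s, d}" using sd elH[of s] elH[of d] elH[of p] p sX by simp
    ultimately show "set_structure.is_pair HOD mem a b p"
      unfolding set_structure.is_pair_def by blast
  qed
  have appH: "set_structure.app HOD mem f a b \<longleftrightarrow> app f a b" if "a \<in> el \<alpha>" "b \<in> el \<alpha>" for a b
    unfolding set_structure.app_def app_def using elH[of f] fX pairH[OF that] tr[OF fX] by auto
  have "set_structure.bijection HOD mem f (el \<tau>) (el \<alpha>)"
    unfolding set_structure.bijection_def set_structure.maps_def
  proof (intro conjI ballI)
    fix p assume "p \<in> set_structure.el HOD mem f"
    then have p: "p \<in> el f" using elH[of f] fX by simp
    then obtain a b where ab: "a \<in> el \<tau>" "b \<in> el \<alpha>" "is_pair a b p"
      using f(2) unfolding bijection_def maps_def by blast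
    then show "\<exists>a\<in>el \<tau>. \<exists>b\<in>el \<alpha>. set_structure.is_pair HOD mem a b p"
      using pairH[of a b p] \<tau>\<alpha> tr[OF fX] p by blast
  next
    fix a assume a: "a \<in> el \<tau>"
    then have a': "a \<in> el \<alpha>" using \<tau>\<alpha> by blast
    have "\<exists>!b. b \<in> el \<alpha> \<and> app f a b" using f(2) a unfolding bijection_def maps_def by blast
    moreover have "b \<in> el \<alpha> \<and> set_structure.app HOD mem f a b \<longleftrightarrow> b \<in> el \<alpha> \<and> app f a b" for b
      using appH[OF a'] by blast
    ultimately show "\<exists>!b. b \<in> el \<alpha> \<and> set_structure.app HOD mem f a b" by simp
  next
    fix b assume b: "b \<in> el \<alpha>"
    have "\<exists>!a. a \<in> el \<tau> \<and> app f a b" using f(2) b unfolding bijection_def by blast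
    moreover have "a \<in> el \<tau> \<and> set_structure.app HOD mem f a b \<longleftrightarrow> a \<in> el \<tau> \<and> app f a b" for a
      using appH[OF _ b] \<tau>\<alpha> by blast
    ultimately show "\<exists>!a. a \<in> el \<tau> \<and> set_structure.app HOD mem f a b" by simp
  qed
  moreover have "f \<in> HOD" using fX XH by blast
  moreover have "\<tau> \<in> set_structure.el HOD mem \<alpha>" using elH[of \<alpha>] \<tau> by simp
  ultimately show ?thesis unfolding set_structure.cardinal_def
    using elH[of \<alpha>] elH[OF disjI1[OF \<tau>X]] by metis
qed

section \<open>The levels of the constructible hierarchy\<close>

lemmas dfb_satisfies[dfb] = dfb_Sat[unfolded Sat_def]

lemma dfb_definable_subset[dfb]:
  "Dft C a \<Longrightarrow> Dft C p \<Longrightarrow> Dft C x \<Longrightarrow> Dfb C (\<lambda>e. definable_subset (el (a e)) (el (p e)) (x e))"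
  by (rule dfb_lift3[of C "\<lambda>a p x. definable_subset (el a) (el p) x"])
     (unfold definable_subset_def, (rule dfb)+)

lemma update_Sat: "e \<in> U \<Longrightarrow> i \<in> U \<Longrightarrow> a \<in> U \<Longrightarrow>
    (\<exists>e'\<in>U. update e i a e' \<and> satisfies (el A) (el P) c e') \<longleftrightarrow> Sat A P c (upd e i a)"
  unfolding Sat_def using update_iff upd_U by blast

lemma definable_subset_iff:
  "definable_subset (el A) (el P) X \<longleftrightarrow> el X \<subseteq> el A \<and>
     (\<exists>c\<in>Formula. \<exists>e\<in>As A. \<exists>i\<in>omega. \<forall>a\<in>el A. a \<in> el X \<longleftrightarrow> Sat A P c (upd e i a))"
proof -
  have "(\<forall>a\<in>el A. a \<in> el X \<longleftrightarrow> (\<exists>e'\<in>U. update e i a e' \<and> satisfies (el A) (el P) c e')) \<longleftrightarrow>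
     (\<forall>a\<in>el A. a \<in> el X \<longleftrightarrow> Sat A P c (upd e i a))" if "e \<in> As A" "i \<in> omega" for c e i
    by (rule ball_cong[OF refl]) (simp only: update_Sat[OF As_U[OF that(1)] omega_U[OF that(2)] el_U])
  then show ?thesis unfolding definable_subset_def by (simp cong: bex_cong)
qed

definition lstep :: "'a \<Rightarrow> 'a \<Rightarrow> 'a" where
  "lstep x A = setof {X \<in> U. definable_subset (el A) (el x) X}"

text \<open>\<open>L x a\<close> is the level \<open>L\<^sub>a[x]\<close>.\<close>

definition L :: "'a \<Rightarrow> 'a \<Rightarrow> 'a" where "L = lev lstep"

lemma Ds_lstep: "Ds C lstep"
  unfolding Ds_def lstep_def by (intro allI) (rule dfb)+

lemma dft_L[dfb]: "Dft C a \<Longrightarrow> Dft C b \<Longrightarrow> Dft C (\<lambda>e. L (a e) (b e))"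
  unfolding L_def by (rule dft_lev[OF Ds_lstep])

lemma L_U[simp, intro]: "x \<in> U \<Longrightarrow> L x a \<in> U" unfolding L_def by (rule lev_U[OF Ds_lstep])

lemma el_lstep:
  assumes "x \<in> U" "A \<in> U" shows "el (lstep x A) = {X \<in> U. definable_subset (el A) (el x) X}"
proof -
  have 1: "{X \<in> U. definable_subset (el A) (el x) X} \<subseteq> {y \<in> U. el y \<subseteq> el A}"
    unfolding definable_subset_def by blast
  have "Dfc U (\<lambda>e. {X \<in> U. definable_subset (el A) (el x) X})"
    by (rule dfb dft_const_U[OF assms(1)] dft_const_U[OF assms(2)])+
  from isset_subset[OF isset_Pow[OF isset_el[OF assms(2)]] 1 this]
  show ?thesis unfolding lstep_def by (rule el_setof)
qed

text \<open>Definability over a level by a concrete formula; one parameter \<open>b\<close>, assigned to all other variables, is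
  enough for the two uses below.\<close>

lemma definable_by_fm:
  assumes A: "A \<in> U" "x \<in> U" and b: "b \<in> el A" and X: "el X \<subseteq> el A"
    and \<phi>: "\<And>z. z \<in> el A \<Longrightarrow> z \<in> el X \<longleftrightarrow> set_structure.sat (el A) mem \<phi> (\<lambda>n. if n = 0 then z else b)"
  shows "definable_subset (el A) (el x) X"
proof -
  define N where "N = Suc (vbound \<phi>)"
  define e where "e = asg (\<lambda>_. b) N"
  have bU: "b \<in> U" using b by simp
  have e: "e \<in> As A" unfolding e_def by (rule asg_As) (rule b)
  have "z \<in> el X \<longleftrightarrow> Sat A x (fcode \<phi>) (upd e (num 0) z)" if z: "z \<in> el A" for z
  proof -
    have "Sat A x (fcode \<phi>) (upd e (num 0) z) \<longleftrightarrow> set_structure.sat (el A) mem \<phi> (\<lambda>n. if n = 0 then z else b)"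
    proof (rule Sat_fcode[OF A upd_As[OF e num_omega z]])
      show "vbound \<phi> \<le> N" by (simp add: N_def)
      fix n assume n: "n < N"
      have "app e (num n) b" unfolding e_def using app_asg[of N "\<lambda>_. b" b n] n bU by simp
      moreover have "app (upd e (num 0) z) (num n) c \<longleftrightarrow> (if num n = num 0 then c = z else app e (num n) c)"
        if "c \<in> U" for c
        by (rule app_upd[OF As_U[OF e] num_U el_U[OF z] num_U that])
      ultimately show "(if n = 0 then z else b) \<in> el A \<and> app (upd e (num 0) z) (num n) (if n = 0 then z else b)"
        using z b bU el_U[OF z] by (auto simp del: num.simps)
    qed
    then show ?thesis using \<phi>[OF z] by simp
  qed
  then show ?thesis unfolding definable_subset_iff using X e fcode_Formula num_omega by blast
qed

lemma lstep_ok: "x \<in> U \<Longrightarrow> step_ok lstep x"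
  unfolding step_ok_def
proof (intro ballI impI)
  fix A assume x: "x \<in> U" and A: "A \<in> U" "transitive A"
  have 1: "el A \<subseteq> el (lstep x A)"
  proof
    fix a assume a: "a \<in> el A"
    have "definable_subset (el A) (el x) a"
    proof (rule definable_by_fm[OF A(1) x a, of _ "Mem 0 1"])
      show "el a \<subseteq> el A" using A(2) a unfolding transitive_def by blast
      show "z \<in> el a \<longleftrightarrow> set_structure.sat (el A) mem (Mem 0 1) (\<lambda>n. if n = 0 then z else a)" if "z \<in> el A" for z
        using that by (simp add: set_structure.sat.simps mem_iff)
    qed
    then show "a \<in> el (lstep x A)" using el_lstep[OF x A(1)] a by simp
  qed
  moreover have "transitive (lstep x A)"
    unfolding transitive_def using 1 unfolding el_lstep[OF x A(1)] definable_subset_def by blast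
  ultimately show "el A \<subseteq> el (lstep x A) \<and> transitive (lstep x A)" by blast
qed

lemma L_emp: "x \<in> U \<Longrightarrow> L x emp = emp" unfolding L_def by (rule lev_emp[OF Ds_lstep])
lemma el_L_sc: "x \<in> U \<Longrightarrow> b \<in> Ord \<Longrightarrow> el (L x (sc b)) = {X \<in> U. definable_subset (el (L x b)) (el x) X}"
  using lev_sc[OF Ds_lstep, of x b] el_lstep[of x "L x b"] L_U by (simp add: L_def)
lemma el_L_limit: "x \<in> U \<Longrightarrow> a \<in> U \<Longrightarrow> limit_ordinal a \<Longrightarrow> el (L x a) = (\<Union>b\<in>el a. el (L x b))"
  unfolding L_def by (rule lev_limit[OF Ds_lstep])
lemma L_trans: "x \<in> U \<Longrightarrow> a \<in> Ord \<Longrightarrow> transitive (L x a)"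
  unfolding L_def using lev_trans_mono[OF Ds_lstep _ lstep_ok] by blast
lemma L_mono: "x \<in> U \<Longrightarrow> a \<in> Ord \<Longrightarrow> b \<in> el a \<or> b = a \<Longrightarrow> el (L x b) \<subseteq> el (L x a)"
  unfolding L_def by (rule lev_mono[OF Ds_lstep _ lstep_ok])

lemma L_level_L: "x \<in> U \<Longrightarrow> a \<in> Ord \<Longrightarrow> L_level x a (L x a)"
  unfolding L_level_def L_def
  by (intro bexI[of _ emp] conjI lev_level[OF Ds_lstep])
     (simp_all add: is_Def_def el_lstep)

text \<open>The definition of ordinals, variable \<open>0\<close> being transitive and linearly ordered by membership.\<close>

definition ord_fm :: fm where
  "ord_fm = Conj (Neg (Exists 1 (Exists 2 (Conj (Mem 1 0) (Conj (Mem 2 1) (Neg (Mem 2 0)))))))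
     (Neg (Exists 1 (Exists 2 (Conj (Mem 1 0) (Conj (Mem 2 0)
        (Conj (Neg (Mem 1 2)) (Conj (Neg (Equal 1 2)) (Neg (Mem 2 1)))))))))"

lemma sat_ord_fm:
  assumes A: "transitive A" and z: "z \<in> el A"
  shows "set_structure.sat (el A) mem ord_fm (\<lambda>n. if n = 0 then z else b) \<longleftrightarrow> z \<in> Ord"
proof -
  have zA: "el z \<subseteq> el A" using A z unfolding transitive_def by blast
  have yA: "el y \<subseteq> el A" if "y \<in> el A" for y using A that unfolding transitive_def by blast
  have "set_structure.sat (el A) mem ord_fm (\<lambda>n. if n = 0 then z else b) \<longleftrightarrow>
     (\<forall>y\<in>el A. \<forall>w\<in>el A. y \<in> el z \<longrightarrow> w \<in> el y \<longrightarrow> w \<in> el z) \<and>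
     (\<forall>y\<in>el A. \<forall>w\<in>el A. y \<in> el z \<longrightarrow> w \<in> el z \<longrightarrow> y \<in> el w \<or> y = w \<or> w \<in> el y)"
    unfolding ord_fm_def by (simp add: set_structure.sat.simps mem_iff cong: bex_cong)
  also have "\<dots> \<longleftrightarrow> z \<in> Ord"
  proof
    assume R: "(\<forall>y\<in>el A. \<forall>w\<in>el A. y \<in> el z \<longrightarrow> w \<in> el y \<longrightarrow> w \<in> el z) \<and>
     (\<forall>y\<in>el A. \<forall>w\<in>el A. y \<in> el z \<longrightarrow> w \<in> el z \<longrightarrow> y \<in> el w \<or> y = w \<or> w \<in> el y)"
    show "z \<in> Ord"
    proof (rule OrdI)
      show "z \<in> U" using z by simp
      show "u \<in> el z" if "u \<in> el y" "y \<in> el z" for u y using R that zA yA by blast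
      show "u \<in> el y \<or> u = y \<or> y \<in> el u" if "u \<in> el z" "y \<in> el z" for u y using R that zA by blast
    qed
  next
    assume "z \<in> Ord"
    then show "(\<forall>y\<in>el A. \<forall>w\<in>el A. y \<in> el z \<longrightarrow> w \<in> el y \<longrightarrow> w \<in> el z) \<and>
     (\<forall>y\<in>el A. \<forall>w\<in>el A. y \<in> el z \<longrightarrow> w \<in> el z \<longrightarrow> y \<in> el w \<or> y = w \<or> w \<in> el y)"
      using Ord_trans[of z] Ord_lin_in[of z] by blast
  qed
  finally show ?thesis .
qed

text \<open>At a successor step, \<open>b\<close> is the set of ordinals of \<open>L\<^sub>b[x]\<close> and hence definable over it, while an
  ordinal in \<open>L\<^bsub>b+1\<^esub>[x]\<close> is a subset of \<open>b\<close>.\<close>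

lemma L_ordinals:
  assumes x: "x \<in> U" and a: "a \<in> Ord" shows "el (L x a) \<inter> Ord = el a"
proof (rule Ord_induct[of "\<lambda>a. el (L x a) \<inter> Ord = el a", OF _ a])
  show "Dfb U (\<lambda>e. el (L x (e 0)) \<inter> Ord = el (e 0))" by (rule dfb dft_const_U[OF x])+
next
  fix a assume a: "a \<in> Ord" and IH: "\<And>c. c \<in> el a \<Longrightarrow> el (L x c) \<inter> Ord = el c"
  from Ord_cases[OF a] show "el (L x a) \<inter> Ord = el a"
  proof cases
    case 1 then show ?thesis by (simp add: L_emp[OF x])
  next
    case (2 b)
    note IHb = IH[OF 2(3)]
    have Lb: "L x b \<in> U" "transitive (L x b)" using x L_trans[OF x 2(1)] by auto
    have bL: "el b \<subseteq> el (L x b)" using IHb by blast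
    have "definable_subset (el (L x b)) (el x) b"
    proof (cases "el (L x b) = {}")
      case True
      then show ?thesis unfolding definable_subset_iff
        using bL Formula_intros(1)[OF emp_omega emp_omega] emp_As emp_omega by blast
    next
      case False
      then obtain d where d: "d \<in> el (L x b)" by blast
      show ?thesis
        by (rule definable_by_fm[OF Lb(1) x d bL, of ord_fm])
           (use sat_ord_fm[OF Lb(2)] IHb in blast)
    qed
    then have "b \<in> el (L x a)" using el_L_sc[OF x 2(1)] 2 by simp
    moreover have "el (L x b) \<subseteq> el (L x a)" using L_mono[OF x a] 2(3) by blast
    ultimately have 3: "el a \<subseteq> el (L x a) \<inter> Ord" using bL 2 Ord_elem[OF a] by auto
    have "z \<in> el a" if z: "z \<in> el (L x a)" "z \<in> Ord" for z
    proof -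
      have "el z \<subseteq> el (L x b)" using z(1) el_L_sc[OF x 2(1)] 2(2) unfolding definable_subset_def by auto
      then have "el z \<subseteq> el b" using IHb Ord_elem[OF z(2)] by blast
      then show ?thesis using Ord_le_iff[OF z(2) 2(1)] 2 by auto
    qed
    then show ?thesis using 3 by blast
  next
    case 3
    note e = el_L_limit[OF x Ord_U[OF a] 3]
    show ?thesis
    proof
      show "el (L x a) \<inter> Ord \<subseteq> el a"
      proof
        fix z assume "z \<in> el (L x a) \<inter> Ord"
        then obtain b where b: "b \<in> el a" "z \<in> el (L x b)" "z \<in> Ord" using e by blast
        then have "z \<in> el b" using IH[OF b(1)] by blast
        then show "z \<in> el a" using Ord_trans[OF a _ b(1)] by blast
      qed
      show "el a \<subseteq> el (L x a) \<inter> Ord"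
      proof
        fix z assume z: "z \<in> el a"
        have "sc z \<in> el a" by (rule limit_sc[OF Ord_U[OF a] 3 z])
        moreover have "z \<in> el (sc z)" using z by simp
        ultimately have "z \<in> el (L x (sc z))" "sc z \<in> el a" using IH by blast+
        then show "z \<in> el (L x a) \<inter> Ord" using e Ord_elem[OF a z] by blast
      qed
    qed
  qed
qed

lemma Ord_sub_L: "x \<in> U \<Longrightarrow> a \<in> Ord \<Longrightarrow> el a \<subseteq> el (L x a)" using L_ordinals by blast

section \<open>Upward absoluteness of existential formulas\<close>

definition dclosed :: "'a set \<Rightarrow> bool" where
  "dclosed S \<longleftrightarrow> (\<forall>i\<in>omega. \<forall>j\<in>omega. memc i j \<in> S \<and> eqc i j \<in> S \<and> predc i \<in> S) \<and>
     (\<forall>f\<in>S. negc f \<in> S) \<and> (\<forall>f\<in>S. \<forall>g\<in>S. conjc f g \<in> S) \<and>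
     (\<forall>i\<in>omega. \<forall>j\<in>omega. \<forall>f\<in>S. i \<noteq> j \<longrightarrow> exc i (conjc (memc i j) f) \<in> S)"

lemma Delta0_iff: "c \<in> Delta0 \<longleftrightarrow> c \<in> U \<and> (\<forall>S\<in>U. dclosed (el S) \<longrightarrow> c \<in> el S)"
  unfolding Delta0_def atomic_all dclosed_def
  using boolean_closed_iff[OF el_subset] bounded_ex_closed_iff[OF el_subset] by simp

lemma Sigma1_iff: "c \<in> Sigma1 \<longleftrightarrow> c \<in> U \<and>
    (\<forall>S\<in>U. Delta0 \<subseteq> el S \<and> (\<forall>i\<in>omega. \<forall>f\<in>el S. exc i f \<in> el S) \<longrightarrow> c \<in> el S)"
  unfolding Sigma1_def using ex_closed_iff[OF el_subset] by simp

lemma Delta0_sub: "Delta0 \<subseteq> Formula"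
proof
  fix c assume c: "c \<in> Delta0"
  have "dclosed (el (setof Formula))" unfolding el_setof[OF isset_Formula] dclosed_def
    by (simp add: Formula_intros)
  then have "c \<in> el (setof Formula)" using c Delta0_iff setof_U by blast
  then show "c \<in> Formula" by (simp add: el_setof)
qed

lemma Sigma1_sub: "Sigma1 \<subseteq> Formula"
proof
  fix c assume c: "c \<in> Sigma1"
  have "Delta0 \<subseteq> el (setof Formula) \<and> (\<forall>i\<in>omega. \<forall>f\<in>el (setof Formula). exc i f \<in> el (setof Formula))"
    unfolding el_setof[OF isset_Formula] using Delta0_sub Formula_intros(6) by blast
  then have "c \<in> el (setof Formula)" using c Sigma1_iff setof_U by blast
  then show "c \<in> Formula" by (simp add: el_setof)
qed

lemma As_mono: "el A \<subseteq> el B \<Longrightarrow> As A \<subseteq> As B"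
  unfolding assignments_def by blast

text \<open>A witness for a bounded quantifier belongs to a value of the assignment, so it lies in the smaller
  transitive structure already.\<close>

lemma Delta0_absolute:
  assumes A: "A \<in> U" "B \<in> U" "P \<in> U" "el A \<subseteq> el B" "transitive A" and c: "c \<in> Delta0" and e: "e \<in> As A"
  shows "Sat A P c e \<longleftrightarrow> Sat B P c e"
proof -
  define S where "S = {c \<in> Formula. \<forall>e\<in>As A. Sat A P c e \<longleftrightarrow> Sat B P c e}"
  have "isset S" unfolding S_def
    by (rule isset_sep[OF isset_Formula]) (rule dfb dft_const_U[OF A(1)] dft_const_U[OF A(2)] dft_const_U[OF A(3)])+
  then have S: "el (setof S) = S" by (rule el_setof)
  note SA = Sat_clause[OF A(1,3)] and SB = Sat_clause[OF A(2,3)]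
  have AB: "e \<in> As B" if "e \<in> As A" for e using As_mono[OF A(4)] that by blast
  have "dclosed S" unfolding dclosed_def
  proof (intro conjI ballI impI)
    fix i j assume "i \<in> omega" "j \<in> omega"
    then show "memc i j \<in> S" "eqc i j \<in> S" "predc i \<in> S"
      unfolding S_def by (simp_all add: Formula_intros SA SB AB)
  next
    fix f assume "f \<in> S"
    then show "negc f \<in> S" unfolding S_def by (simp add: Formula_intros SA SB AB)
  next
    fix f g assume "f \<in> S" "g \<in> S"
    then show "conjc f g \<in> S" unfolding S_def by (simp add: Formula_intros SA SB AB)
  next
    fix i j f assume i: "i \<in> omega" and j: "j \<in> omega" and f: "f \<in> S" and ij: "i \<noteq> j"
    have F: "f \<in> Formula" "\<And>e. e \<in> As A \<Longrightarrow> Sat A P f e \<longleftrightarrow> Sat B P f e" using f by (simp_all add: S_def)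
    have G: "conjc (memc i j) f \<in> Formula"
      by (rule Formula_intros(5)[OF Formula_intros(1)[OF i j] F(1)])
    have "Sat A P (exc i (conjc (memc i j) f)) e \<longleftrightarrow> Sat B P (exc i (conjc (memc i j) f)) e" if e: "e \<in> As A" for e
    proof -
      define M where "M a \<longleftrightarrow> (\<exists>u\<in>U. \<exists>v\<in>U. app (upd e i a) i u \<and> app (upd e i a) j v \<and> mem u v)" for a
      have a1: "Sat A P (conjc (memc i j) f) (upd e i a) \<longleftrightarrow> M a \<and> Sat B P f (upd e i a)" if a: "a \<in> el A" for a
        unfolding Sat_clause(5)[OF A(1,3) upd_As[OF e i a] Formula_intros(1)[OF i j] F(1)]
          Sat_clause(1)[OF A(1,3) upd_As[OF e i a] i j] F(2)[OF upd_As[OF e i a]] M_def by simp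
      have b1: "Sat B P (conjc (memc i j) f) (upd e i a) \<longleftrightarrow> M a \<and> Sat B P f (upd e i a)" if a: "a \<in> el B" for a
        unfolding Sat_clause(5)[OF A(2,3) upd_As[OF AB[OF e] i a] Formula_intros(1)[OF i j] F(1)]
          Sat_clause(1)[OF A(2,3) upd_As[OF AB[OF e] i a] i j] M_def by simp
      have aA: "a \<in> el A" if a: "a \<in> el B" "M a" for a
      proof -
        have U: "e \<in> U" "i \<in> U" "j \<in> U" "a \<in> U" using e i j a by auto
        obtain u v where uv: "u \<in> U" "v \<in> U" "app (upd e i a) i u" "app (upd e i a) j v" "mem u v"
          using a(2) unfolding M_def by blast
        have "u = a" using uv(3) app_upd[OF U(1,2,4,2) uv(1)] by simp
        moreover have "app e j v" using uv(4) app_upd[OF U(1,2,4,3) uv(2)] ij by simp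
        then have "v \<in> el A" using As_app[OF e U(3) uv(2)] by blast
        ultimately show ?thesis using transitiveD[OF A(5), of a v] uv(5) mem_iff[OF uv(1), of v] by simp
      qed
      have "Sat A P (exc i (conjc (memc i j) f)) e \<longleftrightarrow> (\<exists>a\<in>el A. M a \<and> Sat B P f (upd e i a))"
        unfolding Sat_clause(6)[OF A(1,3) e i G] using a1 by (simp cong: bex_cong)
      also have "\<dots> \<longleftrightarrow> (\<exists>a\<in>el B. M a \<and> Sat B P f (upd e i a))" using aA A(4) by blast
      also have "\<dots> \<longleftrightarrow> Sat B P (exc i (conjc (memc i j) f)) e"
        unfolding Sat_clause(6)[OF A(2,3) AB[OF e] i G] using b1 by (simp cong: bex_cong)
      finally show ?thesis .
    qed
    then show "exc i (conjc (memc i j) f) \<in> S" unfolding S_def using Formula_intros(6)[OF i G] by blast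
  qed
  then have "c \<in> S" using c Delta0_iff S setof_U by metis
  then show ?thesis using e by (simp add: S_def)
qed

lemma Sigma1_upward:
  assumes A: "A \<in> U" "B \<in> U" "P \<in> U" "el A \<subseteq> el B" "transitive A" and c: "c \<in> Sigma1"
    and e: "e \<in> As A" "Sat A P c e"
  shows "Sat B P c e"
proof -
  define S where "S = {c \<in> Formula. \<forall>e\<in>As A. Sat A P c e \<longrightarrow> Sat B P c e}"
  have "isset S" unfolding S_def
    by (rule isset_sep[OF isset_Formula]) (rule dfb dft_const_U[OF A(1)] dft_const_U[OF A(2)] dft_const_U[OF A(3)])+
  then have S: "el (setof S) = S" by (rule el_setof)
  have AB: "e \<in> As B" if "e \<in> As A" for e using As_mono[OF A(4)] that by blast
  have "Delta0 \<subseteq> S" unfolding S_def using Delta0_sub Delta0_absolute[OF A] by blast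
  moreover have "exc i f \<in> S" if i: "i \<in> omega" and f: "f \<in> S" for i f
  proof -
    have F: "f \<in> Formula" "\<And>e. e \<in> As A \<Longrightarrow> Sat A P f e \<Longrightarrow> Sat B P f e" using f by (simp_all add: S_def)
    have "Sat B P (exc i f) e" if e: "e \<in> As A" "Sat A P (exc i f) e" for e
    proof -
      obtain a where "a \<in> el A" "Sat A P f (upd e i a)"
        using e(2) Sat_clause(6)[OF A(1,3) e(1) i F(1)] by blast
      then have "a \<in> el B" "Sat B P f (upd e i a)" using F(2)[OF upd_As[OF e(1) i]] A(4) by blast+
      then show ?thesis using Sat_clause(6)[OF A(2,3) AB[OF e(1)] i F(1)] by blast
    qed
    then show ?thesis unfolding S_def using Formula_intros(6)[OF i F(1)] by blast
  qed
  ultimately have "c \<in> S" using c Sigma1_iff S setof_U by metis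
  then show ?thesis using e by (simp add: S_def)
qed

section \<open>Witnesses of inadmissibility\<close>

lemma dfb_cofinal_map[dfb]:
  "Dft C a \<Longrightarrow> Dft C b \<Longrightarrow> Dft C c \<Longrightarrow> Dfb C (\<lambda>e. cofinal_map (a e) (b e) (c e))"
  by (rule dfb_lift3[of C cofinal_map]) (unfold cofinal_map_def maps_def, (rule dfb)+)

text \<open>\<open>wit x a w\<close>: the tuple \<open>w\<close> shows that \<open>a\<close> is not \<open>x\<close>-admissible.  It consists of the domain \<open>d\<close> of a
  cofinal map, a \<open>\<Sigma>\<^sub>1\<close> definition \<open>c\<close> with parameters \<open>e\<close>, and the variables \<open>i\<close> and \<open>j\<close> for argument and value.
  The map itself is left out, so that \<open>w\<close> is built from elements of \<open>L\<^sub>a[x]\<close>.\<close>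

definition wtuple :: "'a \<Rightarrow> 'a \<Rightarrow> 'a \<Rightarrow> 'a \<Rightarrow> 'a \<Rightarrow> 'a" where
  "wtuple d c e i j = pair d (pair c (pair e (pair i j)))"

definition wit0 :: "'a \<Rightarrow> 'a \<Rightarrow> 'a \<Rightarrow> 'a \<Rightarrow> 'a \<Rightarrow> 'a \<Rightarrow> 'a \<Rightarrow> bool" where
  "wit0 x a d c e i j \<longleftrightarrow> (\<exists>f\<in>U. cofinal_map f d a \<and>
     (\<forall>u\<in>el (L x a). \<forall>v\<in>el (L x a). app f u v \<longleftrightarrow> Sat (L x a) x c (upd (upd e i u) j v)))"

definition wit :: "'a \<Rightarrow> 'a \<Rightarrow> 'a \<Rightarrow> bool" where
  "wit x a w \<longleftrightarrow> a \<in> Ord \<and> (\<exists>d\<in>el a. \<exists>c\<in>Sigma1. \<exists>e\<in>As (L x a). \<exists>i\<in>omega. \<exists>j\<in>omega.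
     w = wtuple d c e i j \<and> wit0 x a d c e i j)"

lemma dfb_wit[dfb]: "Dft C a \<Longrightarrow> Dft C b \<Longrightarrow> Dft C c \<Longrightarrow> Dfb C (\<lambda>e. wit (a e) (b e) (c e))"
  by (rule dfb_lift3[of C wit]) (unfold wit_def wit0_def wtuple_def, (rule dfb)+)

lemma wtuple_inject:
  "d \<in> U \<Longrightarrow> c \<in> U \<Longrightarrow> e \<in> U \<Longrightarrow> i \<in> U \<Longrightarrow> j \<in> U \<Longrightarrow> d' \<in> U \<Longrightarrow> c' \<in> U \<Longrightarrow> e' \<in> U \<Longrightarrow> i' \<in> U \<Longrightarrow> j' \<in> U \<Longrightarrow>
   wtuple d c e i j = wtuple d' c' e' i' j' \<Longrightarrow> d = d' \<and> c = c' \<and> e = e' \<and> i = i' \<and> j = j'"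
  unfolding wtuple_def by simp

lemma Sigma1_U: "c \<in> Sigma1 \<Longrightarrow> c \<in> U" using Sigma1_iff by blast

text \<open>A smaller ordinal with the same witness would bound the range of the cofinal map, because
  existential formulas persist from the smaller level to the larger one.\<close>

lemma wit0_not_less:
  assumes x: "x \<in> U" and a: "a \<in> Ord" and b: "b \<in> el a" and d: "d \<in> el b" and c: "c \<in> Sigma1"
    and e: "e \<in> As (L x b)" and i: "i \<in> omega" and j: "j \<in> omega"
    and wa: "wit0 x a d c e i j" and wb: "wit0 x b d c e i j"
  shows False
proof -
  have bO: "b \<in> Ord" by (rule Ord_elem[OF a b])
  obtain f where f: "cofinal_map f d a"
    "\<forall>u\<in>el (L x a). \<forall>v\<in>el (L x a). app f u v \<longleftrightarrow> Sat (L x a) x c (upd (upd e i u) j v)"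
    using wa unfolding wit0_def by blast
  obtain g where g: "cofinal_map g d b"
    "\<forall>u\<in>el (L x b). \<forall>v\<in>el (L x b). app g u v \<longleftrightarrow> Sat (L x b) x c (upd (upd e i u) j v)"
    using wb unfolding wit0_def by blast
  obtain u v where uv: "u \<in> el d" "v \<in> el a" "app f u v" "mem b v \<or> b = v"
    using f(1) b unfolding cofinal_map_def by blast
  obtain v' where v': "v' \<in> el b" "app g u v'" using g(1) uv(1) unfolding cofinal_map_def maps_def by blast
  have ub: "u \<in> el (L x b)" using Ord_trans[OF bO uv(1) d] Ord_sub_L[OF x bO] by blast
  have vb: "v' \<in> el (L x b)" using v'(1) Ord_sub_L[OF x bO] by blast
  have sub: "el (L x b) \<subseteq> el (L x a)" using L_mono[OF x a] b by blast
  have "Sat (L x b) x c (upd (upd e i u) j v')" using g(2) ub vb v'(2) by blast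
  then have "Sat (L x a) x c (upd (upd e i u) j v')"
    by (rule Sigma1_upward[OF L_U[OF x] L_U[OF x] x sub L_trans[OF x bO] c upd_As[OF upd_As[OF e i ub] j vb]])
  then have "app f u v'" using f(2) sub ub vb by blast
  moreover have "v' \<in> el a" using Ord_trans[OF a v'(1) b] .
  moreover have "\<exists>!w. w \<in> el a \<and> app f u w" using f(1) uv(1) unfolding cofinal_map_def maps_def by blast
  ultimately have "v' = v" using uv(2,3) by blast
  then show False using uv(4) v'(1) mem_iff[of b v] bO no_self no_cycle2 by auto
qed

lemma wit_unique:
  assumes x: "x \<in> U" and wa: "wit x a w" and wb: "wit x b w"
  shows "a = b"
proof -
  obtain d c e i j where A: "a \<in> Ord" "d \<in> el a" "c \<in> Sigma1" "e \<in> As (L x a)" "i \<in> omega" "j \<in> omega"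
    "w = wtuple d c e i j" "wit0 x a d c e i j" using wa unfolding wit_def by blast
  obtain d' c' e' i' j' where B: "b \<in> Ord" "d' \<in> el b" "c' \<in> Sigma1" "e' \<in> As (L x b)" "i' \<in> omega" "j' \<in> omega"
    "w = wtuple d' c' e' i' j'" "wit0 x b d' c' e' i' j'" using wb unfolding wit_def by blast
  have "d = d' \<and> c = c' \<and> e = e' \<and> i = i' \<and> j = j'"
    by (rule wtuple_inject[OF el_U[OF A(2)] Sigma1_U[OF A(3)] As_U[OF A(4)] omega_U[OF A(5)] omega_U[OF A(6)]
        el_U[OF B(2)] Sigma1_U[OF B(3)] As_U[OF B(4)] omega_U[OF B(5)] omega_U[OF B(6)]]) (use A(7) B(7) in simp)
  then have B': "d \<in> el b" "e \<in> As (L x b)" "wit0 x b d c e i j" using B by simp_all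
  have "b \<notin> el a" using wit0_not_less[OF x A(1) _ B'(1) A(3) B'(2) A(5,6,8) B'(3)] by blast
  moreover have "a \<notin> el b" using wit0_not_less[OF x B(1) _ A(2,3,4,5,6) B'(3) A(8)] by blast
  ultimately show ?thesis using Ord_linear[OF A(1) B(1)] by blast
qed

text \<open>The parameters can be restricted to a finite assignment; only those are generated from their values
  by adjoining one pair at a time.\<close>

lemma inadmissible_wit:
  assumes x: "x \<in> U" and a: "a \<in> Ord" "limit_ordinal a" "om \<in> el a" and na: "\<not> admissible x a"
  obtains d c e i j n where "d \<in> el a" "c \<in> Sigma1" "e \<in> As (L x a)" "i \<in> omega" "j \<in> omega" "n \<in> omega"
    "wit x a (wtuple d c (restr e n) i j)"
proof -
  have "\<exists>w\<in>el a. el w = omega" using a(3) el_om by blast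
  then obtain d f where f: "d \<in> el a" "f \<in> U" "cofinal_map f d a" "Sigma1_function (el (L x a)) (el x) f"
    using na a(2) L_level_L[OF x a(1)] L_U[OF x, of a] unfolding admissible_def by blast
  let ?A = "L x a"
  have A: "?A \<in> U" using x by simp
  obtain c e i j where c: "c \<in> Sigma1" "e \<in> As ?A" "i \<in> omega" "j \<in> omega"
    "\<forall>u\<in>el ?A. \<forall>v\<in>el ?A. app f u v \<longleftrightarrow>
      (\<exists>e'\<in>U. \<exists>e''\<in>U. update e i u e' \<and> update e' j v e'' \<and> satisfies (el ?A) (el x) c e'')"
    using f(4) unfolding Sigma1_function_def by blast
  have cF: "c \<in> Formula" using c(1) Sigma1_sub by blast
  obtain n where n: "n \<in> omega" "\<forall>e\<in>As ?A. \<forall>d\<in>As ?A. agree n e d \<longrightarrow> (Sat ?A x c e \<longleftrightarrow> Sat ?A x c d)"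
    using Sat_support[OF A x cF] by blast
  have U: "e \<in> U" "i \<in> U" "j \<in> U" "n \<in> U" using c n by simp_all
  have rA: "restr e n \<in> As ?A" by (rule restr_As[OF c(2) U(4)])
  have eq: "app f u v \<longleftrightarrow> Sat ?A x c (upd (upd (restr e n) i u) j v)" if u: "u \<in> el ?A" and v: "v \<in> el ?A" for u v
  proof -
    have uU: "u \<in> U" "v \<in> U" using u v by simp_all
    have "(\<exists>e'\<in>U. \<exists>e''\<in>U. update e i u e' \<and> update e' j v e'' \<and> satisfies (el ?A) (el x) c e'') \<longleftrightarrow>
        (\<exists>e''\<in>U. update (upd e i u) j v e'' \<and> satisfies (el ?A) (el x) c e'')"
      using update_iff[OF U(1,2) uU(1)] upd_U by blast
    also have "\<dots> \<longleftrightarrow> Sat ?A x c (upd (upd e i u) j v)" by (rule update_Sat[OF upd_U U(3) uU(2)])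
    also have "\<dots> \<longleftrightarrow> Sat ?A x c (upd (upd (restr e n) i u) j v)"
    proof -
      have "agree n (upd (upd e i u) j v) (upd (upd (restr e n) i u) j v)"
        by (intro agree_upd agree_restr upd_U U uU As_U[OF rA])
      then show ?thesis
        using n(2) upd_As[OF upd_As[OF c(2,3) u] c(4) v] upd_As[OF upd_As[OF rA c(3) u] c(4) v] by blast
    qed
    finally show ?thesis using c(5) u v by blast
  qed
  have "wit0 x a d c (restr e n) i j" unfolding wit0_def using f(2,3) eq by blast
  then have "wit x a (wtuple d c (restr e n) i j)" unfolding wit_def using a(1) f(1) c(1,3,4) rA by blast
  then show ?thesis using that f(1) c(1-4) n(1) by blast
qed

section \<open>A definable enumeration closed under the witnesses\<close>

text \<open>The three operations under which the enumeration below is closed: adjoining an element, the ordinal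
  named by a witness, and the subset of \<open>L\<^sub>b[y]\<close> defined by \<open>c\<close> with parameters \<open>e\<close> and variable \<open>i\<close>.\<close>

definition ins :: "'a \<Rightarrow> 'a \<Rightarrow> 'a" where "ins a b = setof (insert a (el b))"

definition wit_ord :: "'a \<Rightarrow> 'a \<Rightarrow> 'a" where "wit_ord y w = uniq (\<lambda>a. wit y a w)"

definition defset_rel :: "'a \<Rightarrow> 'a \<Rightarrow> 'a \<Rightarrow> bool" where
  "defset_rel y w X \<longleftrightarrow> (\<exists>b\<in>Ord. \<exists>c\<in>Formula. \<exists>e\<in>As (L y b). \<exists>i\<in>omega.
     w = pair b (pair c (pair e i)) \<and> el X = {a \<in> el (L y b). Sat (L y b) y c (upd e i a)})"

definition defset :: "'a \<Rightarrow> 'a \<Rightarrow> 'a" where "defset y w = uniq (defset_rel y w)"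

lemma dft_ins[dfb]: "Dft C a \<Longrightarrow> Dft C b \<Longrightarrow> Dft C (\<lambda>e. ins (a e) (b e))"
  by (rule dft_lift2[of C ins]) (unfold ins_def, (rule dfb)+)

lemma dft_wit_ord[dfb]: "Dft C a \<Longrightarrow> Dft C b \<Longrightarrow> Dft C (\<lambda>e. wit_ord (a e) (b e))"
  by (rule dft_lift2[of C wit_ord]) (unfold wit_ord_def, (rule dfb)+)

lemma dfb_defset_rel[dfb]: "Dft C a \<Longrightarrow> Dft C b \<Longrightarrow> Dft C c \<Longrightarrow> Dfb C (\<lambda>e. defset_rel (a e) (b e) (c e))"
  by (rule dfb_lift3[of C defset_rel]) (unfold defset_rel_def, (rule dfb)+)

lemma dft_defset[dfb]: "Dft C a \<Longrightarrow> Dft C b \<Longrightarrow> Dft C (\<lambda>e. defset (a e) (b e))"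
  by (rule dft_lift2[of C defset]) (unfold defset_def, (rule dfb)+)

lemma ins_U[simp, intro]: "ins a b \<in> U" by (simp add: ins_def)
lemma el_ins: "a \<in> U \<Longrightarrow> b \<in> U \<Longrightarrow> el (ins a b) = insert a (el b)"
  unfolding ins_def by (rule el_setof[OF isset_insert[OF _ isset_el]])

definition enum_rel :: "'a \<Rightarrow> 'a \<Rightarrow> 'a \<Rightarrow> 'a \<Rightarrow> bool" where
  "enum_rel t \<xi> h v \<longleftrightarrow> (\<xi> = emp \<and> v = psnd t) \<or>
     (\<exists>a\<in>Ord. \<xi> = cp (num 1) a \<and> v = a) \<or>
     (\<exists>a\<in>Ord. \<exists>b\<in>Ord. \<xi> = cp (num 2) (cp a b) \<and> v = ins (fn h a) (fn h b)) \<or>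
     (\<exists>a\<in>Ord. \<xi> = cp (num 3) a \<and> v = wit_ord (pfst t) (fn h a)) \<or>
     (\<exists>a\<in>Ord. \<xi> = cp (num 4) a \<and> v = defset (pfst t) (fn h a))"

definition enum_step :: "'a \<Rightarrow> 'a \<Rightarrow> 'a \<Rightarrow> 'a" where "enum_step t \<xi> h = uniq (enum_rel t \<xi> h)"

text \<open>\<open>enum y p\<close> enumerates along the ordinals the least class that contains \<open>p\<close> and the ordinals and is
  closed under the operations \<open>ins\<close>, \<open>wit_ord y\<close> and \<open>defset y\<close>: an index codes the operation and the
  indices of its arguments.\<close>

definition enum :: "'a \<Rightarrow> 'a \<Rightarrow> 'a \<Rightarrow> 'a" where "enum y p = rec enum_step (pair y p)"

lemma Dg_enum_step: "Dg C enum_step"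
  unfolding Dg_def enum_step_def enum_rel_def by (intro allI) (rule dfb)+

lemma dft_enum[dfb]: "Dft C a \<Longrightarrow> Dft C b \<Longrightarrow> Dft C c \<Longrightarrow> Dft C (\<lambda>e. enum (a e) (b e) (c e))"
  unfolding enum_def by (rule dft_rec[OF Dg_enum_step] dfb | assumption)+

lemma enum_U[simp, intro]: "enum y p a \<in> U" unfolding enum_def by (rule rec_U[OF Dg_enum_step pair_U])

lemma cp_eq_iff: "a \<in> Ord \<Longrightarrow> b \<in> Ord \<Longrightarrow> c \<in> Ord \<Longrightarrow> d \<in> Ord \<Longrightarrow> cp a b = cp c d \<longleftrightarrow> a = c \<and> b = d"
  using cp_inject by blast

lemma cp_not_emp: "a \<in> Ord \<Longrightarrow> b \<in> Ord \<Longrightarrow> cp a b \<noteq> emp"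
  using cp_gt(1)[of a b] by auto

lemma num_Ord[simp, intro]: "num k \<in> Ord" using omega_Ord num_omega by blast

lemma enum_rel_simps:
  "enum_rel t emp h v \<longleftrightarrow> v = psnd t"
  "a \<in> Ord \<Longrightarrow> enum_rel t (cp (num 1) a) h v \<longleftrightarrow> v = a"
  "a \<in> Ord \<Longrightarrow> b \<in> Ord \<Longrightarrow> enum_rel t (cp (num 2) (cp a b)) h v \<longleftrightarrow> v = ins (fn h a) (fn h b)"
  "a \<in> Ord \<Longrightarrow> enum_rel t (cp (num 3) a) h v \<longleftrightarrow> v = wit_ord (pfst t) (fn h a)"
  "a \<in> Ord \<Longrightarrow> enum_rel t (cp (num 4) a) h v \<longleftrightarrow> v = defset (pfst t) (fn h a)"
proof -
  have e: "a \<in> Ord \<Longrightarrow> b \<in> Ord \<Longrightarrow> emp = cp a b \<longleftrightarrow> False" for a b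
    using cp_not_emp[of a b] by metis
  note eqs = cp_eq_iff cp_not_emp e
  show "enum_rel t emp h v \<longleftrightarrow> v = psnd t"
    unfolding enum_rel_def by (simp add: eqs cong: bex_cong conj_cong del: num.simps One_nat_def)
  show "enum_rel t (cp (num 1) a) h v \<longleftrightarrow> v = a" if "a \<in> Ord" for a
    unfolding enum_rel_def using that by (simp add: eqs cong: bex_cong conj_cong del: num.simps One_nat_def)
  show "enum_rel t (cp (num 2) (cp a b)) h v \<longleftrightarrow> v = ins (fn h a) (fn h b)" if "a \<in> Ord" "b \<in> Ord" for a b
    unfolding enum_rel_def using that by (simp add: eqs cong: bex_cong conj_cong del: num.simps One_nat_def)
  show "enum_rel t (cp (num 3) a) h v \<longleftrightarrow> v = wit_ord (pfst t) (fn h a)" if "a \<in> Ord" for a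
    unfolding enum_rel_def using that by (simp add: eqs cong: bex_cong conj_cong del: num.simps One_nat_def)
  show "enum_rel t (cp (num 4) a) h v \<longleftrightarrow> v = defset (pfst t) (fn h a)" if "a \<in> Ord" for a
    unfolding enum_rel_def using that by (simp add: eqs cong: bex_cong conj_cong del: num.simps One_nat_def)
qed

lemma enum_eq:
  assumes "\<xi> \<in> Ord" "v \<in> U" "\<And>u. enum_rel (pair y p) \<xi> (lam (el \<xi>) (enum y p)) u \<longleftrightarrow> u = v"
  shows "enum y p \<xi> = v"
proof -
  have "enum y p \<xi> = enum_step (pair y p) \<xi> (lam (el \<xi>) (enum y p))"
    unfolding enum_def by (rule rec_eq[OF Dg_enum_step pair_U assms(1)])
  also have "\<dots> = v" unfolding enum_step_def by (rule uniq_eq) (use assms in auto)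
  finally show ?thesis .
qed

lemma fn_enum: "\<xi> \<in> Ord \<Longrightarrow> a \<in> el \<xi> \<Longrightarrow> fn (lam (el \<xi>) (enum y p)) a = enum y p a"
  unfolding enum_def by (rule fn_rec[OF Dg_enum_step pair_U])

lemma enum_emp: "y \<in> U \<Longrightarrow> p \<in> U \<Longrightarrow> enum y p emp = p"
  by (rule enum_eq) (simp_all add: enum_rel_simps)

lemma enum_leaf: "a \<in> Ord \<Longrightarrow> enum y p (cp (num 1) a) = a"
  by (rule enum_eq) (simp_all only: enum_rel_simps Ord_U cp_Ord num_Ord)

lemma enum_ins: "a \<in> Ord \<Longrightarrow> b \<in> Ord \<Longrightarrow> enum y p (cp (num 2) (cp a b)) = ins (enum y p a) (enum y p b)"
proof (rule enum_eq)
  assume a: "a \<in> Ord" and b: "b \<in> Ord"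
  let ?x = "cp (num 2) (cp a b)"
  show x: "?x \<in> Ord" using a b by simp
  have c: "cp a b \<in> el ?x" using cp_gt(2)[of "num 2" "cp a b"] a b by simp
  have "a \<in> el ?x" "b \<in> el ?x" using Ord_trans[OF x _ c] cp_gt[OF a b] by blast+
  then show "enum_rel (pair y p) ?x (lam (el ?x) (enum y p)) u \<longleftrightarrow> u = ins (enum y p a) (enum y p b)" for u
    unfolding enum_rel_simps(3)[OF a b] by (simp only: fn_enum[OF x])
qed simp

lemma enum_N: "y \<in> U \<Longrightarrow> p \<in> U \<Longrightarrow> a \<in> Ord \<Longrightarrow> enum y p (cp (num 3) a) = wit_ord y (enum y p a)"
proof (rule enum_eq)
  assume y: "y \<in> U" "p \<in> U" and a: "a \<in> Ord"
  let ?x = "cp (num 3) a"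
  show x: "?x \<in> Ord" using a by simp
  have "a \<in> el ?x" using cp_gt(2)[of "num 3" a] a by simp
  then show "enum_rel (pair y p) ?x (lam (el ?x) (enum y p)) u \<longleftrightarrow> u = wit_ord y (enum y p a)" for u
    unfolding enum_rel_simps(4)[OF a] by (simp only: fn_enum[OF x] pfst_pair[OF y])
qed (simp add: wit_ord_def)

lemma enum_X: "y \<in> U \<Longrightarrow> p \<in> U \<Longrightarrow> a \<in> Ord \<Longrightarrow> enum y p (cp (num 4) a) = defset y (enum y p a)"
proof (rule enum_eq)
  assume y: "y \<in> U" "p \<in> U" and a: "a \<in> Ord"
  let ?x = "cp (num 4) a"
  show x: "?x \<in> Ord" using a by simp
  have "a \<in> el ?x" using cp_gt(2)[of "num 4" a] a by simp
  then show "enum_rel (pair y p) ?x (lam (el ?x) (enum y p)) u \<longleftrightarrow> u = defset y (enum y p a)" for u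
    unfolding enum_rel_simps(5)[OF a] by (simp only: fn_enum[OF x] pfst_pair[OF y])
qed (simp add: defset_def)

definition cpclosed :: "'a \<Rightarrow> bool" where
  "cpclosed \<gamma> \<longleftrightarrow> \<gamma> \<in> Ord \<and> limit_ordinal \<gamma> \<and> om \<in> el \<gamma> \<and> (\<forall>a\<in>el \<gamma>. \<forall>b\<in>el \<gamma>. cp a b \<in> el \<gamma>)"

definition hull :: "'a \<Rightarrow> 'a \<Rightarrow> 'a set" where "hull y \<gamma> = enum y \<gamma> ` el \<gamma>"

lemma dfc_hull[dfb]: "Dft C a \<Longrightarrow> Dft C b \<Longrightarrow> Dfc C (\<lambda>e. hull (a e) (b e))"
proof -
  assume "Dft C a" "Dft C b"
  then have "Dfc C (\<lambda>e. {z \<in> U. \<exists>u\<in>el (b e). z = enum (a e) (b e) u})"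
    by - (rule dfb dft_shift | assumption)+
  moreover have "{z \<in> U. \<exists>u\<in>el (b e). z = enum (a e) (b e) u} = hull (a e) (b e)" for e
    unfolding hull_def by auto
  ultimately show ?thesis by simp
qed

lemma hull_closed:
  assumes y: "y \<in> U" and g: "cpclosed \<gamma>"
  shows "\<gamma> \<in> hull y \<gamma>" "\<And>a. a \<in> el \<gamma> \<Longrightarrow> a \<in> hull y \<gamma>"
    "\<And>u v. u \<in> hull y \<gamma> \<Longrightarrow> v \<in> hull y \<gamma> \<Longrightarrow> ins u v \<in> hull y \<gamma>"
    "\<And>u. u \<in> hull y \<gamma> \<Longrightarrow> wit_ord y u \<in> hull y \<gamma>" "\<And>u. u \<in> hull y \<gamma> \<Longrightarrow> defset y u \<in> hull y \<gamma>"
proof -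
  have gO: "\<gamma> \<in> Ord" and gl: "limit_ordinal \<gamma>" and go: "om \<in> el \<gamma>"
    and cl: "\<And>a b. a \<in> el \<gamma> \<Longrightarrow> b \<in> el \<gamma> \<Longrightarrow> cp a b \<in> el \<gamma>" using g unfolding cpclosed_def by auto
  have gU: "\<gamma> \<in> U" using gO by simp
  have O: "a \<in> Ord" if "a \<in> el \<gamma>" for a by (rule Ord_elem[OF gO that])
  have n: "num k \<in> el \<gamma>" for k using Ord_trans[OF gO _ go, of "num k"] by simp
  show "\<gamma> \<in> hull y \<gamma>" unfolding hull_def using enum_emp[OF y gU] limit_nonempty[OF gU gl] by (metis image_eqI)
  show "a \<in> hull y \<gamma>" if "a \<in> el \<gamma>" for a
    unfolding hull_def using enum_leaf[OF O[OF that], of y \<gamma>] cl[OF n that] by (metis image_eqI)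
  show "ins u v \<in> hull y \<gamma>" if uv: "u \<in> hull y \<gamma>" "v \<in> hull y \<gamma>" for u v
  proof -
    obtain a b where ab: "a \<in> el \<gamma>" "b \<in> el \<gamma>" "u = enum y \<gamma> a" "v = enum y \<gamma> b" using uv unfolding hull_def by blast
    show ?thesis unfolding hull_def ab(3,4)
      by (rule image_eqI[where x = "cp (num 2) (cp a b)"],
          rule enum_ins[OF O[OF ab(1)] O[OF ab(2)], symmetric], rule cl[OF n cl[OF ab(1,2)]])
  qed
  show "wit_ord y u \<in> hull y \<gamma>" if u: "u \<in> hull y \<gamma>" for u
  proof -
    obtain a where a: "a \<in> el \<gamma>" "u = enum y \<gamma> a" using u unfolding hull_def by blast
    show ?thesis unfolding hull_def a(2)
      by (rule image_eqI[where x = "cp (num 3) a"],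
          rule enum_N[OF y gU O[OF a(1)], symmetric], rule cl[OF n a(1)])
  qed
  show "defset y u \<in> hull y \<gamma>" if u: "u \<in> hull y \<gamma>" for u
  proof -
    obtain a where a: "a \<in> el \<gamma>" "u = enum y \<gamma> a" using u unfolding hull_def by blast
    show ?thesis unfolding hull_def a(2)
      by (rule image_eqI[where x = "cp (num 4) a"],
          rule enum_X[OF y gU O[OF a(1)], symmetric], rule cl[OF n a(1)])
  qed
qed

text \<open>Pairs, and with them codes of formulas and finite assignments, arise by adjoining elements.\<close>

lemma hull_pair:
  assumes y: "y \<in> U" and g: "cpclosed \<gamma>" and ab: "a \<in> hull y \<gamma>" "b \<in> hull y \<gamma>"
  shows "pair a b \<in> hull y \<gamma>"
proof -
  note C = hull_closed[OF y g]
  have U: "a \<in> U" "b \<in> U" using ab by (auto simp: hull_def)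
  have emp: "emp \<in> hull y \<gamma>" using C(2) g limit_nonempty[of \<gamma>] unfolding cpclosed_def by auto
  have sing: "ins u emp = setof {u}" if "u \<in> U" for u
    by (rule el_ext) (use that in \<open>simp_all add: el_ins el_setof isset_single\<close>)
  have dbl: "ins u (ins v emp) = setof {u, v}" if "u \<in> U" "v \<in> U" for u v
    by (rule el_ext) (use that in \<open>simp_all add: el_ins el_setof isset_pair\<close>)
  have 1: "setof {a} \<in> hull y \<gamma>" using C(3)[OF ab(1) emp] sing[OF U(1)] by simp
  have 2: "setof {a, b} \<in> hull y \<gamma>" using C(3)[OF ab(1) C(3)[OF ab(2) emp]] dbl[OF U] by simp
  show ?thesis unfolding pair_def using C(3)[OF 1 C(3)[OF 2 emp]] dbl[of "setof {a}" "setof {a, b}"] by simp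
qed

lemma hull_omega: "y \<in> U \<Longrightarrow> cpclosed \<gamma> \<Longrightarrow> n \<in> omega \<Longrightarrow> n \<in> hull y \<gamma>"
  using hull_closed(2)[of y \<gamma> n] Ord_trans[of \<gamma> n om] unfolding cpclosed_def by simp

lemma hull_Formula:
  assumes y: "y \<in> U" and g: "cpclosed \<gamma>" and c: "c \<in> Formula"
  shows "c \<in> hull y \<gamma>"
proof -
  have gU: "\<gamma> \<in> U" using g unfolding cpclosed_def by simp
  note P = hull_pair[OF y g] and O = hull_omega[OF y g]
  have n: "num k \<in> hull y \<gamma>" for k by (rule O) simp
  show ?thesis
  proof (rule Formula_induct[of "\<lambda>c. c \<in> hull y \<gamma>", OF _ c])
    show "Dfb U (\<lambda>e. e 0 \<in> hull y \<gamma>)" by (rule dfb dft_const_U[OF y] dft_const_U[OF gU])+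
  qed (unfold code_defs, (intro P n; (assumption | rule O, assumption))+)
qed

lemma hull_restr:
  assumes y: "y \<in> U" and g: "cpclosed \<gamma>" and e: "e \<in> As A" and A: "el A \<subseteq> hull y \<gamma>" and n: "n \<in> omega"
  shows "restr e n \<in> hull y \<gamma>"
proof -
  have gU: "\<gamma> \<in> U" using g unfolding cpclosed_def by simp
  have eU: "e \<in> U" using e by simp
  have emp: "emp \<in> hull y \<gamma>" by (rule hull_omega[OF y g emp_omega])
  have rU: "restr e n \<in> U" for n by (simp add: restr_def)
  show ?thesis
  proof (rule omega_induct[of "\<lambda>n. restr e n \<in> hull y \<gamma>", OF _ n])
    show "Dfb U (\<lambda>n. restr e (n 0) \<in> hull y \<gamma>)" by (rule dfb dft_const_U[OF y] dft_const_U[OF gU] dft_const_U[OF eU])+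
    have "restr e emp = emp" by (rule el_ext) (simp_all add: rU el_restr[OF eU])
    then show "restr e emp \<in> hull y \<gamma>" using emp by simp
    fix m assume m: "m \<in> omega" and IH: "restr e m \<in> hull y \<gamma>"
    have mU: "m \<in> U" using m by simp
    show "restr e (sc m) \<in> hull y \<gamma>"
    proof (cases "\<exists>a\<in>U. pair m a \<in> el e")
      case False
      then have "restr e (sc m) = restr e m"
        by (intro el_ext rU) (auto simp: el_restr[OF eU] mU)
      then show ?thesis using IH by simp
    next
      case True
      then obtain a where a: "a \<in> U" "pair m a \<in> el e" by blast
      have ap: "app e m a" using a app_iff[OF eU mU] by blast
      have aA: "a \<in> el A" using As_app[OF e mU a(1) ap] by blast
      have u: "b = a" if "b \<in> U" "pair m b \<in> el e" for b
        using As_fun[OF e mU that(1) a(1) _ ap] that app_iff[OF eU mU that(1)] by blast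
      have "restr e (sc m) = ins (pair m a) (restr e m)"
      proof (rule el_ext[OF rU ins_U])
        show "el (restr e (sc m)) = el (ins (pair m a) (restr e m))"
          unfolding el_ins[OF pair_U rU] el_restr[OF eU sc_U] el_restr[OF eU mU] el_sc[OF mU]
          using a u by blast
      qed
      moreover have "pair m a \<in> hull y \<gamma>" by (rule hull_pair[OF y g hull_omega[OF y g m]]) (use aA A in blast)
      ultimately show ?thesis using hull_closed(3)[OF y g _ IH] by simp
    qed
  qed
qed

text \<open>Inadmissibility in the form in which it is used: there is a witness with finite parameters.\<close>

definition inadm :: "'a \<Rightarrow> 'a \<Rightarrow> bool" where
  "inadm x a \<longleftrightarrow> (\<exists>d\<in>el a. \<exists>c\<in>Sigma1. \<exists>e\<in>As (L x a). \<exists>i\<in>omega. \<exists>j\<in>omega. \<exists>n\<in>omega.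
     wit x a (wtuple d c (restr e n) i j))"

lemma dfb_inadm[dfb]: "Dft C a \<Longrightarrow> Dft C b \<Longrightarrow> Dfb C (\<lambda>e. inadm (a e) (b e))"
  by (rule dfb_lift2[of C inadm]) (unfold inadm_def wtuple_def, (rule dfb)+)

lemma admissibleI:
  assumes "x \<in> U" "a \<in> Ord" "limit_ordinal a" "om \<in> el a" "\<not> inadm x a" shows "admissible x a"
proof (rule ccontr)
  assume n: "\<not> admissible x a"
  obtain d c e i j n where w: "d \<in> el a" "c \<in> Sigma1" "e \<in> As (L x a)" "i \<in> omega" "j \<in> omega" "n \<in> omega"
    "wit x a (wtuple d c (restr e n) i j)"
    by (rule inadmissible_wit[OF assms(1-4) n], rule that)
  have "inadm x a" unfolding inadm_def
    by (rule bexI[OF _ w(1)], rule bexI[OF _ w(2)], rule bexI[OF _ w(3)], rule bexI[OF _ w(4)],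
        rule bexI[OF _ w(5)], rule bexI[OF _ w(6)], rule w(7))
  with assms(5) show False by blast
qed

text \<open>Induction on \<open>a\<close>.  A limit ordinal above \<open>\<gamma>\<close> is named by a witness whose entries lie in the closure by
  the induction hypothesis, and an element of \<open>L\<^bsub>b+1\<^esub>[x]\<close> is given by a definition over \<open>L\<^sub>b[x]\<close> with parameters
  in the closure.\<close>

lemma hull_captures:
  assumes x: "x \<in> U" and g: "cpclosed \<gamma>" and a: "a \<in> Ord"
    and inadm: "\<forall>b\<in>insert a (el a). limit_ordinal b \<and> \<gamma> \<in> el b \<longrightarrow> inadm x b"
  shows "a \<in> hull x \<gamma> \<and> el (L x a) \<subseteq> hull x \<gamma>"
proof -
  have gO: "\<gamma> \<in> Ord" and gU: "\<gamma> \<in> U" using g unfolding cpclosed_def by simp_all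
  note C = hull_closed[OF x g] and P = hull_pair[OF x g] and O = hull_omega[OF x g] and F = hull_Formula[OF x g]
  have "(\<forall>b\<in>insert a (el a). limit_ordinal b \<and> \<gamma> \<in> el b \<longrightarrow> inadm x b) \<longrightarrow> a \<in> hull x \<gamma> \<and> el (L x a) \<subseteq> hull x \<gamma>"
  proof (rule Ord_induct[of "\<lambda>a. (\<forall>b\<in>insert a (el a). limit_ordinal b \<and> \<gamma> \<in> el b \<longrightarrow> inadm x b) \<longrightarrow>
      a \<in> hull x \<gamma> \<and> el (L x a) \<subseteq> hull x \<gamma>", OF _ a])
    show "Dfb U (\<lambda>e. (\<forall>b\<in>insert (e 0) (el (e 0)). limit_ordinal b \<and> \<gamma> \<in> el b \<longrightarrow> inadm x b) \<longrightarrow>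
      e 0 \<in> hull x \<gamma> \<and> el (L x (e 0)) \<subseteq> hull x \<gamma>)"
      by (rule dfb dft_const_U[OF x] dft_const_U[OF gU])+
  next
    fix a assume a: "a \<in> Ord" and IH0: "\<And>c. c \<in> el a \<Longrightarrow>
      (\<forall>b\<in>insert c (el c). limit_ordinal b \<and> \<gamma> \<in> el b \<longrightarrow> inadm x b) \<longrightarrow> c \<in> hull x \<gamma> \<and> el (L x c) \<subseteq> hull x \<gamma>"
    show "(\<forall>b\<in>insert a (el a). limit_ordinal b \<and> \<gamma> \<in> el b \<longrightarrow> inadm x b) \<longrightarrow> a \<in> hull x \<gamma> \<and> el (L x a) \<subseteq> hull x \<gamma>"
    proof
      assume inadm: "\<forall>b\<in>insert a (el a). limit_ordinal b \<and> \<gamma> \<in> el b \<longrightarrow> inadm x b"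
      have IH: "c \<in> hull x \<gamma> \<and> el (L x c) \<subseteq> hull x \<gamma>" if c: "c \<in> el a" for c
      proof -
        have "insert c (el c) \<subseteq> insert a (el a)" using Ord_trans[OF a _ c] c by blast
        then show ?thesis using IH0[OF c] inadm by blast
      qed
      have Lsub: "el (L x a) \<subseteq> hull x \<gamma>"
      proof (cases rule: Ord_cases[OF a])
        case 1 then show ?thesis by (simp add: L_emp[OF x])
      next
        case (2 b)
        note IHb = IH[OF 2(3)]
        have A: "L x b \<in> U" using x by simp
        show ?thesis
        proof
          fix X assume X: "X \<in> el (L x a)"
          then have XU: "X \<in> U" by simp
          have "definable_subset (el (L x b)) (el x) X" using X el_L_sc[OF x 2(1)] 2(2) by simp
          then obtain c e i where c: "el X \<subseteq> el (L x b)" "c \<in> Formula" "e \<in> As (L x b)" "i \<in> omega"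
            "\<forall>a\<in>el (L x b). a \<in> el X \<longleftrightarrow> Sat (L x b) x c (upd e i a)"
            unfolding definable_subset_iff by blast
          obtain n where n: "n \<in> omega" "\<forall>e\<in>As (L x b). \<forall>d\<in>As (L x b). agree n e d \<longrightarrow>
              (Sat (L x b) x c e \<longleftrightarrow> Sat (L x b) x c d)"
            using Sat_support[OF A x c(2)] by blast
          have U: "e \<in> U" "n \<in> U" "i \<in> U" using c n by simp_all
          let ?e = "restr e n"
          have rA: "?e \<in> As (L x b)" by (rule restr_As[OF c(3) U(2)])
          have "Sat (L x b) x c (upd e i a) \<longleftrightarrow> Sat (L x b) x c (upd ?e i a)" if a: "a \<in> el (L x b)" for a
          proof -
            have "agree n (upd e i a) (upd ?e i a)"
              by (rule agree_upd[OF U(1) As_U[OF rA] U(3) el_U[OF a] agree_restr[OF U(1,2)]])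
            then show ?thesis using n(2) upd_As[OF c(3,4) a] upd_As[OF rA c(4) a] by blast
          qed
          then have eX: "el X = {a \<in> el (L x b). Sat (L x b) x c (upd ?e i a)}" using c(1,5) by blast
          let ?w = "pair b (pair c (pair ?e i))"
          have "defset x ?w = X" unfolding defset_def
          proof (rule uniq_eq[OF XU])
            show "defset_rel x ?w X" unfolding defset_rel_def using 2(1) c(2,4) rA eX by blast
            fix Y assume Y: "Y \<in> U" "defset_rel x ?w Y"
            then obtain b' c' e' i' where w: "b' \<in> Ord" "c' \<in> Formula" "e' \<in> As (L x b')" "i' \<in> omega"
              "?w = pair b' (pair c' (pair e' i'))"
              "el Y = {a \<in> el (L x b'). Sat (L x b') x c' (upd e' i' a)}" unfolding defset_rel_def by blast
            have "b = b' \<and> c = c' \<and> ?e = e' \<and> i = i'"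
              using w(5) 2(1) c(2) w(1,2) As_U[OF rA] As_U[OF w(3)] U(3) omega_U[OF w(4)] by simp
            then have "el Y = el X" using w(6) eX by simp
            then show "Y = X" by (rule el_ext[OF Y(1) XU])
          qed
          moreover have "?w \<in> hull x \<gamma>"
            by (intro P) (use IHb F[OF c(2)] hull_restr[OF x g c(3) _ n(1)] O[OF c(4)] in blast)+
          ultimately show "X \<in> hull x \<gamma>" using C(5)[of ?w] by simp
        qed
      next
        case 3
        show ?thesis unfolding el_L_limit[OF x Ord_U[OF a] 3] using IH by blast
      qed
      have "a \<in> hull x \<gamma>"
      proof -
        consider "a \<in> el \<gamma>" | "a = \<gamma>" | "\<gamma> \<in> el a" using Ord_linear[OF a gO] by blast
        then show ?thesis
        proof cases
          case 1 then show ?thesis by (rule C(2))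
        next
          case 2 then show ?thesis using C(1) by simp
        next
          case g3: 3
          show ?thesis
          proof (cases rule: Ord_cases[OF a])
            case 1 then show ?thesis using g3 by simp
          next
            case (2 b)
            have bU: "b \<in> U" using 2 by simp
            have "sc b = ins b b" by (rule el_ext) (simp_all add: bU el_ins)
            then show ?thesis using C(3)[of b b] IH[OF 2(3)] 2(2) by simp
          next
            case 3
            then have "inadm x a" using inadm g3 by blast
            then obtain d c e i j n where w: "d \<in> el a" "c \<in> Sigma1" "e \<in> As (L x a)" "i \<in> omega" "j \<in> omega"
              "n \<in> omega" "wit x a (wtuple d c (restr e n) i j)" unfolding inadm_def by blast
            let ?w = "wtuple d c (restr e n) i j"
            have "wit_ord x ?w = a" unfolding wit_ord_def
              by (rule uniq_eq, rule Ord_U[OF a], rule w(7), rule wit_unique[OF x _ w(7)])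
            moreover have "?w \<in> hull x \<gamma>" unfolding wtuple_def
              by (intro P) (use IH[OF w(1)] F[OF subsetD[OF Sigma1_sub w(2)]] hull_restr[OF x g w(3) Lsub w(6)] O[OF w(4)] O[OF w(5)] in blast)+
            ultimately show ?thesis using C(4)[of ?w] by simp
          qed
        qed
      qed
      with Lsub show "a \<in> hull x \<gamma> \<and> el (L x a) \<subseteq> hull x \<gamma>" by blast
    qed
  qed
  then show ?thesis using inadm by blast
qed

lemma admissible_in_hull:
  assumes x: "x \<in> U" and g: "cpclosed \<gamma>"
  obtains \<mu> where "\<mu> \<in> Ord" "admissible x \<mu>" "\<gamma> \<in> el \<mu>" "el \<mu> \<subseteq> hull x \<gamma>"
proof -
  have gO: "\<gamma> \<in> Ord" and gU: "\<gamma> \<in> U" and go: "om \<in> el \<gamma>" using g unfolding cpclosed_def by simp_all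
  \<comment> \<open>if there were no such ordinal, every ordinal would belong to the closure, which is a set\<close>
  define M where "M b \<longleftrightarrow> limit_ordinal b \<and> \<gamma> \<in> el b \<and> \<not> inadm x b" for b
  have dM: "Dfb U (\<lambda>e. M (e 0))" unfolding M_def by (rule dfb dft_const_U[OF x] dft_const_U[OF gU])+
  have "isset (hull x \<gamma>)" unfolding hull_def
    by (rule isset_image[OF isset_el[OF gU]]) (rule dfb dft_const_U[OF x] dft_const_U[OF gU])+
  then have "\<not> Ord \<subseteq> hull x \<gamma>" by (rule Ord_not_set)
  then obtain a where a: "a \<in> Ord" "a \<notin> hull x \<gamma>" by blast
  then obtain b where b: "b \<in> insert a (el a)" "M b" using hull_captures[OF x g a(1)] unfolding M_def by blast
  then have bO: "b \<in> Ord" using a Ord_elem[OF a(1)] by blast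
  obtain \<mu> where \<mu>: "\<mu> \<in> Ord" "M \<mu>" "\<And>c. c \<in> el \<mu> \<Longrightarrow> \<not> M c" by (rule Ord_least[OF dM bO b(2)], rule that)
  have "om \<in> el \<mu>" using \<mu>(2) Ord_trans[OF \<mu>(1) go] unfolding M_def by blast
  then have "admissible x \<mu>" using admissibleI[OF x \<mu>(1)] \<mu>(2) unfolding M_def by blast
  moreover have "el \<mu> \<subseteq> hull x \<gamma>"
  proof
    fix c assume c: "c \<in> el \<mu>"
    have "\<not> M b" if "b \<in> insert c (el c)" for b using \<mu>(3) that c Ord_trans[OF \<mu>(1) _ c] by blast
    then show "c \<in> hull x \<gamma>" using hull_captures[OF x g Ord_elem[OF \<mu>(1) c]] unfolding M_def by blast
  qed
  ultimately show ?thesis using that \<mu> unfolding M_def by blast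
qed

section \<open>Order types of sets of ordinals\<close>

definition otG :: "'a \<Rightarrow> 'a \<Rightarrow> 'a \<Rightarrow> 'a" where "otG B b h = setof (fn h ` (el B \<inter> el b))"

text \<open>\<open>ot B b\<close> is the order type of the members of \<open>B\<close> below \<open>b\<close>, computed as a transitive collapse.\<close>

definition ot :: "'a \<Rightarrow> 'a \<Rightarrow> 'a" where "ot = rec otG"

lemma Dg_otG: "Dg C otG" unfolding Dg_def otG_def by (intro allI) (rule dfb)+

lemma dft_ot[dfb]: "Dft C a \<Longrightarrow> Dft C b \<Longrightarrow> Dft C (\<lambda>e. ot (a e) (b e))"
  unfolding ot_def by (rule dft_rec[OF Dg_otG])

lemma ot_U[simp]: "B \<in> U \<Longrightarrow> ot B b \<in> U" unfolding ot_def by (rule rec_U[OF Dg_otG])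

lemma isset_Int: "A \<in> U \<Longrightarrow> B \<in> U \<Longrightarrow> isset (el A \<inter> el B)"
  using isset_sep[OF isset_el, of A "\<lambda>z. z \<in> el B", OF _ dfb_in[OF dft_var dfc_el[OF dft_const_U]]]
  by (simp add: Int_def)

lemma el_ot:
  assumes B: "B \<in> U" and b: "b \<in> Ord" shows "el (ot B b) = ot B ` (el B \<inter> el b)"
proof -
  have 1: "fn (lam (el b) (rec otG B)) ` (el B \<inter> el b) = rec otG B ` (el B \<inter> el b)"
    by (rule image_cong[OF refl]) (simp add: fn_rec[OF Dg_otG B b])
  have "isset (rec otG B ` (el B \<inter> el b))"
    by (rule isset_image[OF isset_Int[OF B Ord_U[OF b]]]) (rule dft_rec[OF Dg_otG] dfb dft_const_U[OF B])+
  then show ?thesis unfolding ot_def rec_eq[OF Dg_otG B b]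
    unfolding otG_def[of B b "lam (el b) (rec otG B)"] 1 by (rule el_setof)
qed

lemma ot_Ord:
  assumes B: "B \<in> U" and b: "b \<in> Ord" shows "ot B b \<in> Ord \<and> el (ot B b) \<subseteq> el b"
proof (rule Ord_induct[of "\<lambda>b. ot B b \<in> Ord \<and> el (ot B b) \<subseteq> el b", OF _ b])
  show "Dfb U (\<lambda>e. ot B (e 0) \<in> Ord \<and> el (ot B (e 0)) \<subseteq> el (e 0))" by (rule dfb dft_const_U[OF B])+
  fix b assume b: "b \<in> Ord" and IH: "\<And>c. c \<in> el b \<Longrightarrow> ot B c \<in> Ord \<and> el (ot B c) \<subseteq> el c"
  note e = el_ot[OF B b]
  show "ot B b \<in> Ord \<and> el (ot B b) \<subseteq> el b"
  proof
    show "el (ot B b) \<subseteq> el b"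
    proof
      fix z assume "z \<in> el (ot B b)"
      then obtain c where c: "c \<in> el b" "z = ot B c" using e by blast
      show "z \<in> el b" unfolding c(2)
        by (rule Ord_le_less[OF b conjunct1[OF IH[OF c(1)]] conjunct2[OF IH[OF c(1)]] c(1)])
    qed
    show "ot B b \<in> Ord"
    proof (rule OrdI)
      show "ot B b \<in> U" using B by simp
      fix u v assume u: "u \<in> el v" and "v \<in> el (ot B b)"
      then obtain c where c: "c \<in> el B" "c \<in> el b" "v = ot B c" using e by blast
      then obtain d where d: "d \<in> el B" "d \<in> el c" "u = ot B d" using u el_ot[OF B Ord_elem[OF b c(2)]] by blast
      then show "u \<in> el (ot B b)" unfolding e using Ord_trans[OF b d(2) c(2)] by blast
    next
      fix u v assume "u \<in> el (ot B b)" "v \<in> el (ot B b)"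
      then have "u \<in> Ord" "v \<in> Ord" using e IH by auto
      then show "u \<in> el v \<or> u = v \<or> v \<in> el u" by (rule Ord_linear)
    qed
  qed
qed

lemma ot_strict: "B \<in> U \<Longrightarrow> b \<in> Ord \<Longrightarrow> a \<in> el B \<Longrightarrow> a \<in> el b \<Longrightarrow> ot B a \<in> el (ot B b)"
  by (simp add: el_ot)

lemma ot_inj:
  assumes "B \<in> U" "a \<in> el B" "b \<in> el B" "a \<in> Ord" "b \<in> Ord" "ot B a = ot B b"
  shows "a = b"
  using Ord_linear[OF assms(4,5)] ot_strict[OF assms(1,5,2)] ot_strict[OF assms(1,4,3)] assms(6) no_self[of "ot B b"]
  by auto

section \<open>A bound for the order types of images of the reals\<close>

definition Reals :: "'a set" where "Reals = {x \<in> U. real_set x}"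

lemma isset_Reals[simp, intro]: "isset Reals"
  using isset_Pow[OF isset_omega] by (simp add: Reals_def real_set_def)

lemma dfc_Reals[dfb]: "Dfc C (\<lambda>e. Reals)"
  unfolding Reals_def real_set_def by (rule dfb)+

definition real_img :: "'a \<Rightarrow> 'a" where "real_img g = setof (fn g ` Reals)"

definition less_rel :: "'a \<Rightarrow> 'a" where
  "less_rel g = setof (\<Union>r\<in>Reals. (\<lambda>s. pair s r) ` {s \<in> Reals. fn g s \<in> el (fn g r)})"

definition ordval :: "'a \<Rightarrow> bool" where "ordval g \<longleftrightarrow> (\<forall>r\<in>Reals. fn g r \<in> Ord)"

lemma Reals_U[simp]: "r \<in> Reals \<Longrightarrow> r \<in> U" unfolding Reals_def by blast

lemma dft_real_img[dfb]: "Dft C a \<Longrightarrow> Dft C (\<lambda>e. real_img (a e))"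
  by (rule dft_lift1[of C real_img]) (unfold real_img_def, (rule dfb)+)

lemma dft_less_rel[dfb]: "Dft C a \<Longrightarrow> Dft C (\<lambda>e. less_rel (a e))"
  by (rule dft_lift1[of C less_rel]) (unfold less_rel_def, (rule dfb)+)

lemma dfb_ordval[dfb]: "Dft C a \<Longrightarrow> Dfb C (\<lambda>e. ordval (a e))"
  by (rule dfb_lift1[of C ordval]) (unfold ordval_def, (rule dfb)+)

lemma real_img_U[simp, intro]: "real_img g \<in> U" by (simp add: real_img_def)

lemma el_real_img: "g \<in> U \<Longrightarrow> el (real_img g) = fn g ` Reals"
  unfolding real_img_def by (rule el_setof[OF isset_image[OF isset_Reals]]) (rule dfb dft_const_U | assumption)+

lemma el_less_rel:
  assumes g: "g \<in> U"
  shows "el (less_rel g) = (\<Union>r\<in>Reals. (\<lambda>s. pair s r) ` {s \<in> Reals. fn g s \<in> el (fn g r)})"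
    "el (less_rel g) \<subseteq> (\<Union>r\<in>Reals. el (setof ((\<lambda>s. pair s r) ` Reals)))"
    "isset (\<Union>r\<in>Reals. el (setof ((\<lambda>s. pair s r) ` Reals)))"
proof -
  have 1: "isset ((\<lambda>s. pair s r) ` {s \<in> Reals. fn g s \<in> el (fn g r)})" if "r \<in> U" for r
    by (rule isset_image[OF isset_sep[OF isset_Reals]]) (rule dfb dft_const_U[OF g] dft_const_U[OF that])+
  have 2: "isset ((\<lambda>s. pair s r) ` Reals)" if "r \<in> U" for r
    by (rule isset_image[OF isset_Reals]) (rule dfb dft_const_U[OF that])+
  have "isset (\<Union>r\<in>Reals. el (setof ((\<lambda>s. pair s r) ` {s \<in> Reals. fn g s \<in> el (fn g r)})))"
    by (rule isset_UN[OF isset_Reals]) (rule dfb dft_const_U[OF g])+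
  then have "isset (\<Union>r\<in>Reals. (\<lambda>s. pair s r) ` {s \<in> Reals. fn g s \<in> el (fn g r)})"
    using 1 by (simp add: el_setof)
  then show e: "el (less_rel g) = (\<Union>r\<in>Reals. (\<lambda>s. pair s r) ` {s \<in> Reals. fn g s \<in> el (fn g r)})"
    unfolding less_rel_def by (rule el_setof)
  have "(\<Union>r\<in>Reals. el (setof ((\<lambda>s. pair s r) ` Reals))) = (\<Union>r\<in>Reals. (\<lambda>s. pair s r) ` Reals)"
    using 2 by (simp add: el_setof)
  then show "el (less_rel g) \<subseteq> (\<Union>r\<in>Reals. el (setof ((\<lambda>s. pair s r) ` Reals)))"
    unfolding e by auto
  show "isset (\<Union>r\<in>Reals. el (setof ((\<lambda>s. pair s r) ` Reals)))"
    by (rule isset_UN[OF isset_Reals]) (rule dfb)+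
qed

text \<open>The type of the values below \<open>g r\<close> is the set of the types of the values below \<open>g s\<close> for \<open>g s < g r\<close>, so it
  depends on the induced order only.\<close>

lemma ot_determined:
  assumes g: "g \<in> U" "ordval g" and h: "h \<in> U" "ordval h" and eq: "less_rel g = less_rel h" and r: "r \<in> Reals"
  shows "ot (real_img g) (fn g r) = ot (real_img h) (fn h r)"
proof -
  have less: "fn g s \<in> el (fn g r) \<longleftrightarrow> fn h s \<in> el (fn h r)" if sr: "s \<in> Reals" "r \<in> Reals" for s r
  proof -
    have "fn k s \<in> el (fn k r) \<longleftrightarrow> pair s r \<in> el (less_rel k)" if "k \<in> U" for k
      unfolding el_less_rel(1)[OF that] using sr by auto
    then show ?thesis using g h eq by simp
  qed
  have gO: "fn g r \<in> Ord" "fn h r \<in> Ord" if "r \<in> Reals" for r using g(2) h(2) that unfolding ordval_def by auto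
  have el1: "el (ot (real_img k) (fn k r)) = (\<lambda>s. ot (real_img k) (fn k s)) ` {s \<in> Reals. fn k s \<in> el (fn k r)}"
    if "k \<in> U" "fn k r \<in> Ord" for k r
    unfolding el_ot[OF real_img_U that(2)] el_real_img[OF that(1)] by auto
  have "\<forall>r\<in>Reals. fn g r = b \<longrightarrow> ot (real_img g) (fn g r) = ot (real_img h) (fn h r)" if "b \<in> Ord" for b
  proof (rule Ord_induct[of "\<lambda>b. \<forall>r\<in>Reals. fn g r = b \<longrightarrow> ot (real_img g) (fn g r) = ot (real_img h) (fn h r)", OF _ that])
    show "Dfb U (\<lambda>e. \<forall>r\<in>Reals. fn g r = e 0 \<longrightarrow> ot (real_img g) (fn g r) = ot (real_img h) (fn h r))"
      by (rule dfb dft_const_U[OF g(1)] dft_const_U[OF h(1)])+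
    fix b assume IH: "\<And>c. c \<in> el b \<Longrightarrow> \<forall>r\<in>Reals. fn g r = c \<longrightarrow> ot (real_img g) (fn g r) = ot (real_img h) (fn h r)"
    show "\<forall>r\<in>Reals. fn g r = b \<longrightarrow> ot (real_img g) (fn g r) = ot (real_img h) (fn h r)"
    proof (intro ballI impI)
      fix r assume r: "r \<in> Reals" "fn g r = b"
      have "{s \<in> Reals. fn g s \<in> el (fn g r)} = {s \<in> Reals. fn h s \<in> el (fn h r)}" using less r(1) by blast
      moreover have "ot (real_img g) (fn g s) = ot (real_img h) (fn h s)" if "s \<in> {s \<in> Reals. fn g s \<in> el (fn g r)}" for s
        using IH that r(2) by blast
      ultimately have "el (ot (real_img g) (fn g r)) = el (ot (real_img h) (fn h r))"
        unfolding el1[OF g(1) gO(1)[OF r(1)]] el1[OF h(1) gO(2)[OF r(1)]] by (metis (no_types, lifting) image_cong)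
      then show "ot (real_img g) (fn g r) = ot (real_img h) (fn h r)" by (rule el_ext[rotated 2]) simp_all
    qed
  qed
  then show ?thesis using r gO(1) by blast
qed

definition rel_type :: "'a \<Rightarrow> 'a \<Rightarrow> 'a" where
  "rel_type E r = uniq (\<lambda>v. \<exists>g\<in>U. ordval g \<and> less_rel g = E \<and> v = ot (real_img g) (fn g r))"

lemma dft_rel_type[dfb]: "Dft C a \<Longrightarrow> Dft C b \<Longrightarrow> Dft C (\<lambda>e. rel_type (a e) (b e))"
  by (rule dft_lift2[of C rel_type]) (unfold rel_type_def, (rule dfb)+)

text \<open>An order type of an image of the reals is determined by a real and a relation on the reals, so
  these order types form a set.\<close>

lemma ot_bound:
  obtains \<theta> where "\<theta> \<in> Ord" "\<And>g r. g \<in> U \<Longrightarrow> ordval g \<Longrightarrow> r \<in> Reals \<Longrightarrow> ot (real_img g) (fn g r) \<in> el \<theta>"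
proof -
  let ?W = "\<Union>r\<in>Reals. el (setof ((\<lambda>s. pair s r) ` Reals))"
  have W: "isset {y \<in> U. el y \<subseteq> ?W}" by (rule isset_Pow[OF el_less_rel(3)[OF emp_U]])
  define X where "X = (\<Union>E\<in>{y \<in> U. el y \<subseteq> ?W}. el (setof (rel_type E ` Reals)))"
  have X: "isset X" unfolding X_def by (rule isset_UN[OF W]) (rule dfb)+
  have "isset {z \<in> X. z \<in> Ord}" by (rule isset_sep[OF X]) (rule dfb)+
  then obtain \<theta> where \<theta>: "\<theta> \<in> Ord" "{z \<in> X. z \<in> Ord} \<subseteq> el \<theta>" using Ord_bound[of "{z \<in> X. z \<in> Ord}"] by blast
  have "ot (real_img g) (fn g r) \<in> el \<theta>" if g: "g \<in> U" "ordval g" and r: "r \<in> Reals" for g r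
  proof -
    have lU: "less_rel g \<in> U" by (simp add: less_rel_def)
    have "rel_type (less_rel g) r = ot (real_img g) (fn g r)" unfolding rel_type_def
    proof (rule uniq_eq)
      show "ot (real_img g) (fn g r) \<in> U" by simp
      show "\<exists>h\<in>U. ordval h \<and> less_rel h = less_rel g \<and> ot (real_img g) (fn g r) = ot (real_img h) (fn h r)"
        using g by blast
      fix v assume "\<exists>h\<in>U. ordval h \<and> less_rel h = less_rel g \<and> v = ot (real_img h) (fn h r)"
      then obtain h where h: "h \<in> U" "ordval h" "less_rel h = less_rel g" "v = ot (real_img h) (fn h r)" by blast
      show "v = ot (real_img g) (fn g r)" unfolding h(4) by (rule ot_determined[OF h(1,2) g h(3) r])
    qed
    moreover have "isset (rel_type (less_rel g) ` Reals)"
      by (rule isset_image[OF isset_Reals]) (rule dfb dft_const_U[OF lU])+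
    ultimately have "ot (real_img g) (fn g r) \<in> el (setof (rel_type (less_rel g) ` Reals))"
      using imageI[OF r, of "rel_type (less_rel g)"] by (simp only: el_setof)
    moreover have "less_rel g \<in> {y \<in> U. el y \<subseteq> ?W}" using lU el_less_rel(2)[OF g(1)] by blast
    ultimately have "ot (real_img g) (fn g r) \<in> X" unfolding X_def by (rule UN_I[rotated])
    moreover have "ot (real_img g) (fn g r) \<in> Ord"
      using ot_Ord[OF real_img_U] g(2) r unfolding ordval_def by blast
    ultimately show ?thesis using \<theta>(2) by blast
  qed
  with \<theta>(1) show ?thesis using that by blast
qed

section \<open>Collapsing an admissible ordinal in HOD\<close>

text \<open>\<open>enum_fn p \<xi>\<close> is the function sending a real \<open>y\<close> to the element with index \<open>\<xi>\<close> of the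
  enumeration for \<open>y\<close>, made ordinal valued.\<close>

definition enum_fn :: "'a \<Rightarrow> 'a \<Rightarrow> 'a" where
  "enum_fn p \<xi> = lam Reals (\<lambda>y. if enum y p \<xi> \<in> Ord then enum y p \<xi> else emp)"

text \<open>The code of \<open>b\<close> consists of the first index \<open>\<xi>\<close> at which \<open>b\<close> occurs for some real, and of the position of
  \<open>b\<close> among the ordinals occurring at \<open>\<xi>\<close>.  The second component of each pair in \<open>hcollapse p m\<close> is an ordinal
  below \<open>m\<close>, the first one is the position of its code among all codes.\<close>

definition first_ix :: "'a \<Rightarrow> 'a \<Rightarrow> 'a" where "first_ix p b = least (\<lambda>\<xi>. \<xi> \<in> el p \<and> b \<in> el (real_img (enum_fn p \<xi>)))"

definition hcode :: "'a \<Rightarrow> 'a \<Rightarrow> 'a" where "hcode p b = cp (first_ix p b) (ot (real_img (enum_fn p (first_ix p b))) b)"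

definition hcollapse :: "'a \<Rightarrow> 'a \<Rightarrow> 'a" where
  "hcollapse p m = setof ((\<lambda>b. pair (ot (setof (hcode p ` el m)) (hcode p b)) b) ` el m)"

lemma dft_enum_fn[dfb]: "Dft C a \<Longrightarrow> Dft C b \<Longrightarrow> Dft C (\<lambda>e. enum_fn (a e) (b e))"
  by (rule dft_lift2[of C enum_fn]) (unfold enum_fn_def, (rule dft_lam dfb)+)

lemma dft_first_ix[dfb]: "Dft C a \<Longrightarrow> Dft C b \<Longrightarrow> Dft C (\<lambda>e. first_ix (a e) (b e))"
  by (rule dft_lift2[of C first_ix]) (unfold first_ix_def, (rule dfb)+)

lemma dft_hcode[dfb]: "Dft C a \<Longrightarrow> Dft C b \<Longrightarrow> Dft C (\<lambda>e. hcode (a e) (b e))"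
  by (rule dft_lift2[of C hcode]) (unfold hcode_def, (rule dfb)+)

lemma dft_hcollapse[dfb]: "Dft C a \<Longrightarrow> Dft C b \<Longrightarrow> Dft C (\<lambda>e. hcollapse (a e) (b e))"
  by (rule dft_lift2[of C hcollapse]) (unfold hcollapse_def, (rule dfb)+)

lemma enum_fn_U[simp, intro]: "enum_fn p \<xi> \<in> U" by (simp add: enum_fn_def)

lemma fn_enum_fn:
  assumes p: "p \<in> U" "\<xi> \<in> U" and y: "y \<in> Reals"
  shows "fn (enum_fn p \<xi>) y = (if enum y p \<xi> \<in> Ord then enum y p \<xi> else emp)"
  unfolding enum_fn_def by (rule fn_lam[OF isset_Reals _ y]) (rule dfb dft_const_U[OF p(1)] dft_const_U[OF p(2)])+

lemma ordval_enum_fn: "p \<in> U \<Longrightarrow> \<xi> \<in> U \<Longrightarrow> ordval (enum_fn p \<xi>)"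
  unfolding ordval_def by (simp add: fn_enum_fn)

text \<open>The real \<open>x\<close> guarantees that every ordinal below \<open>\<mu>\<close> has a code.  As the codes are defined by
  quantifying over all reals, they form a map that is definable from \<open>\<gamma>\<close> and \<open>\<mu>\<close>.\<close>

lemma no_HOD_cardinal_in_hull:
  assumes g: "cpclosed \<gamma>" and \<theta>: "\<theta> \<in> el \<gamma>"
    and bound: "\<And>g r. g \<in> U \<Longrightarrow> ordval g \<Longrightarrow> r \<in> Reals \<Longrightarrow> ot (real_img g) (fn g r) \<in> el \<theta>"
    and x: "x \<in> Reals" and \<mu>: "\<mu> \<in> Ord" "\<gamma> \<in> el \<mu>" "el \<mu> \<subseteq> hull x \<gamma>"
  shows "\<not> set_structure.cardinal HOD mem \<mu>"
proof -
  have gO: "\<gamma> \<in> Ord" and cl: "\<And>a b. a \<in> el \<gamma> \<Longrightarrow> b \<in> el \<gamma> \<Longrightarrow> cp a b \<in> el \<gamma>"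
    using g unfolding cpclosed_def by auto
  have gU: "\<gamma> \<in> U" and \<mu>U: "\<mu> \<in> U" using gO \<mu>(1) by simp_all
  have first_ix: "first_ix \<gamma> b \<in> el \<gamma>" "b \<in> el (real_img (enum_fn \<gamma> (first_ix \<gamma> b)))" if b: "b \<in> el \<mu>" for b
  proof -
    obtain \<xi> where \<xi>: "\<xi> \<in> el \<gamma>" "b = enum x \<gamma> \<xi>" using \<mu>(3) b unfolding hull_def by blast
    have bU: "b \<in> U" using b by simp
    have "b \<in> Ord" by (rule Ord_elem[OF \<mu>(1) b])
    then have "b = fn (enum_fn \<gamma> \<xi>) x" using fn_enum_fn[OF gU el_U[OF \<xi>(1)] x] \<xi>(2) by simp
    then have "b \<in> el (real_img (enum_fn \<gamma> \<xi>))" using el_real_img[OF enum_fn_U] x by blast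
    then have 1: "\<xi> \<in> el \<gamma> \<and> b \<in> el (real_img (enum_fn \<gamma> \<xi>))" using \<xi>(1) by blast
    have "Dfb U (\<lambda>e. e 0 \<in> el \<gamma> \<and> b \<in> el (real_img (enum_fn \<gamma> (e 0))))"
      by (rule dfb dft_const_U[OF gU] dft_const_U[OF bU])+
    from least(2)[of "\<lambda>\<xi>. \<xi> \<in> el \<gamma> \<and> b \<in> el (real_img (enum_fn \<gamma> \<xi>))", OF this Ord_elem[OF gO \<xi>(1)] 1]
    show "first_ix \<gamma> b \<in> el \<gamma>" "b \<in> el (real_img (enum_fn \<gamma> (first_ix \<gamma> b)))" unfolding first_ix_def by simp_all
  qed
  have otb: "ot (real_img (enum_fn \<gamma> (first_ix \<gamma> b))) b \<in> el \<gamma>" if b: "b \<in> el \<mu>" for b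
  proof -
    obtain r where r: "r \<in> Reals" "b = fn (enum_fn \<gamma> (first_ix \<gamma> b)) r" using first_ix(2)[OF b] el_real_img[OF enum_fn_U] by blast
    have "ot (real_img (enum_fn \<gamma> (first_ix \<gamma> b))) (fn (enum_fn \<gamma> (first_ix \<gamma> b)) r) \<in> el \<theta>"
      by (rule bound[OF enum_fn_U ordval_enum_fn[OF gU el_U[OF first_ix(1)[OF b]]] r(1)])
    then have "ot (real_img (enum_fn \<gamma> (first_ix \<gamma> b))) b \<in> el \<theta>" using r(2) by simp
    then show ?thesis using Ord_trans[OF gO _ \<theta>] by blast
  qed
  have bO: "b \<in> Ord" if "b \<in> el \<mu>" for b by (rule Ord_elem[OF \<mu>(1) that])
  have gel: "a \<in> Ord" if "a \<in> el \<gamma>" for a by (rule Ord_elem[OF gO that])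
  have hcode: "hcode \<gamma> b \<in> el \<gamma>" if b: "b \<in> el \<mu>" for b unfolding hcode_def by (rule cl[OF first_ix(1)[OF b] otb[OF b]])
  have hcode_inj: "b = c" if b: "b \<in> el \<mu>" and c: "c \<in> el \<mu>" and e: "hcode \<gamma> b = hcode \<gamma> c" for b c
  proof -
    have "first_ix \<gamma> b = first_ix \<gamma> c \<and> ot (real_img (enum_fn \<gamma> (first_ix \<gamma> b))) b = ot (real_img (enum_fn \<gamma> (first_ix \<gamma> c))) c"
      by (rule cp_inject[OF gel[OF first_ix(1)[OF b]] gel[OF otb[OF b]] gel[OF first_ix(1)[OF c]] gel[OF otb[OF c]]])
         (use e in \<open>simp add: hcode_def\<close>)
    then have "c \<in> el (real_img (enum_fn \<gamma> (first_ix \<gamma> b)))"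
      "ot (real_img (enum_fn \<gamma> (first_ix \<gamma> b))) b = ot (real_img (enum_fn \<gamma> (first_ix \<gamma> b))) c"
      using first_ix(2)[OF c] by metis+
    then show ?thesis by (rule ot_inj[OF real_img_U first_ix(2)[OF b] _ bO[OF b] bO[OF c]])
  qed
  define B where "B = setof (hcode \<gamma> ` el \<mu>)"
  have "isset (hcode \<gamma> ` el \<mu>)" by (rule isset_image[OF isset_el[OF \<mu>U]]) (rule dfb dft_const_U[OF gU])+
  then have B: "el B = hcode \<gamma> ` el \<mu>" unfolding B_def by (rule el_setof)
  have BU: "B \<in> U" by (simp add: B_def)
  \<comment> \<open>the type of the set of all codes, which is at most \<open>\<gamma>\<close> and hence below \<open>\<mu>\<close>\<close>
  define \<tau> where "\<tau> = ot B \<gamma>"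
  have "el B \<inter> el \<gamma> = hcode \<gamma> ` el \<mu>" using B hcode by blast
  then have el\<tau>: "el \<tau> = ot B ` hcode \<gamma> ` el \<mu>" unfolding \<tau>_def el_ot[OF BU gO] by simp
  have "\<tau> \<in> Ord" "el \<tau> \<subseteq> el \<gamma>" unfolding \<tau>_def using ot_Ord[OF BU gO] by simp_all
  then have \<tau>\<mu>: "\<tau> \<in> el \<mu>" using Ord_le_less[OF \<mu>(1) _ _ \<mu>(2)] by blast
  define f where "f = hcollapse \<gamma> \<mu>"
  have fU: "f \<in> U" by (simp add: f_def hcollapse_def)
  have el_f: "el f = (\<lambda>b. pair (ot B (hcode \<gamma> b)) b) ` el \<mu>"
    unfolding f_def hcollapse_def B_def[symmetric]
    by (rule el_setof[OF isset_image[OF isset_el[OF \<mu>U]]]) (rule dfb dft_const_U[OF gU] dft_const_U[OF BU])+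
  have app: "app f a b \<longleftrightarrow> b \<in> el \<mu> \<and> a = ot B (hcode \<gamma> b)" if "a \<in> U" "b \<in> U" for a b
    unfolding app_iff[OF fU that] el_f using that BU by auto
  have col_inj: "b = c" if b: "b \<in> el \<mu>" and c: "c \<in> el \<mu>" and e: "ot B (hcode \<gamma> b) = ot B (hcode \<gamma> c)" for b c
  proof -
    have "hcode \<gamma> b = hcode \<gamma> c"
      by (rule ot_inj[OF BU _ _ gel[OF hcode[OF b]] gel[OF hcode[OF c]] e]) (use B b c in auto)
    then show ?thesis by (rule hcode_inj[OF b c])
  qed
  have in\<tau>: "ot B (hcode \<gamma> b) \<in> el \<tau>" if "b \<in> el \<mu>" for b using el\<tau> that by blast
  have "bijection f (el \<tau>) (el \<mu>)" unfolding bijection_def maps_def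
  proof (intro conjI ballI)
    fix p assume "p \<in> el f"
    then obtain b where b: "b \<in> el \<mu>" "p = pair (ot B (hcode \<gamma> b)) b" using el_f by blast
    then have "is_pair (ot B (hcode \<gamma> b)) b p" using BU by simp
    then show "\<exists>a\<in>el \<tau>. \<exists>b\<in>el \<mu>. is_pair a b p" using in\<tau>[OF b(1)] b(1) by blast
  next
    fix a assume a: "a \<in> el \<tau>"
    then obtain b where b: "b \<in> el \<mu>" "a = ot B (hcode \<gamma> b)" using el\<tau> by blast
    show "\<exists>!b. b \<in> el \<mu> \<and> app f a b"
    proof (rule ex1I[of _ b])
      show "b \<in> el \<mu> \<and> app f a b" using app[OF el_U[OF a] el_U[OF b(1)]] b by blast
      fix c assume c: "c \<in> el \<mu> \<and> app f a c"
      then have "a = ot B (hcode \<gamma> c)" using app[OF el_U[OF a]] el_U by blast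
      then show "c = b" using col_inj[OF _ b(1)] c b(2) by blast
    qed
  next
    fix b assume b: "b \<in> el \<mu>"
    show "\<exists>!a. a \<in> el \<tau> \<and> app f a b"
    proof (rule ex1I[of _ "ot B (hcode \<gamma> b)"])
      show "ot B (hcode \<gamma> b) \<in> el \<tau> \<and> app f (ot B (hcode \<gamma> b)) b"
        using app[OF el_U[OF in\<tau>[OF b]] el_U[OF b]] in\<tau>[OF b] b by blast
      fix a assume "a \<in> el \<tau> \<and> app f a b"
      then show "a = ot B (hcode \<gamma> b)" using app[OF el_U el_U[OF b]] by blast
    qed
  qed
  moreover have "f \<in> OD"
  proof (rule OD_intro[of "\<lambda>z. z = f"])
    show "Dfb Ord (\<lambda>e. e 0 = f)" unfolding f_def
      by (rule dfb dft_const[OF gU gO] dft_const[OF \<mu>U \<mu>(1)])+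
  qed (simp_all add: fU)
  ultimately show ?thesis using not_HOD_cardinal[OF _ _ \<mu>(1) \<tau>\<mu>] by blast
qed

lemma HP_HOD_fails: "\<not> HP HOD"
proof
  assume "HP HOD"
  then obtain x where x: "x \<in> U" "real_set x"
    "\<And>a. a \<in> U \<Longrightarrow> ordinal a \<Longrightarrow> admissible x a \<Longrightarrow> set_structure.cardinal HOD mem a"
    unfolding HP_def by blast
  have xR: "x \<in> Reals" using x unfolding Reals_def by blast
  obtain \<theta> where \<theta>: "\<theta> \<in> Ord"
    "\<And>g r. g \<in> U \<Longrightarrow> ordval g \<Longrightarrow> r \<in> Reals \<Longrightarrow> ot (real_img g) (fn g r) \<in> el \<theta>"
    by (rule ot_bound, rule that)
  define \<beta> where "\<beta> = sc (omax \<theta> om)"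
  have o: "omax \<theta> om \<in> Ord" "el (omax \<theta> om) = el \<theta> \<union> el om" using omax[OF \<theta>(1) om_Ord] by blast+
  have \<beta>: "\<beta> \<in> Ord" unfolding \<beta>_def using o by simp
  obtain \<gamma> where \<gamma>: "\<gamma> \<in> Ord" "limit_ordinal \<gamma>" "\<beta> \<in> el \<gamma>" "\<And>a b. a \<in> el \<gamma> \<Longrightarrow> b \<in> el \<gamma> \<Longrightarrow> cp a b \<in> el \<gamma>"
    by (rule cp_closure[OF \<beta>], rule that)
  have m: "omax \<theta> om \<in> el \<gamma>" using Ord_trans[OF \<gamma>(1) _ \<gamma>(3)] o unfolding \<beta>_def by simp
  have \<theta>\<gamma>: "\<theta> \<in> el \<gamma>" and og: "om \<in> el \<gamma>"
    using Ord_le_less[OF \<gamma>(1) _ _ m] o(2) \<theta>(1) om_Ord by blast+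
  have g: "cpclosed \<gamma>" unfolding cpclosed_def using \<gamma> og by blast
  obtain \<mu> where \<mu>: "\<mu> \<in> Ord" "admissible x \<mu>" "\<gamma> \<in> el \<mu>" "el \<mu> \<subseteq> hull x \<gamma>"
    by (rule admissible_in_hull[OF x(1) g], rule that)
  have "ordinal \<mu>" using \<mu>(1) unfolding Ord_def by blast
  then have "set_structure.cardinal HOD mem \<mu>" using x(3)[OF Ord_U[OF \<mu>(1)]] \<mu>(2) by blast
  moreover have "\<not> set_structure.cardinal HOD mem \<mu>"
    by (rule no_HOD_cardinal_in_hull[OF g \<theta>\<gamma> \<theta>(2) xR \<mu>(1,3,4)])
  ultimately show False by blast
qed

end

theorem theorem3p14:
  fixes U :: "'a set" and mem :: "'a \<Rightarrow> 'a \<Rightarrow> bool"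
  assumes "set_structure.ZF U mem"
    and "set_structure.AD_L_R U mem"
  shows "\<not> set_structure.HP U mem (set_structure.HOD U mem)"
proof -
  interpret zf U mem by unfold_locales (rule assms(1))
  show ?thesis by (rule HP_HOD_fails)
qed

end
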